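(* Each of the following categories of semigroups (with $(2,1,1)$-homomorphisms as morphisms) is isomorphic to the corresponding category of chain projection ordered categories (with chain projection ordered functors as morphisms): (1) generalized regular $\circ$-semigroups, and chain projection ordered groupoids; (2) $P$-restriction semigroups, and symmetric chain projection ordered categories; (3) regular $\circ$-semigroups, and symmetric chain projection ordered groupoids; (4) restriction semigroups, and commutative chain projection ordered categories; (5) inverse semigroups, and commutative chain projection ordered groupoids.
   Context: Maps are written on the right and composed from left to right. **Semigroups.** A generalized regular $\circ$-semigroup is a semigroup with a unary operation ${}^\circ$ satisfying $xx^\circ x=x$, $x^{\circ\circ}=x$, $(xy)^\circ=(xy)^\circ xx^\circ$, $(xy)^\circ=y^\circ y(xy)^\circ$, $(xy)^\circ x=(x^\circ xy)^\circ$. A regular $\circ$-semigroup satisfies $xx^\circ x=x$, $x^{\circ\circ}=x$, $(xy)^\circ=y^\circ x^\circ$. An inverse semigroup is a regular $\circ$-semigroup (with ${}^\circ$ the inverse) also satisfying $xx^\circ yy^\circ=yy^\circ xx^\circ$. Each of these is regarded as a bi-unary semigroup $(S,\cdot,{}^+,{}^\ast)$ via $x^+=xx^\circ$, $x^\ast=x^\circ x$. A $P$-restriction semigroup is a bi-unary semigroup $(S,\cdot,{}^+,{}^\ast)$ with $x^+x=x$, $(xy)^+=(xy^+)^+$, $(x^+y^+)^+=x^+y^+x^+$, $x^+x^+=x^+$, $x^{+\ast}=x^+$, $xx^\ast=x$, $(xy)^\ast=(x^\ast y)^\ast$, $(x^\ast y^\ast)^\ast=y^\ast x^\ast y^\ast$,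 $x^\ast x^\ast=x^\ast$, $x^{\ast+}=x^\ast$, $(xy)^+x=xy^+x^\ast$, $x(yx)^\ast=x^+y^\ast x$. A restriction semigroup is a bi-unary semigroup with $x^+x=x$, $x^+y^+=y^+x^+=(x^+y^+)^+$, $x^+(xy)^+=(xy)^+=(xy^+)^+$, $x^{+\ast}=x^+$, $xx^\ast=x$, $x^\ast y^\ast=y^\ast x^\ast=(x^\ast y^\ast)^\ast$, $(xy)^\ast y^\ast=(xy)^\ast=(x^\ast y)^\ast$, $x^{\ast+}=x^\ast$, $(xy)^+x=xy^+$, $x(yx)^\ast=y^\ast x$. A $(2,1,1)$-homomorphism is a map preserving $\cdot$, ${}^+$ and ${}^\ast$. **Projection algebras.** A projection algebra $(P,\times,\star)$ is a nonempty set with two binary operations such that for all $e,f,g\in P$: (L1) $e\times e=e$; (L2) $(e\times f)\times e=e\times f$; (L3) $e\times(f\times g)=(e\times f)\times(f\times g)$; (L4) $(e\times f)\times g=(e\times f)\times(e\times g)$; (R1) $e\star e=e$; (R2) $f\star e=e\star(f\star e)$; (R3) $(g\star f)\star e=(g\star f)\star(f\star e)$; (R4) $g\star(f\star e)=(g\star e)\star(f\star e)$; (P3) $(e\star(f\times g))\star g=(e\star f)\star g$ and $g\times((g\star f)\times e)=g\times(f\times e)$; (P4) $(e\times f)\star e=e\times f$ and $f\times(e\star f)=e\star f$. It is strong if moreover $e\times(((e\times f)\times g)\star f)=(e\times f)\times g$ and $(f\times(g\star(f\star e)))\star e=g\star(f\star e)$ for all $e,f,g$. A strong projection algebra is symmetric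 if $e\times f=f\star e$ for all $e,f$, and commutative if $e\times f=f\times e$ for all $e,f$. The natural partial order is $e\leq_P f\iff e=f\times e$. Write $p\,\mathcal F_P\,q$ iff $p\times q=p$ and $p\star q=q$. **Ordered categories.** A (small) category $(C,\circ,\mathbf d,\mathbf r)$ is a nonempty set $C$ with a partial binary operation $\circ$ and maps $\mathbf d,\mathbf r:C\to C$ such that: $x\circ y$ is defined iff $\mathbf r(x)=\mathbf d(y)$, and then $\mathbf d(x\circ y)=\mathbf d(x)$, $\mathbf r(x\circ y)=\mathbf r(y)$; $(x\circ y)\circ z=x\circ(y\circ z)$ whenever $x\circ y$, $y\circ z$ are defined; $\mathbf d(x)\circ x$ and $x\circ\mathbf r(x)$ are defined and both equal $x$. Its set of objects is $P_C=\{\mathbf d(x):x\in C\}=\{\mathbf r(x):x\in C\}$. It is a groupoid if for each $a$ there is $a'$ with $a\circ a'=\mathbf d(a)$, $a'\circ a=\mathbf r(a)$. An ordered category has in addition a partial order $\leq$ on $C$ with: (O1) $a\leq b$ implies $\mathbf d(a)\leq\mathbf d(b)$ and $\mathbf r(a)\leq\mathbf r(b)$; (O2) $a\leq b$, $c\leq d$, $\mathbf r(a)=\mathbf d(c)$, $\mathbf r(b)=\mathbf d(d)$ imply $a\circ c\leq b\circ d$; (O3) if $p\in P_C$, $p\leq\mathbf d(a)$, there is a unique $u\leq a$ with $\mathbf d(u)=p$, denoted ${}_p{\downharpoonleft}a$; (O4) if $q\in P_C$, $q\leq\mathbf r(a)$, there is a unique $v\leq a$ with $\mathbf r(v)=q$,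 denoted $a{\downharpoonright}_q$. **Path category.** For a strong projection algebra $P$, $\mathscr P(P)$ is the set of all tuples ($P$-paths) $(p_1,\dots,p_k)$, $k\geq1$, $p_i\in P$, with $p_1\,\mathcal F_P\,p_2\,\mathcal F_P\cdots\mathcal F_P\,p_k$. Put $\mathbf d(p_1,\dots,p_k)=p_1$, $\mathbf r(p_1,\dots,p_k)=p_k$ (identifying $p$ with the path $(p)$), and $(p_1,\dots,p_k)\circ(q_1,\dots,q_l)=(p_1,\dots,p_k,q_2,\dots,q_l)$ when $p_k=q_1$. For $q\leq_P p_1$ put ${}_q{\downharpoonleft}(p_1,\dots,p_k)=(q_1,\dots,q_k)$ with $q_1=q$, $q_i=q_{i-1}\star p_i$. Order: $\mathfrak p\leq_{\mathscr P}\mathfrak q$ iff $\mathfrak p={}_r{\downharpoonleft}\mathfrak q$ for some $r\leq_P\mathbf d(\mathfrak q)$. **Chain projection ordered categories.** A weak projection ordered category $(C,\circ,\mathbf d,\mathbf r,\leq,P_C,\times,\star)$ is an ordered category with operations $\times,\star$ making $P_C$ a strong projection algebra such that for $p,q\in P_C$: $p\leq q\iff p\leq_{P_C}q$. For $s\in P_C$ put $s^\downarrow=\{x\in P_C: x\leq s\}$ (a subalgebra). For $a\in C$ let $\nu_a:\mathbf d(a)^\downarrow\to\mathbf r(a)^\downarrow$, $p\mapsto\mathbf r({}_p{\downharpoonleft}a)$; and for $x\in P_C$ let $x\Theta_a=\mathbf r({}_{x\star\mathbf d(a)}{\downharpoonleft}a)$, $x\Delta_a=\mathbf d(a{\downharpoonright}_{\mathbf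 r(a)\times x})$. It is a projection ordered category if every $\nu_a$ is a homomorphism of projection algebras. An evaluation map is a map $\varepsilon:\mathscr P(P_C)\to C$ such that for all $p\in P_C$ and $\mathfrak p,\mathfrak q\in\mathscr P(P_C)$: (E1) $\varepsilon(p)=\varepsilon(p,p)=p$; (E2) $\mathbf d(\varepsilon(\mathfrak p))=\mathbf d(\mathfrak p)$, $\mathbf r(\varepsilon(\mathfrak p))=\mathbf r(\mathfrak p)$; (E3) $\varepsilon(\mathfrak p\circ\mathfrak q)=\varepsilon(\mathfrak p)\circ\varepsilon(\mathfrak q)$ when $\mathfrak p\circ\mathfrak q$ is defined; (E4) $\mathfrak p\leq_{\mathscr P}\mathfrak q$ implies $\varepsilon(\mathfrak p)\leq\varepsilon(\mathfrak q)$. For $b\in C$, a pair $(e,f)\in P_C\times P_C$ is $b$-linked if $f=(e\Theta_b)\star f$ and $e=e\times(f\Delta_b)$. For such a pair put $e_1=e\star\mathbf d(b)$, $e_2=f\Delta_b$, $f_1=e\Theta_b$, $f_2=\mathbf r(b)\times f$, and (all composites are defined) $\lambda(e,b,f)=\varepsilon(e,e_1)\circ{}_{e_1}{\downharpoonleft}b\circ\varepsilon(f_1,f)$, $\rho(e,b,f)=\varepsilon(e,e_2)\circ{}_{e_2}{\downharpoonleft}b\circ\varepsilon(f_2,f)$. A chain projection ordered category $(C,\circ,\mathbf d,\mathbf r,\leq,P_C,\times,\star,\varepsilon)$ is a projection ordered category with an evaluation map $\varepsilon$ such that (G2) $\lambda(e,b,f)=\rho(e,b,f)$ for all $b\in C$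 and all $b$-linked pairs $(e,f)$. It is: a chain projection ordered groupoid if $(C,\circ,\mathbf d,\mathbf r)$ is a groupoid; symmetric if $(P_C,\times,\star)$ is symmetric and $p\,\mathcal F_{P_C}\,q$ implies $\varepsilon(p,q,p)=p$ for all $p,q\in P_C$; commutative if $(P_C,\times,\star)$ is commutative; a symmetric (commutative) chain projection ordered groupoid if it is symmetric (commutative) and a groupoid. **Chain projection ordered functors.** A map $\phi:C_1\to C_2$ between chain projection ordered categories (with evaluation maps $\varepsilon_1,\varepsilon_2$) is a chain projection ordered functor if: (F1) $\mathbf d(a\phi)=(\mathbf d(a))\phi$, $\mathbf r(a\phi)=(\mathbf r(a))\phi$; (F2) $(a\circ b)\phi=(a\phi)\circ(b\phi)$ whenever $a\circ b$ is defined; (F3) $a\leq b$ implies $a\phi\leq b\phi$; (F4) $(e\times f)\phi=e\phi\times f\phi$ and $(e\star f)\phi=e\phi\star f\phi$ for $e,f\in P_{C_1}$; (F5) $(\varepsilon_1(p_1,\dots,p_k))\phi=\varepsilon_2(p_1\phi,\dots,p_k\phi)$ for all $(p_1,\dots,p_k)\in\mathscr P(P_{C_1})$. *)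

theory Defs
  imports "HOL-Library.FuncSet"
begin

text \<open>
  Every structure below lives on a nonempty subset of a type \<open>'a\<close>, which plays the role of the
  universe of elements. All operations are required to be extensional (\<open>\<rightarrow>\<^sub>E\<close>, or
  \<open>None\<close> for partial operations), so that equality of structures is equality of
  their carriers and of their operations on the carriers, as in set theory.
\<close>

unbundle no trancl_syntax and no rtrancl_syntax


section \<open>Categories and isomorphism of categories\<close>

text \<open>Composition is written from left to right: \<open>Comp \<C> f g\<close> is first \<open>f\<close>, then \<open>g\<close>.\<close>

record ('o, 'm) category =
  Obj :: "'o set"
  Mor :: "'m set"
  Dom :: "'m \<Rightarrow> 'o"
  Cod :: "'m \<Rightarrow> 'o"
  Ident :: "'o \<Rightarrow> 'm"
  Comp :: "'m \<Rightarrow> 'm \<Rightarrow> 'm"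

definition is_category :: "('o, 'm) category \<Rightarrow> bool" where
  "is_category \<C> \<longleftrightarrow>
     (\<forall>f\<in>Mor \<C>. Dom \<C> f \<in> Obj \<C> \<and> Cod \<C> f \<in> Obj \<C>) \<and>
     (\<forall>A\<in>Obj \<C>. Ident \<C> A \<in> Mor \<C> \<and> Dom \<C> (Ident \<C> A) = A \<and> Cod \<C> (Ident \<C> A) = A) \<and>
     (\<forall>f\<in>Mor \<C>. \<forall>g\<in>Mor \<C>. Cod \<C> f = Dom \<C> g \<longrightarrow>
        Comp \<C> f g \<in> Mor \<C> \<and> Dom \<C> (Comp \<C> f g) = Dom \<C> f \<and> Cod \<C> (Comp \<C> f g) = Cod \<C> g) \<and>
     (\<forall>f\<in>Mor \<C>. Comp \<C> (Ident \<C> (Dom \<C> f)) f = f \<and> Comp \<C> f (Ident \<C> (Cod \<C> f)) = f) \<and>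
     (\<forall>f\<in>Mor \<C>. \<forall>g\<in>Mor \<C>. \<forall>h\<in>Mor \<C>. Cod \<C> f = Dom \<C> g \<and> Cod \<C> g = Dom \<C> h \<longrightarrow>
        Comp \<C> (Comp \<C> f g) h = Comp \<C> f (Comp \<C> g h))"

definition is_functor ::
  "('o1, 'm1) category \<Rightarrow> ('o2, 'm2) category \<Rightarrow> ('o1 \<Rightarrow> 'o2) \<Rightarrow> ('m1 \<Rightarrow> 'm2) \<Rightarrow> bool" where
  "is_functor \<C> \<D> Fo Fm \<longleftrightarrow>
     Fo \<in> Obj \<C> \<rightarrow> Obj \<D> \<and> Fm \<in> Mor \<C> \<rightarrow> Mor \<D> \<and>
     (\<forall>f\<in>Mor \<C>. Dom \<D> (Fm f) = Fo (Dom \<C> f) \<and> Cod \<D> (Fm f) = Fo (Cod \<C> f)) \<and>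
     (\<forall>A\<in>Obj \<C>. Fm (Ident \<C> A) = Ident \<D> (Fo A)) \<and>
     (\<forall>f\<in>Mor \<C>. \<forall>g\<in>Mor \<C>. Cod \<C> f = Dom \<C> g \<longrightarrow> Fm (Comp \<C> f g) = Comp \<D> (Fm f) (Fm g))"

definition isomorphic_categories :: "('o1, 'm1) category \<Rightarrow> ('o2, 'm2) category \<Rightarrow> bool"
    (infix "\<cong>\<^sub>C" 50) where
  "\<C> \<cong>\<^sub>C \<D> \<longleftrightarrow>
     is_category \<C> \<and> is_category \<D> \<and>
     (\<exists>Fo Fm Go Gm. is_functor \<C> \<D> Fo Fm \<and> is_functor \<D> \<C> Go Gm \<and>
        (\<forall>A\<in>Obj \<C>. Go (Fo A) = A) \<and> (\<forall>f\<in>Mor \<C>. Gm (Fm f) = f) \<and>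
        (\<forall>B\<in>Obj \<D>. Fo (Go B) = B) \<and> (\<forall>g\<in>Mor \<D>. Fm (Gm g) = g))"

text \<open>
  The category of structures satisfying \<open>obj\<close>, with carriers given by \<open>car\<close>, whose morphisms
  from \<open>A\<close> to \<open>B\<close> are the (extensional) maps between the carriers satisfying \<open>hom A B\<close>.
\<close>

definition structure_category ::
  "('s \<Rightarrow> bool) \<Rightarrow> ('s \<Rightarrow> 'a set) \<Rightarrow> ('s \<Rightarrow> 's \<Rightarrow> ('a \<Rightarrow> 'a) \<Rightarrow> bool)
    \<Rightarrow> ('s, 's \<times> ('a \<Rightarrow> 'a) \<times> 's) category" where
  "structure_category obj car hom =
     \<lparr> Obj = {A. obj A},
       Mor = {(A, f, B). obj A \<and> obj B \<and> f \<in> car A \<rightarrow>\<^sub>E car B \<and> hom A B f},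
       Dom = (\<lambda>(A, f, B). A),
       Cod = (\<lambda>(A, f, B). B),
       Ident = (\<lambda>A. (A, \<lambda>x\<in>car A. x, A)),
       Comp = (\<lambda>(A, f, B) (B', g, C). (A, compose (car A) g f, C)) \<rparr>"


section \<open>Semigroups with unary operations\<close>

record 'a semigrp =
  elems :: "'a set"
  mul :: "'a \<Rightarrow> 'a \<Rightarrow> 'a" (infixl "\<cdot>\<index>" 70)

record 'a circ_semigrp = "'a semigrp" +
  circ :: "'a \<Rightarrow> 'a" ("_\<degree>\<index>" [1000] 1000)

record 'a biunary_semigrp = "'a semigrp" +
  splus :: "'a \<Rightarrow> 'a" ("_\<^sup>+\<index>" [1000] 1000)
  sast :: "'a \<Rightarrow> 'a" ("_\<^sup>*\<index>" [1000] 1000)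

locale semigrp =
  fixes S (structure)
  assumes nonempty: "elems S \<noteq> {}"
    and mul_closed: "(\<cdot>) \<in> elems S \<rightarrow>\<^sub>E elems S \<rightarrow>\<^sub>E elems S"
    and assoc: "\<lbrakk>x \<in> elems S; y \<in> elems S; z \<in> elems S\<rbrakk> \<Longrightarrow> (x \<cdot> y) \<cdot> z = x \<cdot> (y \<cdot> z)"

locale circ_semigrp = semigrp +
  assumes circ_closed: "circ S \<in> elems S \<rightarrow>\<^sub>E elems S"

locale generalized_regular_circ_semigrp = circ_semigrp +
  assumes "x \<in> elems S \<Longrightarrow> x \<cdot> x\<degree> \<cdot> x = x"
    and "x \<in> elems S \<Longrightarrow> x\<degree>\<degree> = x"
    and "\<lbrakk>x \<in> elems S; y \<in> elems S\<rbrakk> \<Longrightarrow> (x \<cdot> y)\<degree> = (x \<cdot> y)\<degree> \<cdot> x \<cdot> x\<degree>"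
    and "\<lbrakk>x \<in> elems S; y \<in> elems S\<rbrakk> \<Longrightarrow> (x \<cdot> y)\<degree> = y\<degree> \<cdot> y \<cdot> (x \<cdot> y)\<degree>"
    and "\<lbrakk>x \<in> elems S; y \<in> elems S\<rbrakk> \<Longrightarrow> (x \<cdot> y)\<degree> \<cdot> x = (x\<degree> \<cdot> x \<cdot> y)\<degree>"

locale regular_circ_semigrp = circ_semigrp +
  assumes "x \<in> elems S \<Longrightarrow> x \<cdot> x\<degree> \<cdot> x = x"
    and "x \<in> elems S \<Longrightarrow> x\<degree>\<degree> = x"
    and "\<lbrakk>x \<in> elems S; y \<in> elems S\<rbrakk> \<Longrightarrow> (x \<cdot> y)\<degree> = y\<degree> \<cdot> x\<degree>"

locale inverse_semigrp = regular_circ_semigrp +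
  assumes "\<lbrakk>x \<in> elems S; y \<in> elems S\<rbrakk> \<Longrightarrow> x \<cdot> x\<degree> \<cdot> y \<cdot> y\<degree> = y \<cdot> y\<degree> \<cdot> x \<cdot> x\<degree>"

locale biunary_semigrp = semigrp +
  assumes plus_closed: "splus S \<in> elems S \<rightarrow>\<^sub>E elems S"
    and ast_closed: "sast S \<in> elems S \<rightarrow>\<^sub>E elems S"

locale P_restriction_semigrp = biunary_semigrp +
  assumes "x \<in> elems S \<Longrightarrow> x\<^sup>+ \<cdot> x = x"
    and "\<lbrakk>x \<in> elems S; y \<in> elems S\<rbrakk> \<Longrightarrow> (x \<cdot> y)\<^sup>+ = (x \<cdot> y\<^sup>+)\<^sup>+"
    and "\<lbrakk>x \<in> elems S; y \<in> elems S\<rbrakk> \<Longrightarrow> (x\<^sup>+ \<cdot> y\<^sup>+)\<^sup>+ = x\<^sup>+ \<cdot> y\<^sup>+ \<cdot> x\<^sup>+"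
    and "x \<in> elems S \<Longrightarrow> x\<^sup>+ \<cdot> x\<^sup>+ = x\<^sup>+"
    and "x \<in> elems S \<Longrightarrow> x\<^sup>+\<^sup>* = x\<^sup>+"
    and "x \<in> elems S \<Longrightarrow> x \<cdot> x\<^sup>* = x"
    and "\<lbrakk>x \<in> elems S; y \<in> elems S\<rbrakk> \<Longrightarrow> (x \<cdot> y)\<^sup>* = (x\<^sup>* \<cdot> y)\<^sup>*"
    and "\<lbrakk>x \<in> elems S; y \<in> elems S\<rbrakk> \<Longrightarrow> (x\<^sup>* \<cdot> y\<^sup>*)\<^sup>* = y\<^sup>* \<cdot> x\<^sup>* \<cdot> y\<^sup>*"
    and "x \<in> elems S \<Longrightarrow> x\<^sup>* \<cdot> x\<^sup>* = x\<^sup>*"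
    and "x \<in> elems S \<Longrightarrow> x\<^sup>*\<^sup>+ = x\<^sup>*"
    and "\<lbrakk>x \<in> elems S; y \<in> elems S\<rbrakk> \<Longrightarrow> (x \<cdot> y)\<^sup>+ \<cdot> x = x \<cdot> y\<^sup>+ \<cdot> x\<^sup>*"
    and "\<lbrakk>x \<in> elems S; y \<in> elems S\<rbrakk> \<Longrightarrow> x \<cdot> (y \<cdot> x)\<^sup>* = x\<^sup>+ \<cdot> y\<^sup>* \<cdot> x"

locale restriction_semigrp = biunary_semigrp +
  assumes "x \<in> elems S \<Longrightarrow> x\<^sup>+ \<cdot> x = x"
    and "\<lbrakk>x \<in> elems S; y \<in> elems S\<rbrakk> \<Longrightarrow> x\<^sup>+ \<cdot> y\<^sup>+ = y\<^sup>+ \<cdot> x\<^sup>+"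
    and "\<lbrakk>x \<in> elems S; y \<in> elems S\<rbrakk> \<Longrightarrow> y\<^sup>+ \<cdot> x\<^sup>+ = (x\<^sup>+ \<cdot> y\<^sup>+)\<^sup>+"
    and "\<lbrakk>x \<in> elems S; y \<in> elems S\<rbrakk> \<Longrightarrow> x\<^sup>+ \<cdot> (x \<cdot> y)\<^sup>+ = (x \<cdot> y)\<^sup>+"
    and "\<lbrakk>x \<in> elems S; y \<in> elems S\<rbrakk> \<Longrightarrow> (x \<cdot> y)\<^sup>+ = (x \<cdot> y\<^sup>+)\<^sup>+"
    and "x \<in> elems S \<Longrightarrow> x\<^sup>+\<^sup>* = x\<^sup>+"
    and "x \<in> elems S \<Longrightarrow> x \<cdot> x\<^sup>* = x"
    and "\<lbrakk>x \<in> elems S; y \<in> elems S\<rbrakk> \<Longrightarrow> x\<^sup>* \<cdot> y\<^sup>* = y\<^sup>* \<cdot> x\<^sup>*"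
    and "\<lbrakk>x \<in> elems S; y \<in> elems S\<rbrakk> \<Longrightarrow> y\<^sup>* \<cdot> x\<^sup>* = (x\<^sup>* \<cdot> y\<^sup>*)\<^sup>*"
    and "\<lbrakk>x \<in> elems S; y \<in> elems S\<rbrakk> \<Longrightarrow> (x \<cdot> y)\<^sup>* \<cdot> y\<^sup>* = (x \<cdot> y)\<^sup>*"
    and "\<lbrakk>x \<in> elems S; y \<in> elems S\<rbrakk> \<Longrightarrow> (x \<cdot> y)\<^sup>* = (x\<^sup>* \<cdot> y)\<^sup>*"
    and "x \<in> elems S \<Longrightarrow> x\<^sup>*\<^sup>+ = x\<^sup>*"
    and "\<lbrakk>x \<in> elems S; y \<in> elems S\<rbrakk> \<Longrightarrow> (x \<cdot> y)\<^sup>+ \<cdot> x = x \<cdot> y\<^sup>+"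
    and "\<lbrakk>x \<in> elems S; y \<in> elems S\<rbrakk> \<Longrightarrow> x \<cdot> (y \<cdot> x)\<^sup>* = y\<^sup>* \<cdot> x"

definition biunary_of_circ :: "'a circ_semigrp \<Rightarrow> 'a biunary_semigrp" where
  "biunary_of_circ S =
     \<lparr> elems = elems S, mul = mul S,
       splus = (\<lambda>x\<in>elems S. x \<cdot>\<^bsub>S\<^esub> x\<degree>\<^bsub>S\<^esub>),
       sast = (\<lambda>x\<in>elems S. x\<degree>\<^bsub>S\<^esub> \<cdot>\<^bsub>S\<^esub> x) \<rparr>"

definition hom_211 :: "'a biunary_semigrp \<Rightarrow> 'a biunary_semigrp \<Rightarrow> ('a \<Rightarrow> 'a) \<Rightarrow> bool" where
  "hom_211 S T \<phi> \<longleftrightarrow>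
     \<phi> \<in> elems S \<rightarrow> elems T \<and>
     (\<forall>x\<in>elems S. \<forall>y\<in>elems S. \<phi> (x \<cdot>\<^bsub>S\<^esub> y) = \<phi> x \<cdot>\<^bsub>T\<^esub> \<phi> y) \<and>
     (\<forall>x\<in>elems S. \<phi> (x\<^sup>+\<^bsub>S\<^esub>) = (\<phi> x)\<^sup>+\<^bsub>T\<^esub>) \<and>
     (\<forall>x\<in>elems S. \<phi> (x\<^sup>*\<^bsub>S\<^esub>) = (\<phi> x)\<^sup>*\<^bsub>T\<^esub>)"


section \<open>Projection algebras\<close>

locale projection_algebra =
  fixes P :: "'a set"
    and times :: "'a \<Rightarrow> 'a \<Rightarrow> 'a" (infixl "\<otimes>" 70)
    and star :: "'a \<Rightarrow> 'a \<Rightarrow> 'a" (infixl "\<star>" 70)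
  assumes nonempty: "P \<noteq> {}"
    and times_closed: "(\<otimes>) \<in> P \<rightarrow>\<^sub>E P \<rightarrow>\<^sub>E P"
    and star_closed: "(\<star>) \<in> P \<rightarrow>\<^sub>E P \<rightarrow>\<^sub>E P"
    and L1: "e \<in> P \<Longrightarrow> e \<otimes> e = e"
    and L2: "\<lbrakk>e \<in> P; f \<in> P\<rbrakk> \<Longrightarrow> (e \<otimes> f) \<otimes> e = e \<otimes> f"
    and L3: "\<lbrakk>e \<in> P; f \<in> P; g \<in> P\<rbrakk> \<Longrightarrow> e \<otimes> (f \<otimes> g) = (e \<otimes> f) \<otimes> (f \<otimes> g)"
    and L4: "\<lbrakk>e \<in> P; f \<in> P; g \<in> P\<rbrakk> \<Longrightarrow> (e \<otimes> f) \<otimes> g = (e \<otimes> f) \<otimes> (e \<otimes> g)"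
    and R1: "e \<in> P \<Longrightarrow> e \<star> e = e"
    and R2: "\<lbrakk>e \<in> P; f \<in> P\<rbrakk> \<Longrightarrow> f \<star> e = e \<star> (f \<star> e)"
    and R3: "\<lbrakk>e \<in> P; f \<in> P; g \<in> P\<rbrakk> \<Longrightarrow> (g \<star> f) \<star> e = (g \<star> f) \<star> (f \<star> e)"
    and R4: "\<lbrakk>e \<in> P; f \<in> P; g \<in> P\<rbrakk> \<Longrightarrow> g \<star> (f \<star> e) = (g \<star> e) \<star> (f \<star> e)"
    and P3_star: "\<lbrakk>e \<in> P; f \<in> P; g \<in> P\<rbrakk> \<Longrightarrow> (e \<star> (f \<otimes> g)) \<star> g = (e \<star> f) \<star> g"
    and P3_times: "\<lbrakk>e \<in> P; f \<in> P; g \<in> P\<rbrakk> \<Longrightarrow> g \<otimes> ((g \<star> f) \<otimes> e) = g \<otimes> (f \<otimes> e)"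
    and P4_times: "\<lbrakk>e \<in> P; f \<in> P\<rbrakk> \<Longrightarrow> (e \<otimes> f) \<star> e = e \<otimes> f"
    and P4_star: "\<lbrakk>e \<in> P; f \<in> P\<rbrakk> \<Longrightarrow> f \<otimes> (e \<star> f) = e \<star> f"

locale strong_projection_algebra = projection_algebra +
  assumes strong_times:
      "\<lbrakk>e \<in> P; f \<in> P; g \<in> P\<rbrakk> \<Longrightarrow> e \<otimes> (((e \<otimes> f) \<otimes> g) \<star> f) = (e \<otimes> f) \<otimes> g"
    and strong_star:
      "\<lbrakk>e \<in> P; f \<in> P; g \<in> P\<rbrakk> \<Longrightarrow> (f \<otimes> (g \<star> (f \<star> e))) \<star> e = g \<star> (f \<star> e)"

locale symmetric_projection_algebra = strong_projection_algebra +
  assumes symmetric: "\<lbrakk>e \<in> P; f \<in> P\<rbrakk> \<Longrightarrow> e \<otimes> f = f \<star> e"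

locale commutative_projection_algebra = strong_projection_algebra +
  assumes commutative: "\<lbrakk>e \<in> P; f \<in> P\<rbrakk> \<Longrightarrow> e \<otimes> f = f \<otimes> e"

definition projection_hom ::
  "'a set \<Rightarrow> ('a \<Rightarrow> 'a \<Rightarrow> 'a) \<Rightarrow> ('a \<Rightarrow> 'a \<Rightarrow> 'a) \<Rightarrow>
   'b set \<Rightarrow> ('b \<Rightarrow> 'b \<Rightarrow> 'b) \<Rightarrow> ('b \<Rightarrow> 'b \<Rightarrow> 'b) \<Rightarrow> ('a \<Rightarrow> 'b) \<Rightarrow> bool" where
  "projection_hom P t s Q t' s' h \<longleftrightarrow>
     h \<in> P \<rightarrow> Q \<and>
     (\<forall>e\<in>P. \<forall>f\<in>P. h (t e f) = t' (h e) (h f) \<and> h (s e f) = s' (h e) (h f))"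


section \<open>Ordered categories\<close>

text \<open>Here a category is a single-sorted structure, the objects being the identity arrows.\<close>

record 'a arrow_cat =
  arr :: "'a set"
  pcomp :: "'a \<Rightarrow> 'a \<Rightarrow> 'a option"
  src :: "'a \<Rightarrow> 'a" ("\<^bold>d\<index>")
  tgt :: "'a \<Rightarrow> 'a" ("\<^bold>r\<index>")

text \<open>The value of \<open>x \<bullet> y\<close> is meaningful only if the composite is defined.\<close>

definition arr_comp :: "('a, 'm) arrow_cat_scheme \<Rightarrow> 'a \<Rightarrow> 'a \<Rightarrow> 'a" (infixl "\<bullet>\<index>" 70) where
  "x \<bullet>\<^bsub>C\<^esub> y = the (pcomp C x y)"

text \<open>
  In a category \<open>obs C = \<^bold>d ` arr C = \<^bold>r ` arr C\<close>, since the unit laws give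
  \<open>\<^bold>r (\<^bold>d x) = \<^bold>d x\<close> and \<open>\<^bold>d (\<^bold>r x) = \<^bold>r x\<close>.
\<close>

definition obs :: "('a, 'm) arrow_cat_scheme \<Rightarrow> 'a set" where
  "obs C = \<^bold>d\<^bsub>C\<^esub> ` arr C"

locale arrow_cat =
  fixes C (structure)
  assumes nonempty: "arr C \<noteq> {}"
    and dom_closed: "\<^bold>d \<in> arr C \<rightarrow>\<^sub>E arr C"
    and rng_closed: "\<^bold>r \<in> arr C \<rightarrow>\<^sub>E arr C"
    and comp_defined: "pcomp C x y \<noteq> None \<longleftrightarrow> x \<in> arr C \<and> y \<in> arr C \<and> \<^bold>r x = \<^bold>d y"
    and comp_closed: "\<lbrakk>x \<in> arr C; y \<in> arr C; \<^bold>r x = \<^bold>d y\<rbrakk> \<Longrightarrow> x \<bullet> y \<in> arr C"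
    and dom_comp: "\<lbrakk>x \<in> arr C; y \<in> arr C; \<^bold>r x = \<^bold>d y\<rbrakk> \<Longrightarrow> \<^bold>d (x \<bullet> y) = \<^bold>d x"
    and rng_comp: "\<lbrakk>x \<in> arr C; y \<in> arr C; \<^bold>r x = \<^bold>d y\<rbrakk> \<Longrightarrow> \<^bold>r (x \<bullet> y) = \<^bold>r y"
    and comp_assoc:
      "\<lbrakk>x \<in> arr C; y \<in> arr C; z \<in> arr C; \<^bold>r x = \<^bold>d y; \<^bold>r y = \<^bold>d z\<rbrakk>
        \<Longrightarrow> (x \<bullet> y) \<bullet> z = x \<bullet> (y \<bullet> z)"
    and left_unit: "x \<in> arr C \<Longrightarrow> pcomp C (\<^bold>d x) x = Some x"
    and right_unit: "x \<in> arr C \<Longrightarrow> pcomp C x (\<^bold>r x) = Some x"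

locale arrow_groupoid = arrow_cat +
  assumes inverse:
    "a \<in> arr C \<Longrightarrow> \<exists>a'\<in>arr C. pcomp C a a' = Some (\<^bold>d a) \<and> pcomp C a' a = Some (\<^bold>r a)"

record 'a ordered_cat = "'a arrow_cat" +
  leq :: "'a \<Rightarrow> 'a \<Rightarrow> bool" (infix "\<sqsubseteq>\<index>" 50)

locale ordered_cat = arrow_cat +
  assumes order: "partial_order_on (arr C) {(a, b). a \<sqsubseteq> b}"
    and O1: "a \<sqsubseteq> b \<Longrightarrow> \<^bold>d a \<sqsubseteq> \<^bold>d b \<and> \<^bold>r a \<sqsubseteq> \<^bold>r b"
    and O2: "\<lbrakk>a \<sqsubseteq> b; c \<sqsubseteq> e; \<^bold>r a = \<^bold>d c; \<^bold>r b = \<^bold>d e\<rbrakk> \<Longrightarrow> a \<bullet> c \<sqsubseteq> b \<bullet> e"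
    and O3: "\<lbrakk>a \<in> arr C; p \<in> obs C; p \<sqsubseteq> \<^bold>d a\<rbrakk> \<Longrightarrow> \<exists>!u. u \<sqsubseteq> a \<and> \<^bold>d u = p"
    and O4: "\<lbrakk>a \<in> arr C; q \<in> obs C; q \<sqsubseteq> \<^bold>r a\<rbrakk> \<Longrightarrow> \<exists>!v. v \<sqsubseteq> a \<and> \<^bold>r v = q"

definition lrestrict :: "('a, 'm) ordered_cat_scheme \<Rightarrow> 'a \<Rightarrow> 'a \<Rightarrow> 'a" (infixr "\<downharpoonleft>\<index>" 75) where
  "p \<downharpoonleft>\<^bsub>C\<^esub> a = (THE u. u \<sqsubseteq>\<^bsub>C\<^esub> a \<and> \<^bold>d\<^bsub>C\<^esub> u = p)"

definition rrestrict :: "('a, 'm) ordered_cat_scheme \<Rightarrow> 'a \<Rightarrow> 'a \<Rightarrow> 'a" (infixl "\<downharpoonright>\<index>" 75) where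
  "a \<downharpoonright>\<^bsub>C\<^esub> q = (THE v. v \<sqsubseteq>\<^bsub>C\<^esub> a \<and> \<^bold>r\<^bsub>C\<^esub> v = q)"


section \<open>Projection ordered categories\<close>

record 'a projection_cat = "'a ordered_cat" +
  ptimes :: "'a \<Rightarrow> 'a \<Rightarrow> 'a" (infixl "\<otimes>\<index>" 70)
  pstar :: "'a \<Rightarrow> 'a \<Rightarrow> 'a" (infixl "\<star>\<index>" 70)

definition proj_leq :: "('a, 'm) projection_cat_scheme \<Rightarrow> 'a \<Rightarrow> 'a \<Rightarrow> bool" where
  "proj_leq C e f \<longleftrightarrow> e = f \<otimes>\<^bsub>C\<^esub> e"

definition F_rel :: "('a, 'm) projection_cat_scheme \<Rightarrow> 'a \<Rightarrow> 'a \<Rightarrow> bool" where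
  "F_rel C p q \<longleftrightarrow> p \<otimes>\<^bsub>C\<^esub> q = p \<and> p \<star>\<^bsub>C\<^esub> q = q"

locale weak_projection_ordered_cat = ordered_cat +
  assumes projections: "strong_projection_algebra (obs C) (\<otimes>) (\<star>)"
    and leq_iff: "\<lbrakk>p \<in> obs C; q \<in> obs C\<rbrakk> \<Longrightarrow> p \<sqsubseteq> q \<longleftrightarrow> proj_leq C p q"

definition down :: "('a, 'm) projection_cat_scheme \<Rightarrow> 'a \<Rightarrow> 'a set" where
  "down C s = {x \<in> obs C. x \<sqsubseteq>\<^bsub>C\<^esub> s}"

definition nu :: "('a, 'm) projection_cat_scheme \<Rightarrow> 'a \<Rightarrow> 'a \<Rightarrow> 'a" where
  "nu C a p = \<^bold>r\<^bsub>C\<^esub> (p \<downharpoonleft>\<^bsub>C\<^esub> a)"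

definition Theta :: "('a, 'm) projection_cat_scheme \<Rightarrow> 'a \<Rightarrow> 'a \<Rightarrow> 'a" where
  "Theta C a x = \<^bold>r\<^bsub>C\<^esub> ((x \<star>\<^bsub>C\<^esub> \<^bold>d\<^bsub>C\<^esub> a) \<downharpoonleft>\<^bsub>C\<^esub> a)"

definition Delta :: "('a, 'm) projection_cat_scheme \<Rightarrow> 'a \<Rightarrow> 'a \<Rightarrow> 'a" where
  "Delta C a x = \<^bold>d\<^bsub>C\<^esub> (a \<downharpoonright>\<^bsub>C\<^esub> (\<^bold>r\<^bsub>C\<^esub> a \<otimes>\<^bsub>C\<^esub> x))"

locale projection_ordered_cat = weak_projection_ordered_cat +
  assumes nu_hom:
    "a \<in> arr C \<Longrightarrow>
      projection_hom (down C (\<^bold>d a)) (\<otimes>) (\<star>) (down C (\<^bold>r a)) (\<otimes>) (\<star>) (nu C a)"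


section \<open>The path category and evaluation maps\<close>

text \<open>
  A path \<open>(p\<^sub>1, \<dots>, p\<^sub>k)\<close> is a nonempty list; its domain is \<open>hd\<close>, its range is \<open>last\<close>.
\<close>

definition paths :: "('a, 'm) projection_cat_scheme \<Rightarrow> 'a list set" where
  "paths C = {ps. ps \<noteq> [] \<and> set ps \<subseteq> obs C \<and> successively (F_rel C) ps}"

definition path_comp :: "'a list \<Rightarrow> 'a list \<Rightarrow> 'a list" where
  "path_comp ps qs = ps @ tl qs"

primrec star_trail :: "('a, 'm) projection_cat_scheme \<Rightarrow> 'a \<Rightarrow> 'a list \<Rightarrow> 'a list" where
  "star_trail C q [] = []"
| "star_trail C q (p # ps) = (q \<star>\<^bsub>C\<^esub> p) # star_trail C (q \<star>\<^bsub>C\<^esub> p) ps"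

definition path_restrict :: "('a, 'm) projection_cat_scheme \<Rightarrow> 'a \<Rightarrow> 'a list \<Rightarrow> 'a list" where
  "path_restrict C q ps = q # star_trail C q (tl ps)"

definition path_leq :: "('a, 'm) projection_cat_scheme \<Rightarrow> 'a list \<Rightarrow> 'a list \<Rightarrow> bool" where
  "path_leq C ps qs \<longleftrightarrow> (\<exists>r\<in>obs C. proj_leq C r (hd qs) \<and> ps = path_restrict C r qs)"

record 'a chain_cat = "'a projection_cat" +
  evaluation :: "'a list \<Rightarrow> 'a" ("\<epsilon>\<index>")

locale evaluation_projection_ordered_cat = projection_ordered_cat +
  assumes eval_closed: "\<epsilon> \<in> paths C \<rightarrow>\<^sub>E arr C"
    and E1: "p \<in> obs C \<Longrightarrow> \<epsilon> [p] = p \<and> \<epsilon> [p, p] = p"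
    and E2: "ps \<in> paths C \<Longrightarrow> \<^bold>d (\<epsilon> ps) = hd ps \<and> \<^bold>r (\<epsilon> ps) = last ps"
    and E3: "\<lbrakk>ps \<in> paths C; qs \<in> paths C; last ps = hd qs\<rbrakk>
              \<Longrightarrow> \<epsilon> (path_comp ps qs) = \<epsilon> ps \<bullet> \<epsilon> qs"
    and E4: "\<lbrakk>ps \<in> paths C; qs \<in> paths C; path_leq C ps qs\<rbrakk> \<Longrightarrow> \<epsilon> ps \<sqsubseteq> \<epsilon> qs"


section \<open>Chain projection ordered categories\<close>

definition linked :: "('a, 'm) chain_cat_scheme \<Rightarrow> 'a \<Rightarrow> 'a \<Rightarrow> 'a \<Rightarrow> bool" where
  "linked C b e f \<longleftrightarrow>
     e \<in> obs C \<and> f \<in> obs C \<and>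
     f = Theta C b e \<star>\<^bsub>C\<^esub> f \<and> e = e \<otimes>\<^bsub>C\<^esub> Delta C b f"

definition lambda :: "('a, 'm) chain_cat_scheme \<Rightarrow> 'a \<Rightarrow> 'a \<Rightarrow> 'a \<Rightarrow> 'a" where
  "lambda C e b f =
     (let e1 = e \<star>\<^bsub>C\<^esub> \<^bold>d\<^bsub>C\<^esub> b; f1 = Theta C b e
      in \<epsilon>\<^bsub>C\<^esub> [e, e1] \<bullet>\<^bsub>C\<^esub> (e1 \<downharpoonleft>\<^bsub>C\<^esub> b) \<bullet>\<^bsub>C\<^esub> \<epsilon>\<^bsub>C\<^esub> [f1, f])"

definition rho :: "('a, 'm) chain_cat_scheme \<Rightarrow> 'a \<Rightarrow> 'a \<Rightarrow> 'a \<Rightarrow> 'a" where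
  "rho C e b f =
     (let e2 = Delta C b f; f2 = \<^bold>r\<^bsub>C\<^esub> b \<otimes>\<^bsub>C\<^esub> f
      in \<epsilon>\<^bsub>C\<^esub> [e, e2] \<bullet>\<^bsub>C\<^esub> (e2 \<downharpoonleft>\<^bsub>C\<^esub> b) \<bullet>\<^bsub>C\<^esub> \<epsilon>\<^bsub>C\<^esub> [f2, f])"

locale chain_projection_ordered_cat = evaluation_projection_ordered_cat +
  assumes G2: "\<lbrakk>b \<in> arr C; linked C b e f\<rbrakk> \<Longrightarrow> lambda C e b f = rho C e b f"

locale chain_projection_ordered_groupoid = chain_projection_ordered_cat + arrow_groupoid

locale symmetric_chain_projection_ordered_cat = chain_projection_ordered_cat +
  assumes symmetric_projections: "symmetric_projection_algebra (obs C) (\<otimes>) (\<star>)"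
    and eval_symmetric: "\<lbrakk>p \<in> obs C; q \<in> obs C; F_rel C p q\<rbrakk> \<Longrightarrow> \<epsilon> [p, q, p] = p"

locale commutative_chain_projection_ordered_cat = chain_projection_ordered_cat +
  assumes commutative_projections: "commutative_projection_algebra (obs C) (\<otimes>) (\<star>)"

locale symmetric_chain_projection_ordered_groupoid =
  symmetric_chain_projection_ordered_cat + arrow_groupoid

locale commutative_chain_projection_ordered_groupoid =
  commutative_chain_projection_ordered_cat + arrow_groupoid

definition chain_projection_ordered_functor ::
  "'a chain_cat \<Rightarrow> 'a chain_cat \<Rightarrow> ('a \<Rightarrow> 'a) \<Rightarrow> bool" where
  "chain_projection_ordered_functor C D \<phi> \<longleftrightarrow>
     \<phi> \<in> arr C \<rightarrow> arr D \<and>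
     (\<forall>a\<in>arr C. \<^bold>d\<^bsub>D\<^esub> (\<phi> a) = \<phi> (\<^bold>d\<^bsub>C\<^esub> a) \<and> \<^bold>r\<^bsub>D\<^esub> (\<phi> a) = \<phi> (\<^bold>r\<^bsub>C\<^esub> a)) \<and>
     (\<forall>a\<in>arr C. \<forall>b\<in>arr C. \<^bold>r\<^bsub>C\<^esub> a = \<^bold>d\<^bsub>C\<^esub> b \<longrightarrow> \<phi> (a \<bullet>\<^bsub>C\<^esub> b) = \<phi> a \<bullet>\<^bsub>D\<^esub> \<phi> b) \<and>
     (\<forall>a\<in>arr C. \<forall>b\<in>arr C. a \<sqsubseteq>\<^bsub>C\<^esub> b \<longrightarrow> \<phi> a \<sqsubseteq>\<^bsub>D\<^esub> \<phi> b) \<and>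
     (\<forall>e\<in>obs C. \<forall>f\<in>obs C. \<phi> (e \<otimes>\<^bsub>C\<^esub> f) = \<phi> e \<otimes>\<^bsub>D\<^esub> \<phi> f \<and> \<phi> (e \<star>\<^bsub>C\<^esub> f) = \<phi> e \<star>\<^bsub>D\<^esub> \<phi> f) \<and>
     (\<forall>ps\<in>paths C. \<phi> (\<epsilon>\<^bsub>C\<^esub> ps) = \<epsilon>\<^bsub>D\<^esub> (map \<phi> ps))"


section \<open>The categories of semigroups and of chain projection ordered categories\<close>

text \<open>
  The objects keep the operation \<open>\<degree>\<close>; the morphisms are the \<open>(2,1,1)\<close>-homomorphisms of the
  associated bi-unary semigroups.
\<close>

definition circ_semigrp_category ::
  "('a circ_semigrp \<Rightarrow> bool) \<Rightarrow>
   ('a circ_semigrp, 'a circ_semigrp \<times> ('a \<Rightarrow> 'a) \<times> 'a circ_semigrp) category" where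
  "circ_semigrp_category obj =
     structure_category obj elems (\<lambda>S T. hom_211 (biunary_of_circ S) (biunary_of_circ T))"

definition biunary_semigrp_category ::
  "('a biunary_semigrp \<Rightarrow> bool) \<Rightarrow>
   ('a biunary_semigrp, 'a biunary_semigrp \<times> ('a \<Rightarrow> 'a) \<times> 'a biunary_semigrp) category" where
  "biunary_semigrp_category obj = structure_category obj elems hom_211"

definition chain_cat_category ::
  "('a chain_cat \<Rightarrow> bool) \<Rightarrow>
   ('a chain_cat, 'a chain_cat \<times> ('a \<Rightarrow> 'a) \<times> 'a chain_cat) category" where
  "chain_cat_category obj = structure_category obj arr chain_projection_ordered_functor"

end

theory Submission
  imports Defs
begin

text \<open>
  All five isomorphisms are restrictions of a single correspondence. Call a bi-unary semigroup a
  DRC-restriction semigroup if it satisfies the laws of the locale \<open>drc_restriction_semigrp\<close>; the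
  essential ones are the shift laws \<open>(xy)\<^sup>+x = x(x\<^sup>*y)\<^sup>+\<close> and \<open>x(yx)\<^sup>* = (yx\<^sup>+)\<^sup>*x\<close>, which hold both in
  \<open>P\<close>-restriction semigroups and in the bi-unary semigroups of generalized regular
  \<open>\<degree>\<close>-semigroups. These semigroups correspond to chain projection ordered categories on the
  same set of elements, with \<open>x\<^sup>+\<close> and \<open>x\<^sup>*\<close> as domain and range of \<open>x\<close>.

  From a semigroup \<open>S\<close> to a category: \<open>x \<bullet> y\<close> is the product \<open>xy\<close>, but only if \<open>x\<^sup>* = y\<^sup>+\<close>; the order is
  the natural one; on projections \<open>e \<otimes> f = (ef)\<^sup>+\<close> and \<open>e \<star> f = (ef)\<^sup>*\<close>; a path is evaluated by
  multiplying its vertices. The shift laws make the order left-right symmetric and give (G2), as both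
  \<open>\<lambda>(e, b, f)\<close> and \<open>\<rho>(e, b, f)\<close> are equal to \<open>ebf\<close> (\<open>chain_projection_ordered_cat_K\<close>).

  From a category \<open>C\<close> to a semigroup: arrows \<open>a\<close> and \<open>b\<close> are multiplied by joining them across the
  path \<open>[p, q]\<close> with \<open>p = \<^bold>r a \<otimes> \<^bold>d b\<close> and \<open>q = \<^bold>r a \<star> \<^bold>d b\<close>, after restricting \<open>a\<close> to end in \<open>p\<close> and \<open>b\<close>
  to start in \<open>q\<close>. Associativity is the heart of the matter. A composite across a path restricts to
  a composite across a restricted path (\<open>bridge_rrestrict\<close>), and therefore
  \<open>(ab)c = (a \<downharpoonright> e) \<bullet> \<lambda>(e, b, f) \<bullet> (f \<downharpoonleft> c)\<close> for \<open>e = \<^bold>r a \<otimes> \<Delta>\<^sub>b(\<^bold>d c)\<close> and \<open>f = \<Theta>\<^sub>b(\<^bold>r a) \<star> \<^bold>d c\<close>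
  (\<open>mul_assoc_left\<close>). The opposite of \<open>C\<close> is again a projection ordered category with an
  evaluation map, and reading the formula there gives \<open>a(bc) = (a \<downharpoonright> e) \<bullet> \<rho>(e, b, f) \<bullet> (f \<downharpoonleft> c)\<close> with the same \<open>e\<close> and \<open>f\<close>
  (\<open>mul_assoc_right\<close>). Each of the two computations supplies one half of the statement that \<open>(e, f)\<close> is
  \<open>b\<close>-linked, so (G2) is just what is needed.

  The constructions are mutually inverse, as \<open>(a\<^sup>*b\<^sup>+)\<^sup>+(a\<^sup>*b\<^sup>+)\<^sup>* = a\<^sup>*b\<^sup>+\<close> in a semigroup, and the
  homomorphisms are exactly the functors, since either structure is defined in terms of the other.
  It remains to recognise the special classes. The category is symmetric iff the semigroup is
  \<open>P\<close>-restriction, commutative iff it is restriction (then \<open>p F q\<close> only if \<open>p = q\<close>), and a groupoid iff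
  every \<open>x\<close> has a \<open>y\<close> with \<open>xy = x\<^sup>+ = y\<^sup>*\<close> and \<open>yx = x\<^sup>* = y\<^sup>+\<close>. Such a \<open>y\<close> is unique, and \<open>x\<degree> = y\<close>
  recovers the \<open>\<degree>\<close>-semigroup.
\<close>

section \<open>Projection algebras\<close>

(* A projection algebra writes its operations with the same symbols as the record fields. *)
no_notation ptimes (infixl "\<otimes>\<index>" 70) and pstar (infixl "\<star>\<index>" 70)

context projection_algebra
begin

lemma times_in [simp, intro]: "\<lbrakk>e \<in> P; f \<in> P\<rbrakk> \<Longrightarrow> e \<otimes> f \<in> P"
  using times_closed by auto

lemma star_in [simp, intro]: "\<lbrakk>e \<in> P; f \<in> P\<rbrakk> \<Longrightarrow> e \<star> f \<in> P"
  using star_closed by auto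

lemma times_absorb [simp]: "\<lbrakk>e \<in> P; f \<in> P\<rbrakk> \<Longrightarrow> e \<otimes> (e \<otimes> f) = e \<otimes> f"
  using L4[of e e f] L1[of e] by simp

lemma le_iff_star: "\<lbrakk>e \<in> P; f \<in> P\<rbrakk> \<Longrightarrow> f \<otimes> e = e \<longleftrightarrow> e \<star> f = e"
  using P4_star[of e f] P4_times[of f e] by auto

lemma le_absorb:
  assumes "e \<in> P" "f \<in> P" "f \<otimes> e = e"
  shows "e \<otimes> f = e" "e \<star> f = e" "f \<star> e = e"
proof -
  show "e \<otimes> f = e"
    using L2[of f e] assms by simp
  show *: "e \<star> f = e"
    using P4_times[of f e] assms by simp
  show "f \<star> e = e"
    using R2[of f e] * assms by simp
qed

lemma times_star:
  assumes "e \<in> P" "f \<in> P"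
  shows "e \<otimes> (e \<star> f) = e \<otimes> f"
proof -
  have "(e \<star> f) \<otimes> f = e \<star> f"
    using L2[of f "e \<star> f"] P4_star[of e f] assms by simp
  then show ?thesis
    using P3_times[of f e e] P3_times[of f f e] L1[of f] assms by simp
qed

lemma star_times:
  assumes "e \<in> P" "f \<in> P"
  shows "(e \<otimes> f) \<star> f = e \<star> f"
proof -
  have "e \<star> (e \<otimes> f) = e \<otimes> f"
    using R2[of e "e \<otimes> f"] P4_times[of e f] assms by simp
  then show ?thesis
    using P3_star[of e e f] R1[of e] assms by simp
qed

text \<open>
  Both products of \<open>e\<close> and \<open>f\<close> are \<open>F\<close>-related. The resulting path is the bridge that joins an arrow
  ending in \<open>e\<close> to an arrow starting in \<open>f\<close>.
\<close>

lemma F_times_star: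
  assumes "e \<in> P" "f \<in> P"
  shows "(e \<otimes> f) \<otimes> (e \<star> f) = e \<otimes> f" "(e \<otimes> f) \<star> (e \<star> f) = e \<star> f"
  using L4[of e f "e \<star> f"] R4[of f e "e \<otimes> f"] L1 R1 times_star star_times assms
  by simp_all

text \<open>
  The L-laws and the R-laws are mirror images of each other, and so are the two halves of (P3) and
  (P4). Hence every fact below has a left-right dual.
\<close>

lemma dual_axioms:
  "projection_algebra P (\<lambda>e\<in>P. \<lambda>f\<in>P. f \<star> e) (\<lambda>e\<in>P. \<lambda>f\<in>P. f \<otimes> e)"
proof unfold_locales
  show "P \<noteq> {}"
    by (rule nonempty)
qed (simp_all only: restrict_apply' star_in times_in,
     auto intro: L1 R1 L2 L2[symmetric] R2 R2[symmetric] L3 R3 L4 R4 P3_star P3_times P4_star P4_times)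

end

context strong_projection_algebra
begin

text \<open>
  The path \<open>[p, q]\<close> can be cut down to end in \<open>z \<le> q\<close>: its first vertex becomes \<open>p \<otimes> z\<close>, and the
  strong law guarantees that the left restriction of \<open>[p, q]\<close> to \<open>p \<otimes> z\<close> ends in \<open>z\<close> again.
\<close>

lemma F_restrict:
  assumes "p \<in> P" "q \<in> P" "z \<in> P" and F: "p \<otimes> q = p" "p \<star> q = q" and z: "q \<otimes> z = z"
  shows "(p \<otimes> z) \<star> q = z" "(p \<otimes> z) \<otimes> z = p \<otimes> z" "(p \<otimes> z) \<star> z = z"
proof -
  have zq: "z \<star> q = z"
    using assms le_absorb by blast
  show *: "(p \<otimes> z) \<star> q = z"
    using strong_star[of q p z] F zq assms by simp
  show "(p \<otimes> z) \<otimes> z = p \<otimes> z"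
    using L4[of p z z] L1 assms by simp
  show "(p \<otimes> z) \<star> z = z"
    using R4[of q "p \<otimes> z" "p \<otimes> z"] R1 * assms by simp
qed

lemma dual: "strong_projection_algebra P (\<lambda>e\<in>P. \<lambda>f\<in>P. f \<star> e) (\<lambda>e\<in>P. \<lambda>f\<in>P. f \<otimes> e)"
proof -
  interpret D: projection_algebra P "\<lambda>e\<in>P. \<lambda>f\<in>P. f \<star> e" "\<lambda>e\<in>P. \<lambda>f\<in>P. f \<otimes> e"
    by (rule dual_axioms)
  show ?thesis
    by unfold_locales (simp_all only: restrict_apply' star_in times_in strong_times strong_star)
qed

text \<open>
  Going back from \<open>y\<close> across the bridge between \<open>p\<close> and \<open>q\<close> is the same as going back directly to \<open>p\<close>.
  This is why both bracketings of a triple product start in the same projection.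
\<close>

lemma times_times_star:
  assumes "p \<in> P" "q \<in> P" "y \<in> P" "q \<otimes> y = y"
  shows "(p \<otimes> q) \<otimes> ((p \<star> q) \<otimes> y) = p \<otimes> y"
proof -
  have "(p \<otimes> q) \<otimes> ((p \<star> q) \<otimes> y) = (p \<otimes> q) \<otimes> (p \<otimes> ((p \<star> q) \<otimes> y))"
    using assms by (intro L4) auto
  also have "\<dots> = (p \<otimes> q) \<otimes> (p \<otimes> y)"
    using P3_times[of y q p] assms by simp
  also have "\<dots> = (p \<otimes> q) \<otimes> (q \<otimes> y)"
    using L4[of p q y] assms by simp
  also have "\<dots> = p \<otimes> y"
    using L3[of p q y] assms by simp
  finally show ?thesis .
qed

text \<open>
  Moving from \<open>p \<otimes> y\<close> forward to \<open>q\<close> passes through the bridge between \<open>p\<close> and \<open>q\<close>, where \<open>F_restrict\<close>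
  applies.
\<close>

lemma times_star_swap:
  assumes "p \<in> P" "q \<in> P" "y \<in> P" "q \<otimes> y = y"
  shows "(p \<otimes> y) \<star> q = (p \<star> q) \<otimes> y"
proof -
  let ?z = "(p \<star> q) \<otimes> y" and ?e = "p \<otimes> y"
  have e: "(p \<otimes> q) \<otimes> ?z = ?e"
    using times_times_star assms .
  have *: "?e \<star> (p \<star> q) = ?z"
    using F_restrict(1)[of "p \<otimes> q" "p \<star> q" ?z] F_times_star e assms by simp
  have "?e \<star> p = ?e"
    using assms by (simp add: P4_times)
  then have "?e \<star> q = ?e \<star> (p \<star> q)"
    using R3[of q p ?e] assms by simp
  then show ?thesis using * by simp
qed

end

notation ptimes (infixl "\<otimes>\<index>" 70) and pstar (infixl "\<star>\<index>" 70)

section \<open>Restriction in ordered categories\<close>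

context arrow_cat
begin

lemma d_in [simp]: "x \<in> arr C \<Longrightarrow> \<^bold>d x \<in> arr C"
  and r_in [simp]: "x \<in> arr C \<Longrightarrow> \<^bold>r x \<in> arr C"
  using dom_closed rng_closed by auto

lemma r_d [simp]: "x \<in> arr C \<Longrightarrow> \<^bold>r (\<^bold>d x) = \<^bold>d x"
  using comp_defined[of "\<^bold>d x" x] left_unit by auto

lemma d_r [simp]: "x \<in> arr C \<Longrightarrow> \<^bold>d (\<^bold>r x) = \<^bold>r x"
  using comp_defined[of x "\<^bold>r x"] right_unit by auto

lemma d_d [simp]: "x \<in> arr C \<Longrightarrow> \<^bold>d (\<^bold>d x) = \<^bold>d x"
  using d_r[of "\<^bold>d x"] by simp

lemma r_r [simp]: "x \<in> arr C \<Longrightarrow> \<^bold>r (\<^bold>r x) = \<^bold>r x"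
  using r_d[of "\<^bold>r x"] by simp

lemma d_comp_id [simp]: "x \<in> arr C \<Longrightarrow> \<^bold>d x \<bullet> x = x"
  and comp_r_id [simp]: "x \<in> arr C \<Longrightarrow> x \<bullet> \<^bold>r x = x"
  using left_unit right_unit by (auto simp: arr_comp_def)

lemma pcomp_eq:
  "pcomp C x y = (if x \<in> arr C \<and> y \<in> arr C \<and> \<^bold>r x = \<^bold>d y then Some (x \<bullet> y) else None)"
  using comp_defined[of x y] by (auto simp: arr_comp_def)

lemma obs_iff: "p \<in> obs C \<longleftrightarrow> p \<in> arr C \<and> \<^bold>d p = p"
  by (auto simp: obs_def intro: image_eqI[of p _ p])

lemma obs_arr [simp]: "p \<in> obs C \<Longrightarrow> p \<in> arr C"
  and obs_d_eq [simp]: "p \<in> obs C \<Longrightarrow> \<^bold>d p = p"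
  and d_obs [simp]: "x \<in> arr C \<Longrightarrow> \<^bold>d x \<in> obs C"
  and r_obs [simp]: "x \<in> arr C \<Longrightarrow> \<^bold>r x \<in> obs C"
  by (simp_all add: obs_iff)

lemma obs_r_eq [simp]: "p \<in> obs C \<Longrightarrow> \<^bold>r p = p"
  using r_d[of p] by simp

lemma comp_assoc3:
  "\<lbrakk>x \<in> arr C; y \<in> arr C; z \<in> arr C; \<^bold>r x = \<^bold>d y; \<^bold>r y = \<^bold>d z\<rbrakk>
    \<Longrightarrow> x \<bullet> (y \<bullet> z) = x \<bullet> y \<bullet> z"
  by (simp add: comp_assoc)

end

context ordered_cat
begin

lemma le_arr: "a \<sqsubseteq> b \<Longrightarrow> a \<in> arr C" "a \<sqsubseteq> b \<Longrightarrow> b \<in> arr C"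
  using order by (auto simp: partial_order_on_def preorder_on_def)

lemma le_refl [simp]: "a \<in> arr C \<Longrightarrow> a \<sqsubseteq> a"
  using order by (auto simp: partial_order_on_def preorder_on_def refl_on_def)

lemma le_trans: "a \<sqsubseteq> b \<Longrightarrow> b \<sqsubseteq> c \<Longrightarrow> a \<sqsubseteq> c"
  using order unfolding partial_order_on_def preorder_on_def trans_def by blast

lemma lrestrict:
  assumes "a \<in> arr C" "p \<in> obs C" "p \<sqsubseteq> \<^bold>d a"
  shows lrestrict_le: "p \<downharpoonleft> a \<sqsubseteq> a"
    and d_lrestrict [simp]: "\<^bold>d (p \<downharpoonleft> a) = p"
    and lrestrict_arr [simp]: "p \<downharpoonleft> a \<in> arr C"
  using theI'[OF O3[OF assms]] le_arr by (auto simp: lrestrict_def)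

lemma rrestrict:
  assumes "a \<in> arr C" "q \<in> obs C" "q \<sqsubseteq> \<^bold>r a"
  shows rrestrict_le: "a \<downharpoonright> q \<sqsubseteq> a"
    and r_rrestrict [simp]: "\<^bold>r (a \<downharpoonright> q) = q"
    and rrestrict_arr [simp]: "a \<downharpoonright> q \<in> arr C"
  using theI'[OF O4[OF assms]] le_arr by (auto simp: rrestrict_def)

lemma le_eq_lrestrict: "u \<sqsubseteq> a \<Longrightarrow> \<^bold>d u \<downharpoonleft> a = u"
  unfolding lrestrict_def using O1 le_arr O3[of a "\<^bold>d u"] by (intro the1_equality) auto

lemma le_eq_rrestrict: "u \<sqsubseteq> a \<Longrightarrow> a \<downharpoonright> \<^bold>r u = u"
  unfolding rrestrict_def using O1 le_arr O4[of a "\<^bold>r u"] by (intro the1_equality) auto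

lemma lrestrict_d [simp]: "a \<in> arr C \<Longrightarrow> \<^bold>d a \<downharpoonleft> a = a"
  and rrestrict_r [simp]: "a \<in> arr C \<Longrightarrow> a \<downharpoonright> \<^bold>r a = a"
  using le_eq_lrestrict[of a a] le_eq_rrestrict[of a a] by simp_all

lemma lrestrict_lrestrict:
  assumes "a \<in> arr C" "u \<sqsubseteq> a" "q \<in> obs C" "q \<sqsubseteq> \<^bold>d u"
  shows "q \<downharpoonleft> u = q \<downharpoonleft> a"
  using le_eq_lrestrict[of "q \<downharpoonleft> u" a] lrestrict[of u q] le_trans[of _ u a] le_arr assms by auto

lemma rrestrict_rrestrict:
  assumes "a \<in> arr C" "u \<sqsubseteq> a" "q \<in> obs C" "q \<sqsubseteq> \<^bold>r u"
  shows "u \<downharpoonright> q = a \<downharpoonright> q"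
  using le_eq_rrestrict[of "u \<downharpoonright> q" a] rrestrict[of u q] le_trans[of _ u a] le_arr assms by auto

text \<open>
  Below an object there are only objects: \<open>u\<close> and \<open>\<^bold>d u\<close> lie below \<open>p\<close> and have the same domain.
\<close>

lemma le_obs_obs:
  assumes "u \<sqsubseteq> p" "p \<in> obs C"
  shows "u \<in> obs C"
proof -
  have u: "u \<in> arr C"
    using assms le_arr by blast
  moreover have "\<^bold>d u \<sqsubseteq> p"
    using O1[of u p] assms by simp
  ultimately have "\<^bold>d u = u"
    using le_eq_lrestrict[of "\<^bold>d u" p] le_eq_lrestrict[of u p] assms by simp
  then show ?thesis
    using d_obs[OF u] by simp
qed

lemma lrestrict_obs: "\<lbrakk>p \<sqsubseteq> q; q \<in> obs C\<rbrakk> \<Longrightarrow> p \<downharpoonleft> q = p"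
  using le_eq_lrestrict[of p q] le_obs_obs[of p q] by simp

lemma rrestrict_obs: "\<lbrakk>p \<sqsubseteq> q; q \<in> obs C\<rbrakk> \<Longrightarrow> q \<downharpoonright> p = p"
  using le_eq_rrestrict[of p q] le_obs_obs[of p q] by simp

lemma lrestrict_eq_rrestrict:
  "\<lbrakk>a \<in> arr C; p \<in> obs C; p \<sqsubseteq> \<^bold>d a\<rbrakk> \<Longrightarrow> a \<downharpoonright> \<^bold>r (p \<downharpoonleft> a) = p \<downharpoonleft> a"
  by (simp add: le_eq_rrestrict lrestrict_le)

lemma rrestrict_eq_lrestrict:
  "\<lbrakk>a \<in> arr C; q \<in> obs C; q \<sqsubseteq> \<^bold>r a\<rbrakk> \<Longrightarrow> \<^bold>d (a \<downharpoonright> q) \<downharpoonleft> a = a \<downharpoonright> q"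
  by (simp add: le_eq_lrestrict rrestrict_le)

lemma r_lrestrict_le: "\<lbrakk>a \<in> arr C; p \<in> obs C; p \<sqsubseteq> \<^bold>d a\<rbrakk> \<Longrightarrow> \<^bold>r (p \<downharpoonleft> a) \<sqsubseteq> \<^bold>r a"
  by (simp add: O1 lrestrict_le)

lemma d_rrestrict_le: "\<lbrakk>a \<in> arr C; q \<in> obs C; q \<sqsubseteq> \<^bold>r a\<rbrakk> \<Longrightarrow> \<^bold>d (a \<downharpoonright> q) \<sqsubseteq> \<^bold>d a"
  by (simp add: O1 rrestrict_le)

end

section \<open>Projections of an ordered category\<close>

sublocale weak_projection_ordered_cat \<subseteq> P: strong_projection_algebra "obs C" "(\<otimes>)" "(\<star>)"
  by (rule projections)

context weak_projection_ordered_cat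
begin

lemma le_iff: "\<lbrakk>p \<in> obs C; q \<in> obs C\<rbrakk> \<Longrightarrow> p \<sqsubseteq> q \<longleftrightarrow> q \<otimes> p = p"
  unfolding leq_iff proj_leq_def by (rule eq_commute)

lemma times_le [simp]: "\<lbrakk>e \<in> obs C; f \<in> obs C\<rbrakk> \<Longrightarrow> e \<otimes> f \<sqsubseteq> e"
  by (simp add: le_iff)

lemma star_le [simp]: "\<lbrakk>e \<in> obs C; f \<in> obs C\<rbrakk> \<Longrightarrow> e \<star> f \<sqsubseteq> f"
  by (simp add: le_iff P.P4_star)

lemma le_absorb:
  assumes "p \<in> obs C" "q \<in> obs C" "p \<sqsubseteq> q"
  shows "q \<otimes> p = p" "p \<otimes> q = p" "p \<star> q = p" "q \<star> p = p"
  using assms P.le_absorb le_iff by auto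

lemma F_times_star: "\<lbrakk>e \<in> obs C; f \<in> obs C\<rbrakk> \<Longrightarrow> F_rel C (e \<otimes> f) (e \<star> f)"
  by (simp add: F_rel_def P.F_times_star)

end

context projection_ordered_cat
begin

lemma r_lrestrict_hom:
  assumes "a \<in> arr C" "e \<in> obs C" "f \<in> obs C" "e \<sqsubseteq> \<^bold>d a" "f \<sqsubseteq> \<^bold>d a"
  shows "\<^bold>r ((e \<otimes> f) \<downharpoonleft> a) = \<^bold>r (e \<downharpoonleft> a) \<otimes> \<^bold>r (f \<downharpoonleft> a)"
    and "\<^bold>r ((e \<star> f) \<downharpoonleft> a) = \<^bold>r (e \<downharpoonleft> a) \<star> \<^bold>r (f \<downharpoonleft> a)"
  using nu_hom[OF assms(1)] assms by (auto simp: projection_hom_def down_def nu_def)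

text \<open>
  The map \<open>\<nu>\<^sub>a\<close> is bijective, so its inverse is a homomorphism as well.
\<close>

lemma d_rrestrict_hom:
  assumes a: "a \<in> arr C" and "e \<in> obs C" "f \<in> obs C" "e \<sqsubseteq> \<^bold>r a" "f \<sqsubseteq> \<^bold>r a"
  shows "\<^bold>d (a \<downharpoonright> (e \<otimes> f)) = \<^bold>d (a \<downharpoonright> e) \<otimes> \<^bold>d (a \<downharpoonright> f)"
    and "\<^bold>d (a \<downharpoonright> (e \<star> f)) = \<^bold>d (a \<downharpoonright> e) \<star> \<^bold>d (a \<downharpoonright> f)"
proof -
  let ?x = "\<^bold>d (a \<downharpoonright> e)" and ?y = "\<^bold>d (a \<downharpoonright> f)"
  have x: "?x \<in> obs C" "?x \<sqsubseteq> \<^bold>d a" "\<^bold>r (?x \<downharpoonleft> a) = e"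
    using assms by (simp_all add: rrestrict_eq_lrestrict d_rrestrict_le)
  have y: "?y \<in> obs C" "?y \<sqsubseteq> \<^bold>d a" "\<^bold>r (?y \<downharpoonleft> a) = f"
    using assms by (simp_all add: rrestrict_eq_lrestrict d_rrestrict_le)
  have t: "?x \<otimes> ?y \<sqsubseteq> \<^bold>d a" "?x \<star> ?y \<sqsubseteq> \<^bold>d a"
    using times_le[of ?x ?y] star_le[of ?x ?y] x y le_trans by blast+
  show "\<^bold>d (a \<downharpoonright> (e \<otimes> f)) = ?x \<otimes> ?y"
    using lrestrict_eq_rrestrict[OF a _ t(1)] r_lrestrict_hom(1)[OF a x(1) y(1) x(2) y(2)] x y t a
    by simp
  show "\<^bold>d (a \<downharpoonright> (e \<star> f)) = ?x \<star> ?y"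
    using lrestrict_eq_rrestrict[OF a _ t(2)] r_lrestrict_hom(2)[OF a x(1) y(1) x(2) y(2)] x y t a
    by simp
qed

end

section \<open>The product of two arrows\<close>

definition chain_mul :: "('a, 'm) chain_cat_scheme \<Rightarrow> 'a \<Rightarrow> 'a \<Rightarrow> 'a" where
  "chain_mul C a b =
     (let p = \<^bold>r\<^bsub>C\<^esub> a \<otimes>\<^bsub>C\<^esub> \<^bold>d\<^bsub>C\<^esub> b; q = \<^bold>r\<^bsub>C\<^esub> a \<star>\<^bsub>C\<^esub> \<^bold>d\<^bsub>C\<^esub> b
      in (a \<downharpoonright>\<^bsub>C\<^esub> p) \<bullet>\<^bsub>C\<^esub> \<epsilon>\<^bsub>C\<^esub> [p, q] \<bullet>\<^bsub>C\<^esub> (q \<downharpoonleft>\<^bsub>C\<^esub> b))"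

text \<open>
  Reversing arrows exchanges domain and range, \<open>\<otimes>\<close> and \<open>\<star>\<close>, left and right restriction, and
  \<open>\<Theta>\<close> and \<open>\<Delta>\<close>. Statements about right restriction follow from those about left restriction here.
\<close>

definition opposite :: "('a, 'm) chain_cat_scheme \<Rightarrow> 'a chain_cat" where
  "opposite C =
     \<lparr> arr = arr C, pcomp = (\<lambda>x y. pcomp C y x), src = tgt C, tgt = src C, leq = leq C,
       ptimes = (\<lambda>e\<in>obs C. \<lambda>f\<in>obs C. f \<star>\<^bsub>C\<^esub> e), pstar = (\<lambda>e\<in>obs C. \<lambda>f\<in>obs C. f \<otimes>\<^bsub>C\<^esub> e),
       evaluation = (\<lambda>ps\<in>rev ` paths C. \<epsilon>\<^bsub>C\<^esub> (rev ps)) \<rparr>"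

lemma opposite_simps [simp]:
  "arr (opposite C) = arr C" "pcomp (opposite C) x y = pcomp C y x"
  "src (opposite C) = tgt C" "tgt (opposite C) = src C" "leq (opposite C) = leq C"
  "ptimes (opposite C) = (\<lambda>e\<in>obs C. \<lambda>f\<in>obs C. f \<star>\<^bsub>C\<^esub> e)"
  "pstar (opposite C) = (\<lambda>e\<in>obs C. \<lambda>f\<in>obs C. f \<otimes>\<^bsub>C\<^esub> e)"
  "evaluation (opposite C) = (\<lambda>ps\<in>rev ` paths C. \<epsilon>\<^bsub>C\<^esub> (rev ps))"
  "x \<bullet>\<^bsub>opposite C\<^esub> y = y \<bullet>\<^bsub>C\<^esub> x"
  "p \<downharpoonleft>\<^bsub>opposite C\<^esub> a = a \<downharpoonright>\<^bsub>C\<^esub> p" "a \<downharpoonright>\<^bsub>opposite C\<^esub> p = p \<downharpoonleft>\<^bsub>C\<^esub> a"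
  by (simp_all add: opposite_def arr_comp_def lrestrict_def rrestrict_def)

context evaluation_projection_ordered_cat
begin

lemma eval_arr [simp]: "ps \<in> paths C \<Longrightarrow> \<epsilon> ps \<in> arr C"
  using eval_closed by auto

lemma eval_pair:
  assumes "p \<in> obs C" "q \<in> obs C" "F_rel C p q"
  shows "[p, q] \<in> paths C" "\<epsilon> [p, q] \<in> arr C" "\<^bold>d (\<epsilon> [p, q]) = p" "\<^bold>r (\<epsilon> [p, q]) = q"
proof -
  show *: "[p, q] \<in> paths C"
    using assms by (simp add: paths_def)
  show "\<epsilon> [p, q] \<in> arr C" "\<^bold>d (\<epsilon> [p, q]) = p" "\<^bold>r (\<epsilon> [p, q]) = q"
    using E2[OF *] * by simp_all
qed

lemma eval_pair_restrict:
  assumes "p \<in> obs C" "q \<in> obs C" "F_rel C p q" "z \<in> obs C" "z \<sqsubseteq> q"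
  shows "F_rel C (p \<otimes> z) z" "\<epsilon> [p \<otimes> z, z] \<sqsubseteq> \<epsilon> [p, q]" "(p \<otimes> z) \<star> q = z"
proof -
  have z: "q \<otimes> z = z"
    using assms le_iff by simp
  note * = P.F_restrict[OF assms(1,2,4) _ _ z]
  show F: "F_rel C (p \<otimes> z) z" and st: "(p \<otimes> z) \<star> q = z"
    using * assms by (simp_all add: F_rel_def)
  have "path_leq C [p \<otimes> z, z] [p, q]"
    unfolding path_leq_def proj_leq_def path_restrict_def using st assms
    by (intro bexI[of _ "p \<otimes> z"]) simp_all
  then show "\<epsilon> [p \<otimes> z, z] \<sqsubseteq> \<epsilon> [p, q]"
    using E4 eval_pair(1) F assms by simp
qed

lemma Theta_obs:
  assumes "b \<in> arr C" "x \<in> obs C"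
  shows "Theta C b x \<in> obs C" "Theta C b x \<sqsubseteq> \<^bold>r b"
  using assms by (simp_all add: Theta_def r_lrestrict_le)

lemma Delta_obs:
  assumes "b \<in> arr C" "x \<in> obs C"
  shows "Delta C b x \<in> obs C" "Delta C b x \<sqsubseteq> \<^bold>d b"
  using assms by (simp_all add: Delta_def d_rrestrict_le)

lemma d_rrestrict_Theta:
  "\<lbrakk>b \<in> arr C; x \<in> obs C\<rbrakk> \<Longrightarrow> \<^bold>d (b \<downharpoonright> Theta C b x) = x \<star> \<^bold>d b"
  by (simp add: Theta_def lrestrict_eq_rrestrict)

lemma r_lrestrict_Delta:
  "\<lbrakk>b \<in> arr C; x \<in> obs C\<rbrakk> \<Longrightarrow> \<^bold>r (Delta C b x \<downharpoonleft> b) = \<^bold>r b \<otimes> x"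
  by (simp add: Delta_def rrestrict_eq_lrestrict)

lemma mul_parts:
  assumes "a \<in> arr C" "b \<in> arr C"
  defines "p \<equiv> \<^bold>r a \<otimes> \<^bold>d b" and "q \<equiv> \<^bold>r a \<star> \<^bold>d b"
  shows "p \<in> obs C" "q \<in> obs C" "p \<sqsubseteq> \<^bold>r a" "q \<sqsubseteq> \<^bold>d b" "F_rel C p q"
    and "chain_mul C a b = (a \<downharpoonright> p) \<bullet> \<epsilon> [p, q] \<bullet> (q \<downharpoonleft> b)"
    and "chain_mul C a b \<in> arr C"
    and "\<^bold>d (chain_mul C a b) = \<^bold>d (a \<downharpoonright> p)" "\<^bold>r (chain_mul C a b) = \<^bold>r (q \<downharpoonleft> b)"
proof -
  show *: "p \<in> obs C" "q \<in> obs C" "p \<sqsubseteq> \<^bold>r a" "q \<sqsubseteq> \<^bold>d b" "F_rel C p q"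
    using assms by (simp_all add: F_times_star)
  show m: "chain_mul C a b = (a \<downharpoonright> p) \<bullet> \<epsilon> [p, q] \<bullet> (q \<downharpoonleft> b)"
    by (simp add: chain_mul_def Let_def p_def q_def)
  show "chain_mul C a b \<in> arr C"
    "\<^bold>d (chain_mul C a b) = \<^bold>d (a \<downharpoonright> p)" "\<^bold>r (chain_mul C a b) = \<^bold>r (q \<downharpoonleft> b)"
    unfolding m using * eval_pair[OF *(1,2,5)] assms(1,2)
    by (simp_all add: comp_closed dom_comp rng_comp)
qed

text \<open>
  The order is compatible with composition and evaluation, so restricting the three factors
  to match one another produces an arrow below the composite; it is the restriction since its range
  is \<open>t\<close>.
\<close>

lemma bridge_rrestrict:
  assumes xy: "x \<in> arr C" "y \<in> arr C" and F: "F_rel C (\<^bold>r x) (\<^bold>d y)"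
    and t: "t \<in> obs C" "t \<sqsubseteq> \<^bold>r y"
  defines "z \<equiv> \<^bold>d (y \<downharpoonright> t)"
  defines "e \<equiv> \<^bold>r x \<otimes> z"
  shows "(x \<bullet> \<epsilon> [\<^bold>r x, \<^bold>d y] \<bullet> y) \<downharpoonright> t = (x \<downharpoonright> e) \<bullet> \<epsilon> [e, z] \<bullet> (y \<downharpoonright> t)"
proof -
  have z: "z \<in> obs C" "z \<sqsubseteq> \<^bold>d y"
    using xy t by (simp_all add: z_def d_rrestrict_le)
  have e: "e \<in> obs C" "e \<sqsubseteq> \<^bold>r x"
    using xy z by (simp_all add: e_def)
  have Fe: "F_rel C e z" and le: "\<epsilon> [e, z] \<sqsubseteq> \<epsilon> [\<^bold>r x, \<^bold>d y]"
    using eval_pair_restrict[OF _ _ F z] xy by (simp_all add: e_def)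
  note ep = eval_pair[OF _ _ F] eval_pair[OF e(1) z(1) Fe]
  have "(x \<downharpoonright> e) \<bullet> \<epsilon> [e, z] \<bullet> (y \<downharpoonright> t) \<sqsubseteq> x \<bullet> \<epsilon> [\<^bold>r x, \<^bold>d y] \<bullet> y"
    using xy e t z ep by (intro O2 le rrestrict_le) (simp_all add: comp_closed rng_comp z_def)
  from le_eq_rrestrict[OF this] show ?thesis
    using xy e t z ep by (simp add: comp_closed rng_comp z_def)
qed

text \<open>
  Here \<open>ab\<close> ends in \<open>\<Theta>\<^sub>b(\<^bold>r a)\<close>, and to be joined with \<open>c\<close> it is restricted to end in
  \<open>t = \<Theta>\<^sub>b(\<^bold>r a) \<otimes> \<^bold>d c\<close>. As \<open>\<nu>\<^sub>b\<close> is an isomorphism of projection algebras, this restricts \<open>b\<close> to start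
  in \<open>z = (\<^bold>r a \<star> \<^bold>d b) \<otimes> \<Delta>\<^sub>b(\<^bold>d c)\<close>, and then the bridge between \<open>a\<close> and \<open>b\<close> to start in \<open>e\<close>.
  What lies between \<open>e\<close> and \<open>f\<close> is \<open>\<lambda>(e, b, f)\<close>. The two \<open>F\<close>-relations hold as the path from \<open>e\<close>
  to \<open>z\<close> is a restriction of a bridge and the path from \<open>t\<close> to \<open>f\<close> is a bridge.
\<close>

lemma mul_assoc_left:
  assumes "a \<in> arr C" "b \<in> arr C" "c \<in> arr C"
  defines "e \<equiv> \<^bold>r a \<otimes> Delta C b (\<^bold>d c)" and "f \<equiv> Theta C b (\<^bold>r a) \<star> \<^bold>d c"
  shows "chain_mul C (chain_mul C a b) c = (a \<downharpoonright> e) \<bullet> lambda C e b f \<bullet> (f \<downharpoonleft> c)"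
    and "F_rel C e (e \<star> \<^bold>d b)" "F_rel C (Theta C b e) f"
proof -
  let ?p = "\<^bold>r a" and ?q = "\<^bold>d b" and ?s = "\<^bold>d c"
  let ?y = "Delta C b ?s" and ?x = "Theta C b ?p"
  let ?z = "(?p \<star> ?q) \<otimes> ?y" and ?t = "?x \<otimes> ?s"
  have y: "?y \<in> obs C" "?y \<sqsubseteq> ?q" and x: "?x \<in> obs C" "?x \<sqsubseteq> \<^bold>r b"
    using Theta_obs Delta_obs assms by simp_all
  have tf: "?t \<in> obs C" "f \<in> obs C" "F_rel C ?t f" "?t \<sqsubseteq> ?x" "?t \<sqsubseteq> \<^bold>r b"
    using x assms le_trans[OF times_le x(2)] by (simp_all add: f_def F_times_star)
  have z: "?z \<in> obs C" "?z \<sqsubseteq> ?p \<star> ?q" "?z \<sqsubseteq> ?q"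
    using y assms le_trans[OF times_le star_le] by simp_all
  have bt: "\<^bold>d (b \<downharpoonright> ?t) = ?z"
  proof -
    have "?t = ?x \<otimes> (\<^bold>r b \<otimes> ?s)"
      using P.L4[of "\<^bold>r b" ?x ?s] le_absorb[OF _ _ x(2)] x assms by simp
    then show ?thesis
      using d_rrestrict_hom(1)[of b ?x "\<^bold>r b \<otimes> ?s"] d_rrestrict_Theta[of b ?p] x assms
      by (simp add: Delta_def)
  qed
  then have bz: "?z \<downharpoonleft> b = b \<downharpoonright> ?t"
    using rrestrict_eq_lrestrict[of b ?t] tf assms by simp
  have qy: "?q \<otimes> ?y = ?y"
    using y assms le_iff by simp
  have e: "e \<in> obs C" "e \<sqsubseteq> ?p" "(?p \<otimes> ?q) \<otimes> ?z = e" "e \<star> ?q = ?z"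
    using P.times_times_star[of ?p ?q ?y] P.times_star_swap[of ?p ?q ?y] qy y assms
    by (simp_all add: e_def)
  have Te: "Theta C b e = ?t"
    using e tf assms bz by (simp add: Theta_def)
  show "F_rel C (Theta C b e) f"
    using Te tf by simp
  note m = mul_parts[OF assms(1,2)]
  have Fez: "F_rel C e ?z"
    using eval_pair_restrict(1)[OF m(1,2,5) z(1,2)] e by simp
  then show "F_rel C e (e \<star> \<^bold>d b)"
    using e by simp
  have rm: "\<^bold>r (chain_mul C a b) = ?x"
    using m(9) by (simp add: Theta_def)
  have t': "((?p \<star> ?q) \<downharpoonleft> b) \<downharpoonright> ?t = b \<downharpoonright> ?t"
    using rrestrict_rrestrict[of b "(?p \<star> ?q) \<downharpoonleft> b" ?t] lrestrict_le[of b "?p \<star> ?q"] m tf rm assms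
    by simp
  have e': "(a \<downharpoonright> (?p \<otimes> ?q)) \<downharpoonright> e = a \<downharpoonright> e"
    using rrestrict_rrestrict[of a "a \<downharpoonright> (?p \<otimes> ?q)" e] rrestrict_le[of a "?p \<otimes> ?q"] m e assms
      times_le[of "?p \<otimes> ?q" ?z] z by simp
  have res: "chain_mul C a b \<downharpoonright> ?t = (a \<downharpoonright> e) \<bullet> \<epsilon> [e, ?z] \<bullet> (?z \<downharpoonleft> b)"
    using bridge_rrestrict[of "a \<downharpoonright> (?p \<otimes> ?q)" "(?p \<star> ?q) \<downharpoonleft> b" ?t] m tf rm e t' e' bt bz assms
    by simp
  note ep = eval_pair[OF e(1) z(1) Fez] eval_pair[OF tf(1-3)]
  have "chain_mul C (chain_mul C a b) c
      = (a \<downharpoonright> e) \<bullet> \<epsilon> [e, ?z] \<bullet> (?z \<downharpoonleft> b) \<bullet> \<epsilon> [?t, f] \<bullet> (f \<downharpoonleft> c)"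
    using mul_parts(6)[OF m(7) assms(3)] res rm by (simp add: f_def)
  also have "\<dots> = (a \<downharpoonright> e) \<bullet> (\<epsilon> [e, ?z] \<bullet> (?z \<downharpoonleft> b) \<bullet> \<epsilon> [?t, f]) \<bullet> (f \<downharpoonleft> c)"
    using ep e z tf bz bt assms(1-3) by (simp add: comp_assoc3 comp_closed dom_comp rng_comp)
  also have "\<epsilon> [e, ?z] \<bullet> (?z \<downharpoonleft> b) \<bullet> \<epsilon> [?t, f] = lambda C e b f"
    using e Te by (simp add: lambda_def Let_def)
  finally show "chain_mul C (chain_mul C a b) c = (a \<downharpoonright> e) \<bullet> lambda C e b f \<bullet> (f \<downharpoonleft> c)" .
qed

end

section \<open>The opposite category\<close>

lemma path_comp_paths:
  assumes "ps \<in> paths C" "qs \<in> paths C" "last ps = hd qs"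
  shows "path_comp ps qs \<in> paths C"
proof -
  obtain x qs' where "qs = x # qs'"
    using assms by (cases qs) (auto simp: paths_def)
  then show ?thesis
    using assms by (cases qs') (auto simp: paths_def path_comp_def successively_append_iff)
qed

lemma star_trail_snoc:
  "star_trail C q (xs @ [y]) = star_trail C q xs @ [last (q # star_trail C q xs) \<star>\<^bsub>C\<^esub> y]"
  by (induction xs arbitrary: q) auto

lemma path_restrict_snoc:
  "ps \<noteq> [] \<Longrightarrow> path_restrict C r (ps @ [y]) = path_restrict C r ps @ [last (path_restrict C r ps) \<star>\<^bsub>C\<^esub> y]"
  by (cases ps) (simp_all add: path_restrict_def star_trail_snoc)

context evaluation_projection_ordered_cat
begin

lemma obs_opposite [simp]: "obs (opposite C) = obs C"
proof -
  have "\<^bold>r x \<in> \<^bold>d ` arr C" if "x \<in> arr C" for x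
    using that by (intro image_eqI[of _ _ "\<^bold>r x"]) simp_all
  moreover have "\<^bold>d x \<in> \<^bold>r ` arr C" if "x \<in> arr C" for x
    using that by (intro image_eqI[of _ _ "\<^bold>d x"]) simp_all
  ultimately show ?thesis
    unfolding obs_def opposite_simps by blast
qed

lemma opposite_arrow_cat: "arrow_cat (opposite C)"
  by unfold_locales
    (simp_all add: nonempty rng_closed dom_closed right_unit left_unit comp_closed dom_comp
      rng_comp comp_assoc, auto simp: pcomp_eq)

lemma F_rel_opposite [simp]:
  "\<lbrakk>e \<in> obs C; f \<in> obs C\<rbrakk> \<Longrightarrow> F_rel (opposite C) e f \<longleftrightarrow> F_rel C f e"
  by (auto simp: F_rel_def)

lemma paths_opposite: "paths (opposite C) = rev ` paths C"
proof -
  have "ps \<in> paths (opposite C) \<longleftrightarrow> rev ps \<in> paths C" for ps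
  proof -
    have "successively (F_rel (opposite C)) ps \<longleftrightarrow> successively (\<lambda>x y. F_rel C y x) ps"
      if "set ps \<subseteq> obs C"
      using that by (intro successively_cong refl F_rel_opposite) blast+
    then show ?thesis
      by (auto simp: paths_def)
  qed
  moreover have "ps \<in> rev ` paths C \<longleftrightarrow> rev ps \<in> paths C" for ps
    using image_eqI[of ps rev "rev ps" "paths C"] by auto
  ultimately show ?thesis
    by blast
qed

lemma eval_opposite:
  assumes "rev ps \<in> paths C"
  shows "\<epsilon>\<^bsub>opposite C\<^esub> ps = \<epsilon> (rev ps)"
proof -
  have "ps \<in> rev ` paths C"
    using imageI[OF assms, of rev] by simp
  then show ?thesis
    by simp
qed

text \<open>
  Restricting a path from its last vertex backwards, by means of \<open>\<otimes>\<close>, yields the same path as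
  restricting it from its first vertex forwards, by means of \<open>\<star>\<close>, provided that the new first vertex
  is known: on each edge \<open>F_restrict\<close> says that the step forwards undoes the step backwards.
\<close>

lemma rev_opposite_restrict:
  assumes "set (q # qs) \<subseteq> obs C" "successively (\<lambda>x y. F_rel C y x) (q # qs)" "r \<in> obs C" "r \<sqsubseteq> q"
  shows "\<exists>r'\<in>obs C. r' \<sqsubseteq> last (q # qs) \<and>
    rev (path_restrict (opposite C) r (q # qs)) = path_restrict C r' (rev (q # qs))"
  using assms
proof (induction qs arbitrary: q r)
  case Nil
  then show ?case
    by (auto simp: path_restrict_def)
next
  case (Cons q2 qs)
  let ?r = "q2 \<otimes> r"
  have r: "?r \<in> obs C" "?r \<sqsubseteq> q2" "?r \<star> q = r"
    using Cons.prems eval_pair_restrict(3)[of q2 q r] by simp_all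
  obtain r' where r': "r' \<in> obs C" "r' \<sqsubseteq> last (q2 # qs)"
    "rev (path_restrict (opposite C) ?r (q2 # qs)) = path_restrict C r' (rev (q2 # qs))"
    using Cons.IH[of q2 ?r] Cons.prems r by auto
  have "last (path_restrict C r' (rev (q2 # qs))) = ?r"
    unfolding r'(3)[symmetric] by (simp add: path_restrict_def)
  then have "path_restrict C r' (rev (q2 # qs) @ [q])
      = rev (path_restrict (opposite C) ?r (q2 # qs)) @ [r]"
    unfolding r'(3) by (subst path_restrict_snoc) (use r(3) in simp_all)
  also have "\<dots> = rev (path_restrict (opposite C) r (q # q2 # qs))"
    using Cons.prems by (simp add: path_restrict_def)
  finally show ?case
    using r' by (intro bexI[of _ r']) simp_all
qed

lemma opposite: "evaluation_projection_ordered_cat (opposite C)"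
proof -
  interpret D: arrow_cat "opposite C"
    by (rule opposite_arrow_cat)
  interpret DP: strong_projection_algebra "obs (opposite C)" "ptimes (opposite C)" "pstar (opposite C)"
    using P.dual by simp
  show ?thesis
  proof unfold_locales
    show "partial_order_on (arr (opposite C)) {(a, b). a \<sqsubseteq>\<^bsub>opposite C\<^esub> b}"
      using order by simp
  next
    fix a b assume "a \<sqsubseteq>\<^bsub>opposite C\<^esub> b"
    then show "\<^bold>d\<^bsub>opposite C\<^esub> a \<sqsubseteq>\<^bsub>opposite C\<^esub> \<^bold>d\<^bsub>opposite C\<^esub> b \<and> \<^bold>r\<^bsub>opposite C\<^esub> a \<sqsubseteq>\<^bsub>opposite C\<^esub> \<^bold>r\<^bsub>opposite C\<^esub> b"
      using O1 by simp
  next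
    fix a b c e
    assume "a \<sqsubseteq>\<^bsub>opposite C\<^esub> b" "c \<sqsubseteq>\<^bsub>opposite C\<^esub> e" "\<^bold>r\<^bsub>opposite C\<^esub> a = \<^bold>d\<^bsub>opposite C\<^esub> c"
      "\<^bold>r\<^bsub>opposite C\<^esub> b = \<^bold>d\<^bsub>opposite C\<^esub> e"
    then show "a \<bullet>\<^bsub>opposite C\<^esub> c \<sqsubseteq>\<^bsub>opposite C\<^esub> b \<bullet>\<^bsub>opposite C\<^esub> e"
      using O2[of c e a b] by simp
  next
    fix a p assume "a \<in> arr (opposite C)" "p \<in> obs (opposite C)" "p \<sqsubseteq>\<^bsub>opposite C\<^esub> \<^bold>d\<^bsub>opposite C\<^esub> a"
    then show "\<exists>!u. u \<sqsubseteq>\<^bsub>opposite C\<^esub> a \<and> \<^bold>d\<^bsub>opposite C\<^esub> u = p"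
      using O4[of a p] by simp
  next
    fix a p assume "a \<in> arr (opposite C)" "p \<in> obs (opposite C)" "p \<sqsubseteq>\<^bsub>opposite C\<^esub> \<^bold>r\<^bsub>opposite C\<^esub> a"
    then show "\<exists>!u. u \<sqsubseteq>\<^bsub>opposite C\<^esub> a \<and> \<^bold>r\<^bsub>opposite C\<^esub> u = p"
      using O3[of a p] by simp
  next
    fix p q assume "p \<in> obs (opposite C)" "q \<in> obs (opposite C)"
    then show "p \<sqsubseteq>\<^bsub>opposite C\<^esub> q \<longleftrightarrow> proj_leq (opposite C) p q"
      using P.le_iff_star[of p q] le_iff[of p q] by (auto simp: proj_leq_def)
  next
    fix a assume "a \<in> arr (opposite C)"
    then show "projection_hom (down (opposite C) (\<^bold>d\<^bsub>opposite C\<^esub> a)) (ptimes (opposite C)) (pstar (opposite C))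
      (down (opposite C) (\<^bold>r\<^bsub>opposite C\<^esub> a)) (ptimes (opposite C)) (pstar (opposite C)) (nu (opposite C) a)"
      using d_rrestrict_hom[of a] by (auto simp: projection_hom_def down_def nu_def d_rrestrict_le)
  next
    show "evaluation (opposite C) \<in> paths (opposite C) \<rightarrow>\<^sub>E arr (opposite C)"
      by (auto simp: paths_opposite)
  next
    fix p assume "p \<in> obs (opposite C)"
    then show "evaluation (opposite C) [p] = p \<and> evaluation (opposite C) [p, p] = p"
      using E1[of p] P.L1[of p] P.R1[of p] eval_opposite[of "[p]"] eval_opposite[of "[p, p]"]
      by (simp add: paths_def F_rel_def)
  next
    fix ps assume "ps \<in> paths (opposite C)"
    then show "\<^bold>d\<^bsub>opposite C\<^esub> (evaluation (opposite C) ps) = hd ps \<and> \<^bold>r\<^bsub>opposite C\<^esub> (evaluation (opposite C) ps) = last ps"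
      using E2 by (auto simp: paths_opposite hd_rev last_rev)
  next
    fix ps qs assume *: "ps \<in> paths (opposite C)" "qs \<in> paths (opposite C)" "last ps = hd qs"
    then have **: "rev ps \<in> paths C" "rev qs \<in> paths C" "last (rev qs) = hd (rev ps)"
      by (auto simp: paths_opposite hd_rev last_rev)
    have "rev (path_comp ps qs) = path_comp (rev qs) (rev ps)"
    proof -
      obtain x qs' where "qs = x # qs'"
        using ** by (cases qs) (auto simp: paths_def)
      moreover obtain ps' y where "ps = ps' @ [y]"
        using ** by (cases ps rule: rev_cases) (auto simp: paths_def)
      ultimately show ?thesis
        using * by (simp add: path_comp_def)
    qed
    then show "evaluation (opposite C) (path_comp ps qs)
      = evaluation (opposite C) ps \<bullet>\<^bsub>opposite C\<^esub> evaluation (opposite C) qs"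
      using E3[OF **(2,1,3)] path_comp_paths[OF **(2,1,3)] **
      by (simp add: eval_opposite del: opposite_simps(8))
  next
    fix ps qs assume *: "ps \<in> paths (opposite C)" "qs \<in> paths (opposite C)" "path_leq (opposite C) ps qs"
    then have **: "rev ps \<in> paths C" "rev qs \<in> paths C"
      by (auto simp: paths_opposite)
    obtain q qs' where qs: "qs = q # qs'"
      using ** by (cases qs) (auto simp: paths_def)
    obtain r where r: "r \<in> obs C" "proj_leq (opposite C) r q" "ps = path_restrict (opposite C) r qs"
      using * qs by (auto simp: path_leq_def)
    have q: "set (q # qs') \<subseteq> obs C" "successively (\<lambda>x y. F_rel C y x) (q # qs')"
      using **(2) by (auto simp: paths_def qs simp del: rev.simps)
    have "r \<sqsubseteq> q"
      using r q P.le_iff_star[of r q] le_iff[of r q] by (auto simp: proj_leq_def)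
    then obtain r' where r': "r' \<in> obs C" "r' \<sqsubseteq> last qs" "rev ps = path_restrict C r' (rev qs)"
      using rev_opposite_restrict[OF q r(1)] r(3) qs by auto
    have "last qs \<in> obs C"
      using q qs by (metis last_in_set list.distinct(1) subsetD)
    then have "path_leq C (rev ps) (rev qs)"
      using r' le_iff[of r' "last qs"] unfolding path_leq_def proj_leq_def
      by (intro bexI[of _ r']) (simp_all add: hd_rev)
    then show "evaluation (opposite C) ps \<sqsubseteq>\<^bsub>opposite C\<^esub> evaluation (opposite C) qs"
      using E4[OF **] * by (simp add: paths_opposite[symmetric])
  qed
qed

end


section \<open>The semigroup of a chain projection ordered category\<close>

text \<open>
  The shift laws generalise \<open>(xy)\<^sup>+x = xy\<^sup>+\<close> and \<open>x(yx)\<^sup>* = y\<^sup>*x\<close> to projections that do not commute, the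
  projection that is moved across \<open>x\<close> being \<open>(x\<^sup>*y)\<^sup>+\<close> rather than \<open>y\<^sup>+\<close>.
\<close>

locale drc_restriction_semigrp = biunary_semigrp +
  assumes plus_mul_self: "x \<in> elems S \<Longrightarrow> x\<^sup>+ \<cdot> x = x"
    and mul_ast_self: "x \<in> elems S \<Longrightarrow> x \<cdot> x\<^sup>* = x"
    and plus_mul: "\<lbrakk>x \<in> elems S; y \<in> elems S\<rbrakk> \<Longrightarrow> (x \<cdot> y)\<^sup>+ = (x \<cdot> y\<^sup>+)\<^sup>+"
    and ast_mul: "\<lbrakk>x \<in> elems S; y \<in> elems S\<rbrakk> \<Longrightarrow> (x \<cdot> y)\<^sup>* = (x\<^sup>* \<cdot> y)\<^sup>*"
    and plus_mul_left: "\<lbrakk>x \<in> elems S; y \<in> elems S\<rbrakk> \<Longrightarrow> x\<^sup>+ \<cdot> (x \<cdot> y)\<^sup>+ = (x \<cdot> y)\<^sup>+"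
    and plus_mul_right: "\<lbrakk>x \<in> elems S; y \<in> elems S\<rbrakk> \<Longrightarrow> (x \<cdot> y)\<^sup>+ \<cdot> x\<^sup>+ = (x \<cdot> y)\<^sup>+"
    and ast_mul_right: "\<lbrakk>x \<in> elems S; y \<in> elems S\<rbrakk> \<Longrightarrow> (x \<cdot> y)\<^sup>* \<cdot> y\<^sup>* = (x \<cdot> y)\<^sup>*"
    and ast_mul_left: "\<lbrakk>x \<in> elems S; y \<in> elems S\<rbrakk> \<Longrightarrow> y\<^sup>* \<cdot> (x \<cdot> y)\<^sup>* = (x \<cdot> y)\<^sup>*"
    and plus_ast: "x \<in> elems S \<Longrightarrow> x\<^sup>+\<^sup>* = x\<^sup>+"
    and ast_plus: "x \<in> elems S \<Longrightarrow> x\<^sup>*\<^sup>+ = x\<^sup>*"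
    and plus_shift: "\<lbrakk>x \<in> elems S; y \<in> elems S\<rbrakk> \<Longrightarrow> (x \<cdot> y)\<^sup>+ \<cdot> x = x \<cdot> (x\<^sup>* \<cdot> y)\<^sup>+"
    and ast_shift: "\<lbrakk>x \<in> elems S; y \<in> elems S\<rbrakk> \<Longrightarrow> x \<cdot> (y \<cdot> x)\<^sup>* = (y \<cdot> x\<^sup>+)\<^sup>* \<cdot> x"

definition semigrp_of_cat :: "'a chain_cat \<Rightarrow> 'a biunary_semigrp" where
  "semigrp_of_cat C =
     \<lparr> elems = arr C, mul = (\<lambda>a\<in>arr C. \<lambda>b\<in>arr C. chain_mul C a b), splus = src C, sast = tgt C \<rparr>"

context evaluation_projection_ordered_cat
begin

lemma mul_opposite:
  assumes "a \<in> arr C" "b \<in> arr C"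
  shows "chain_mul (opposite C) a b = chain_mul C b a"
proof -
  note m = mul_parts[OF assms(2,1)]
  note ep = eval_pair[OF m(1,2,5)]
  have "\<epsilon>\<^bsub>opposite C\<^esub> [\<^bold>r b \<star> \<^bold>d a, \<^bold>r b \<otimes> \<^bold>d a] = \<epsilon> [\<^bold>r b \<otimes> \<^bold>d a, \<^bold>r b \<star> \<^bold>d a]"
    using ep(1) by (subst eval_opposite) simp_all
  then show ?thesis
    using m(1-5) ep assms unfolding m(6)
    by (simp add: chain_mul_def Let_def comp_assoc del: opposite_simps(8))
qed

lemma Theta_opposite: "\<lbrakk>b \<in> arr C; x \<in> obs C\<rbrakk> \<Longrightarrow> Theta (opposite C) b x = Delta C b x"
  and Delta_opposite: "\<lbrakk>b \<in> arr C; x \<in> obs C\<rbrakk> \<Longrightarrow> Delta (opposite C) b x = Theta C b x"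
  by (simp_all add: Theta_def Delta_def)

text \<open>
  The \<open>F\<close>-relations ensure that all composites in \<open>\<rho>(e, b, f)\<close> are defined, so that they can be
  bracketed in the opposite order.
\<close>

lemma lambda_opposite:
  assumes "b \<in> arr C" "e \<in> obs C" "f \<in> obs C" "F_rel C e (Delta C b f)" "F_rel C (\<^bold>r b \<otimes> f) f"
  shows "lambda (opposite C) f b e = rho C e b f"
    and "rho C e b f \<in> arr C" "\<^bold>d (rho C e b f) = e" "\<^bold>r (rho C e b f) = f"
proof -
  note D = Delta_obs[OF assms(1,3)]
  have R: "\<^bold>r b \<otimes> f \<in> obs C"
    using assms by simp
  note e1 = eval_pair[OF assms(2) D(1) assms(4)] and e2 = eval_pair[OF R assms(3,5)]
  have "\<epsilon>\<^bsub>opposite C\<^esub> [Delta C b f, e] = \<epsilon> [e, Delta C b f]"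
    "\<epsilon>\<^bsub>opposite C\<^esub> [f, \<^bold>r b \<otimes> f] = \<epsilon> [\<^bold>r b \<otimes> f, f]"
    using e1(1) e2(1) by (simp_all add: eval_opposite del: opposite_simps(8))
  moreover have "b \<downharpoonright> (\<^bold>r b \<otimes> f) = Delta C b f \<downharpoonleft> b"
    using assms by (simp add: Delta_def rrestrict_eq_lrestrict)
  ultimately show "lambda (opposite C) f b e = rho C e b f"
    using assms D R e1 e2 r_lrestrict_Delta[OF assms(1,3)]
    by (simp add: lambda_def rho_def Let_def Theta_opposite comp_assoc del: opposite_simps(8))
  show "rho C e b f \<in> arr C" "\<^bold>d (rho C e b f) = e" "\<^bold>r (rho C e b f) = f"
    using assms D R e1 e2 r_lrestrict_Delta[OF assms(1,3)]
    by (simp_all add: rho_def Let_def comp_closed dom_comp rng_comp)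
qed

text \<open>
  This is \<open>mul_assoc_left\<close> for the product \<open>(cb)a\<close> in the opposite category, where \<open>e\<close> and \<open>f\<close> exchange
  their roles.
\<close>

lemma mul_assoc_right:
  assumes "a \<in> arr C" "b \<in> arr C" "c \<in> arr C"
  defines "e \<equiv> \<^bold>r a \<otimes> Delta C b (\<^bold>d c)" and "f \<equiv> Theta C b (\<^bold>r a) \<star> \<^bold>d c"
  shows "chain_mul C a (chain_mul C b c) = (a \<downharpoonright> e) \<bullet> rho C e b f \<bullet> (f \<downharpoonleft> c)"
    and "F_rel C e (Delta C b f)" "F_rel C (\<^bold>r b \<otimes> f) f"
proof -
  interpret D: evaluation_projection_ordered_cat "opposite C"
    by (rule opposite)
  note T = Theta_obs[OF assms(2), of "\<^bold>r a"] and De = Delta_obs[OF assms(2)]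
  have ef: "e \<in> obs C" "f \<in> obs C" "e \<sqsubseteq> \<^bold>r a" "f \<sqsubseteq> \<^bold>d c"
    using T De[of "\<^bold>d c"] assms by (simp_all add: e_def f_def)
  have e': "\<^bold>r\<^bsub>opposite C\<^esub> c \<otimes>\<^bsub>opposite C\<^esub> Delta (opposite C) b (\<^bold>d\<^bsub>opposite C\<^esub> a) = f"
    using assms T by (simp add: Delta_opposite)
  have f': "Theta (opposite C) b (\<^bold>r\<^bsub>opposite C\<^esub> c) \<star>\<^bsub>opposite C\<^esub> \<^bold>d\<^bsub>opposite C\<^esub> a = e"
    using assms De[of "\<^bold>d c"] by (simp add: Theta_opposite)
  note L = D.mul_assoc_left[of c b a, unfolded e' f']
  show F1: "F_rel C e (Delta C b f)"
    using L(3) ef De[of f] assms(1-3) by (simp add: Theta_opposite)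
  show F2: "F_rel C (\<^bold>r b \<otimes> f) f"
    using L(2) ef assms(1-3) by simp
  have "chain_mul (opposite C) (chain_mul (opposite C) c b) a = chain_mul C a (chain_mul C b c)"
    using assms mul_parts(7) by (simp add: mul_opposite)
  moreover note lambda_opposite[OF assms(2) ef(1,2) F1 F2]
  ultimately show "chain_mul C a (chain_mul C b c) = (a \<downharpoonright> e) \<bullet> rho C e b f \<bullet> (f \<downharpoonleft> c)"
    using L(1) ef assms(1-3) by (simp add: comp_assoc)
qed

lemma mul_obs_left:
  assumes "x \<in> arr C" "g \<in> obs C" "g \<sqsubseteq> \<^bold>d x"
  shows "chain_mul C g x = g \<downharpoonleft> x"
  using assms le_absorb[of g "\<^bold>d x"] E1[of g] rrestrict_r[of g] d_comp_id[of g] d_comp_id[of "g \<downharpoonleft> x"]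
  by (simp add: chain_mul_def)

lemma mul_obs_right:
  assumes "x \<in> arr C" "g \<in> obs C" "g \<sqsubseteq> \<^bold>r x"
  shows "chain_mul C x g = x \<downharpoonright> g"
  using assms le_absorb[of g "\<^bold>r x"] E1[of g] lrestrict_d[of g] comp_r_id[of g] comp_r_id[of "x \<downharpoonright> g"]
  by (simp add: chain_mul_def)

lemma d_mul_le: "\<lbrakk>x \<in> arr C; y \<in> arr C\<rbrakk> \<Longrightarrow> \<^bold>d (chain_mul C x y) \<sqsubseteq> \<^bold>d x"
  using mul_parts[of x y] d_rrestrict_le by simp

lemma r_mul_le: "\<lbrakk>x \<in> arr C; y \<in> arr C\<rbrakk> \<Longrightarrow> \<^bold>r (chain_mul C x y) \<sqsubseteq> \<^bold>r y"
  using mul_parts[of x y] r_lrestrict_le by simp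

lemma d_mul_d: "\<lbrakk>x \<in> arr C; y \<in> arr C\<rbrakk> \<Longrightarrow> \<^bold>d (chain_mul C x (\<^bold>d y)) = \<^bold>d (chain_mul C x y)"
  using mul_parts(8)[of x y] mul_parts(8)[of x "\<^bold>d y"] by simp

lemma r_mul_r: "\<lbrakk>x \<in> arr C; y \<in> arr C\<rbrakk> \<Longrightarrow> \<^bold>r (chain_mul C (\<^bold>r x) y) = \<^bold>r (chain_mul C x y)"
  using mul_parts(9)[of x y] mul_parts(9)[of "\<^bold>r x" y] by simp

text \<open>
  Both sides are the restriction of \<open>x\<close> to the range \<open>\<^bold>r x \<otimes> \<^bold>d y\<close>.
\<close>

lemma d_mul_shift:
  assumes "x \<in> arr C" "y \<in> arr C"
  shows "chain_mul C (\<^bold>d (chain_mul C x y)) x = chain_mul C x (\<^bold>d (chain_mul C (\<^bold>r x) y))"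
proof -
  let ?p = "\<^bold>r x \<otimes> \<^bold>d y"
  have "\<^bold>d (chain_mul C (\<^bold>r x) y) = ?p"
    using mul_parts(8)[of "\<^bold>r x" y] assms by (simp add: rrestrict_obs)
  then show ?thesis
    using assms d_mul_le[of x y] mul_parts[of x y]
    by (simp add: mul_obs_left mul_obs_right rrestrict_eq_lrestrict)
qed

text \<open>
  Both sides are the restriction of \<open>x\<close> to the domain \<open>\<^bold>r y \<star> \<^bold>d x\<close>.
\<close>

lemma r_mul_shift:
  assumes "x \<in> arr C" "y \<in> arr C"
  shows "chain_mul C x (\<^bold>r (chain_mul C y x)) = chain_mul C (\<^bold>r (chain_mul C y (\<^bold>d x))) x"
proof -
  let ?p = "\<^bold>r y \<star> \<^bold>d x"
  have "\<^bold>r (chain_mul C y (\<^bold>d x)) = ?p"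
    using mul_parts(9)[of y "\<^bold>d x"] assms by (simp add: lrestrict_obs)
  then show ?thesis
    using assms r_mul_le[of y x] mul_parts[of y x]
    by (simp add: mul_obs_left mul_obs_right lrestrict_eq_rrestrict)
qed

end

context chain_projection_ordered_cat
begin

text \<open>
  The two bracketings differ by \<open>\<lambda>(e, b, f)\<close> and \<open>\<rho>(e, b, f)\<close>. That \<open>(e, f)\<close> is \<open>b\<close>-linked follows from
  the path \<open>[\<Theta>\<^sub>b(e), f]\<close> of the first and the path \<open>[e, \<Delta>\<^sub>b(f)]\<close> of the second.
\<close>

lemma mul_assoc:
  assumes "a \<in> arr C" "b \<in> arr C" "c \<in> arr C"
  shows "chain_mul C (chain_mul C a b) c = chain_mul C a (chain_mul C b c)"
proof -
  let ?e = "\<^bold>r a \<otimes> Delta C b (\<^bold>d c)" and ?f = "Theta C b (\<^bold>r a) \<star> \<^bold>d c"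
  have "linked C b ?e ?f"
    using mul_assoc_left(3)[OF assms] mul_assoc_right(2)[OF assms] Theta_obs Delta_obs assms
    by (simp add: linked_def F_rel_def)
  then show ?thesis
    using mul_assoc_left(1)[OF assms] mul_assoc_right(1)[OF assms] G2 assms by simp
qed

end

theorem drc_restriction_semigrp_of_cat:
  assumes "chain_projection_ordered_cat C"
  shows "drc_restriction_semigrp (semigrp_of_cat C)"
proof -
  interpret chain_projection_ordered_cat C
    by (rule assms)
  show ?thesis
  proof unfold_locales
    show "elems (semigrp_of_cat C) \<noteq> {}"
      by (simp add: semigrp_of_cat_def nonempty)
    show "splus (semigrp_of_cat C) \<in> elems (semigrp_of_cat C) \<rightarrow>\<^sub>E elems (semigrp_of_cat C)"
      "sast (semigrp_of_cat C) \<in> elems (semigrp_of_cat C) \<rightarrow>\<^sub>E elems (semigrp_of_cat C)"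
      using dom_closed rng_closed by (simp_all add: semigrp_of_cat_def)
  qed (simp_all add: semigrp_of_cat_def mul_parts(7) d_mul_shift r_mul_shift,
      auto simp: mul_parts(7) mul_assoc mul_obs_left mul_obs_right d_mul_d r_mul_r
        d_mul_le r_mul_le lrestrict_obs rrestrict_obs)
qed

section \<open>The category of a DRC-restriction semigroup\<close>

text \<open>
  Only nonempty words are evaluated: a semigroup need not have an identity.
\<close>

primrec word :: "('a, 'm) semigrp_scheme \<Rightarrow> 'a list \<Rightarrow> 'a" where
  "word S [] = undefined"
| "word S (x # xs) = (if xs = [] then x else x \<cdot>\<^bsub>S\<^esub> word S xs)"

definition projections :: "('a, 'm) biunary_semigrp_scheme \<Rightarrow> 'a set" where
  "projections S = splus S ` elems S"

definition projection_paths :: "('a, 'm) biunary_semigrp_scheme \<Rightarrow> 'a list set" where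
  "projection_paths S =
     {ps. ps \<noteq> [] \<and> set ps \<subseteq> projections S \<and>
       successively (\<lambda>p q. (p \<cdot>\<^bsub>S\<^esub> q)\<^sup>+\<^bsub>S\<^esub> = p \<and> (p \<cdot>\<^bsub>S\<^esub> q)\<^sup>*\<^bsub>S\<^esub> = q) ps}"

text \<open>
  The third conjunct says that \<open>a\<^sup>+\<close> lies below the projection \<open>b\<^sup>+\<close>.
\<close>

definition natural_leq :: "('a, 'm) biunary_semigrp_scheme \<Rightarrow> 'a \<Rightarrow> 'a \<Rightarrow> bool" where
  "natural_leq S a b \<longleftrightarrow> a \<in> elems S \<and> b \<in> elems S \<and>
     b\<^sup>+\<^bsub>S\<^esub> \<cdot>\<^bsub>S\<^esub> a\<^sup>+\<^bsub>S\<^esub> = a\<^sup>+\<^bsub>S\<^esub> \<and> a\<^sup>+\<^bsub>S\<^esub> \<cdot>\<^bsub>S\<^esub> b = a"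

definition cat_of_semigrp :: "('a, 'm) biunary_semigrp_scheme \<Rightarrow> 'a chain_cat" where
  "cat_of_semigrp S =
     \<lparr> arr = elems S,
       pcomp = (\<lambda>x y. if x \<in> elems S \<and> y \<in> elems S \<and> x\<^sup>*\<^bsub>S\<^esub> = y\<^sup>+\<^bsub>S\<^esub> then Some (x \<cdot>\<^bsub>S\<^esub> y) else None),
       src = splus S, tgt = sast S, leq = natural_leq S,
       ptimes = (\<lambda>e\<in>projections S. \<lambda>f\<in>projections S. (e \<cdot>\<^bsub>S\<^esub> f)\<^sup>+\<^bsub>S\<^esub>),
       pstar = (\<lambda>e\<in>projections S. \<lambda>f\<in>projections S. (e \<cdot>\<^bsub>S\<^esub> f)\<^sup>*\<^bsub>S\<^esub>),
       evaluation = (\<lambda>ps\<in>projection_paths S. word S ps) \<rparr>"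

lemma cat_of_semigrp_simps [simp]:
  "arr (cat_of_semigrp S) = elems S"
  "src (cat_of_semigrp S) = splus S" "tgt (cat_of_semigrp S) = sast S"
  "leq (cat_of_semigrp S) = natural_leq S"
  "pcomp (cat_of_semigrp S) x y =
    (if x \<in> elems S \<and> y \<in> elems S \<and> x\<^sup>*\<^bsub>S\<^esub> = y\<^sup>+\<^bsub>S\<^esub> then Some (x \<cdot>\<^bsub>S\<^esub> y) else None)"
  "ptimes (cat_of_semigrp S) = (\<lambda>e\<in>projections S. \<lambda>f\<in>projections S. (e \<cdot>\<^bsub>S\<^esub> f)\<^sup>+\<^bsub>S\<^esub>)"
  "pstar (cat_of_semigrp S) = (\<lambda>e\<in>projections S. \<lambda>f\<in>projections S. (e \<cdot>\<^bsub>S\<^esub> f)\<^sup>*\<^bsub>S\<^esub>)"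
  "evaluation (cat_of_semigrp S) = (\<lambda>ps\<in>projection_paths S. word S ps)"
  "obs (cat_of_semigrp S) = projections S"
  by (simp_all add: cat_of_semigrp_def obs_def projections_def)

lemma F_rel_cat_of_semigrp [simp]:
  "\<lbrakk>p \<in> projections S; q \<in> projections S\<rbrakk> \<Longrightarrow>
    F_rel (cat_of_semigrp S) p q \<longleftrightarrow> (p \<cdot>\<^bsub>S\<^esub> q)\<^sup>+\<^bsub>S\<^esub> = p \<and> (p \<cdot>\<^bsub>S\<^esub> q)\<^sup>*\<^bsub>S\<^esub> = q"
  by (simp add: F_rel_def)

lemma paths_cat_of_semigrp [simp]: "paths (cat_of_semigrp S) = projection_paths S"
proof -
  have "successively (F_rel (cat_of_semigrp S)) ps
      \<longleftrightarrow> successively (\<lambda>p q. (p \<cdot>\<^bsub>S\<^esub> q)\<^sup>+\<^bsub>S\<^esub> = p \<and> (p \<cdot>\<^bsub>S\<^esub> q)\<^sup>*\<^bsub>S\<^esub> = q) ps"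
    if "set ps \<subseteq> projections S" for ps
    using that by (intro successively_cong refl F_rel_cat_of_semigrp) blast+
  then show ?thesis
    by (auto simp: paths_def projection_paths_def)
qed

lemma comp_cat_of_semigrp [simp]:
  "\<lbrakk>x \<in> elems S; y \<in> elems S; x\<^sup>*\<^bsub>S\<^esub> = y\<^sup>+\<^bsub>S\<^esub>\<rbrakk> \<Longrightarrow> x \<bullet>\<^bsub>cat_of_semigrp S\<^esub> y = x \<cdot>\<^bsub>S\<^esub> y"
  by (simp add: arr_comp_def)

context biunary_semigrp
begin

lemma mul_in [simp]: "\<lbrakk>x \<in> elems S; y \<in> elems S\<rbrakk> \<Longrightarrow> x \<cdot> y \<in> elems S"
  using mul_closed by auto

lemma plus_in [simp]: "x \<in> elems S \<Longrightarrow> x\<^sup>+ \<in> elems S"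
  and ast_in [simp]: "x \<in> elems S \<Longrightarrow> x\<^sup>* \<in> elems S"
  using plus_closed ast_closed by auto

end

context drc_restriction_semigrp
begin

lemma plus_plus [simp]: "x \<in> elems S \<Longrightarrow> x\<^sup>+\<^sup>+ = x\<^sup>+"
  using ast_plus[of "x\<^sup>+"] plus_ast[of x] by simp

lemma ast_ast [simp]: "x \<in> elems S \<Longrightarrow> x\<^sup>*\<^sup>* = x\<^sup>*"
  using plus_ast[of "x\<^sup>*"] ast_plus[of x] by simp

lemma proj_iff: "p \<in> projections S \<longleftrightarrow> p \<in> elems S \<and> p\<^sup>+ = p"
  by (auto simp: projections_def intro: image_eqI[of p _ p])

lemma proj_in [simp]: "p \<in> projections S \<Longrightarrow> p \<in> elems S"
  and proj_plus [simp]: "p \<in> projections S \<Longrightarrow> p\<^sup>+ = p"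
  and plus_proj [simp]: "x \<in> elems S \<Longrightarrow> x\<^sup>+ \<in> projections S"
  and ast_proj [simp]: "x \<in> elems S \<Longrightarrow> x\<^sup>* \<in> projections S"
  by (simp_all add: proj_iff ast_plus)

lemma proj_ast [simp]: "p \<in> projections S \<Longrightarrow> p\<^sup>* = p"
  using plus_ast[of p] by simp

lemma proj_idem [simp]: "p \<in> projections S \<Longrightarrow> p \<cdot> p = p"
  using mul_ast_self[of p] by simp

lemma mul_plus_ext [simp]:
  "\<lbrakk>x \<in> elems S; y \<in> elems S\<rbrakk> \<Longrightarrow> x\<^sup>+ \<cdot> (x \<cdot> y) = x \<cdot> y"
  "\<lbrakk>x \<in> elems S; y \<in> elems S\<rbrakk> \<Longrightarrow> x \<cdot> (x\<^sup>* \<cdot> y) = x \<cdot> y"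
  by (simp_all add: assoc[symmetric] plus_mul_self mul_ast_self)

lemma proj_mul_ext [simp]: "\<lbrakk>p \<in> projections S; y \<in> elems S\<rbrakk> \<Longrightarrow> p \<cdot> (p \<cdot> y) = p \<cdot> y"
  using mul_plus_ext(1)[of p y] by simp

text \<open>
  As rewrite rules these equations and their duals normalise products of projections, which is
  enough to verify the laws of a projection algebra; the strong laws rely on the shift laws as well.
\<close>

lemma proj_plus_absorb [simp]:
  assumes "e \<in> projections S" "f \<in> elems S"
  shows "e \<cdot> (e \<cdot> f)\<^sup>+ = (e \<cdot> f)\<^sup>+" "(e \<cdot> f)\<^sup>+ \<cdot> e = (e \<cdot> f)\<^sup>+"
    and "g \<in> elems S \<Longrightarrow> (e \<cdot> f)\<^sup>+ \<cdot> (e \<cdot> g) = (e \<cdot> f)\<^sup>+ \<cdot> g"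
    and "(e \<cdot> f)\<^sup>+ \<cdot> f = e \<cdot> f"
    and "g \<in> elems S \<Longrightarrow> (e \<cdot> f)\<^sup>+ \<cdot> (f \<cdot> g) = e \<cdot> (f \<cdot> g)"
proof -
  show 1: "e \<cdot> (e \<cdot> f)\<^sup>+ = (e \<cdot> f)\<^sup>+" and 2: "(e \<cdot> f)\<^sup>+ \<cdot> e = (e \<cdot> f)\<^sup>+"
    using plus_mul_left[of e f] plus_mul_right[of e f] assms by simp_all
  show 3: "(e \<cdot> f)\<^sup>+ \<cdot> (e \<cdot> g) = (e \<cdot> f)\<^sup>+ \<cdot> g" if "g \<in> elems S" for g
    using assoc[of "(e \<cdot> f)\<^sup>+" e g] 2 assms that by simp
  show 4: "(e \<cdot> f)\<^sup>+ \<cdot> f = e \<cdot> f"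
    using 3[of f] plus_mul_self[of "e \<cdot> f"] assms by simp
  show "(e \<cdot> f)\<^sup>+ \<cdot> (f \<cdot> g) = e \<cdot> (f \<cdot> g)" if "g \<in> elems S" for g
    using assoc[of "(e \<cdot> f)\<^sup>+" f g] assoc[of e f g] 4 assms that by simp
qed

lemma proj_ast_absorb [simp]:
  assumes "e \<in> elems S" "f \<in> projections S"
  shows "(e \<cdot> f)\<^sup>* \<cdot> f = (e \<cdot> f)\<^sup>*" "f \<cdot> (e \<cdot> f)\<^sup>* = (e \<cdot> f)\<^sup>*"
    and "g \<in> elems S \<Longrightarrow> (e \<cdot> f)\<^sup>* \<cdot> (f \<cdot> g) = (e \<cdot> f)\<^sup>* \<cdot> g"
    and "e \<cdot> (e \<cdot> f)\<^sup>* = e \<cdot> f"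
    and "g \<in> elems S \<Longrightarrow> e \<cdot> ((e \<cdot> f)\<^sup>* \<cdot> g) = e \<cdot> (f \<cdot> g)"
proof -
  show 1: "(e \<cdot> f)\<^sup>* \<cdot> f = (e \<cdot> f)\<^sup>*" and 2: "f \<cdot> (e \<cdot> f)\<^sup>* = (e \<cdot> f)\<^sup>*"
    using ast_mul_left[of e f] ast_mul_right[of e f] assms by simp_all
  show "(e \<cdot> f)\<^sup>* \<cdot> (f \<cdot> g) = (e \<cdot> f)\<^sup>* \<cdot> g" if "g \<in> elems S" for g
    using assoc[of "(e \<cdot> f)\<^sup>*" f g] 1 assms that by simp
  show 4: "e \<cdot> (e \<cdot> f)\<^sup>* = e \<cdot> f"
    using assoc[of e f "(e \<cdot> f)\<^sup>*"] 2 mul_ast_self[of "e \<cdot> f"] assms by simp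
  show "e \<cdot> ((e \<cdot> f)\<^sup>* \<cdot> g) = e \<cdot> (f \<cdot> g)" if "g \<in> elems S" for g
    using assoc[of e "(e \<cdot> f)\<^sup>*" g] assoc[of e f g] 4 assms that by simp
qed

lemma strong_projection_algebra_projections:
  "strong_projection_algebra (projections S)
    (\<lambda>e\<in>projections S. \<lambda>f\<in>projections S. (e \<cdot> f)\<^sup>+) (\<lambda>e\<in>projections S. \<lambda>f\<in>projections S. (e \<cdot> f)\<^sup>*)"
proof (unfold_locales, goal_cases)
  case 1
  then show ?case
    using nonempty unfolding projections_def by blast
next
  \<comment> \<open>For \<open>h = (e \<otimes> f) \<otimes> g\<close> the law asserts \<open>(e(hf)\<^sup>*)\<^sup>+ = h\<close>. As \<open>h \<le> e\<close>, shifting \<open>h\<close> across \<open>ef\<close>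
    gives \<open>e(hf)\<^sup>* = hef\<close>.\<close>
  case (16 e f g)
  let ?h = "((e \<cdot> f)\<^sup>+ \<cdot> g)\<^sup>+"
  let ?k = "(?h \<cdot> f)\<^sup>*"
  have h: "?h \<in> projections S" "?h \<cdot> (e \<cdot> f)\<^sup>+ = ?h"
    using plus_mul_right[of "(e \<cdot> f)\<^sup>+" g] 16 by simp_all
  have "?h \<cdot> e = ?h"
    using assoc[of ?h "(e \<cdot> f)\<^sup>+" e] h 16 by simp
  then have hef: "?h \<cdot> (e \<cdot> f) = ?h \<cdot> f"
    using assoc[of ?h e f] h 16 by simp
  have "e \<cdot> ?k = (e \<cdot> f) \<cdot> (?h \<cdot> (e \<cdot> f))\<^sup>*"
    using assoc[of e f ?k] h 16 hef by simp
  also have "\<dots> = ?h \<cdot> (e \<cdot> f)"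
    using ast_shift[of "e \<cdot> f" ?h] h 16 by simp
  finally have "(e \<cdot> ?k)\<^sup>+ = ?h"
    using plus_mul[of ?h "e \<cdot> f"] h 16 by simp
  then show ?case
    using 16 by simp
next
  \<comment> \<open>Dually, for \<open>h = g \<star> (f \<star> e)\<close>, shifting \<open>h\<close> across \<open>fe\<close> gives \<open>(fh)\<^sup>+e = feh\<close>.\<close>
  case (17 e f g)
  let ?h = "(g \<cdot> (f \<cdot> e)\<^sup>*)\<^sup>*"
  let ?k = "(f \<cdot> ?h)\<^sup>+"
  have h: "?h \<in> projections S" "(f \<cdot> e)\<^sup>* \<cdot> ?h = ?h"
    using ast_mul_left[of g "(f \<cdot> e)\<^sup>*"] 17 by simp_all
  have "e \<cdot> ?h = ?h"
    using assoc[of e "(f \<cdot> e)\<^sup>*" ?h] h 17 by simp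
  then have feh: "(f \<cdot> e) \<cdot> ?h = f \<cdot> ?h"
    using assoc[of f e ?h] h 17 by simp
  have "?k \<cdot> e = ((f \<cdot> e) \<cdot> ?h)\<^sup>+ \<cdot> (f \<cdot> e)"
    using assoc[of ?k f e] h 17 feh by simp
  also have "\<dots> = (f \<cdot> e) \<cdot> ?h"
    using plus_shift[of "f \<cdot> e" ?h] h 17 by simp
  finally have "(?k \<cdot> e)\<^sup>* = ?h"
    using ast_mul[of "f \<cdot> e" ?h] h 17 by simp
  then show ?case
    using 17 by simp
qed (simp_all add: plus_mul[symmetric] ast_mul[symmetric] assoc plus_ast ast_plus)

end

context evaluation_projection_ordered_cat
begin

text \<open>
  Being \<open>b\<close>-linked is what makes the composites in \<open>\<lambda>(e, b, f)\<close> defined; with the dual statement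
  below this covers \<open>\<rho>(e, b, f)\<close> too. From \<open>e = e \<otimes> y\<close> with \<open>y = \<Delta>\<^sub>b(f) \<le> \<^bold>d b\<close> one gets
  \<open>x = x \<otimes> y\<close> for \<open>x = e \<star> \<^bold>d b\<close>, and \<open>\<nu>\<^sub>b\<close> maps this to the relation between \<open>\<Theta>\<^sub>b(e)\<close> and \<open>f\<close>.
\<close>

lemma linked_F_left:
  assumes b: "b \<in> arr C" and l: "linked C b e f"
  shows "F_rel C e (e \<star> \<^bold>d b)" "F_rel C (Theta C b e) f"
proof -
  let ?y = "Delta C b f" and ?x = "e \<star> \<^bold>d b"
  have ef: "e \<in> obs C" "f \<in> obs C" "Theta C b e \<star> f = f" "e \<otimes> ?y = e"
    using l by (simp_all add: linked_def)
  have y: "?y \<in> obs C" "\<^bold>d b \<otimes> ?y = ?y"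
    using Delta_obs[OF b ef(2)] le_iff[of ?y "\<^bold>d b"] b by simp_all
  have x: "?x \<in> obs C" "?x \<sqsubseteq> \<^bold>d b"
    using ef b by simp_all
  have t: "Theta C b e \<in> obs C" "Theta C b e \<sqsubseteq> \<^bold>r b"
    using Theta_obs[OF b ef(1)] by simp_all
  have "e = (e \<otimes> \<^bold>d b) \<otimes> ?y"
    using P.L3[of e "\<^bold>d b" ?y] ef y b by simp
  then have "(e \<otimes> \<^bold>d b) \<otimes> e = e"
    using P.times_absorb[of "e \<otimes> \<^bold>d b" ?y] ef(1) y(1) b by simp
  then have "e \<otimes> \<^bold>d b = e"
    using P.L2[of e "\<^bold>d b"] ef b by simp
  then show "F_rel C e (e \<star> \<^bold>d b)"
    using F_times_star[of e "\<^bold>d b"] ef b by simp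
  have "?x \<otimes> ?y = ?x"
    using P.times_star_swap[of e "\<^bold>d b" ?y] ef y b by simp
  then have "Theta C b e = Theta C b e \<otimes> (\<^bold>r b \<otimes> f)"
    using r_lrestrict_hom(1)[OF b x(1) y(1) x(2) Delta_obs(2)[OF b ef(2)]] r_lrestrict_Delta[OF b ef(2)]
    by (simp add: Theta_def)
  also have "\<dots> = Theta C b e \<otimes> f"
    using P.L4[of "\<^bold>r b" "Theta C b e" f] le_absorb(1)[OF t(1) _ t(2)] ef t b by simp
  finally show "F_rel C (Theta C b e) f"
    using ef by (simp add: F_rel_def)
qed

lemma linked_F_right:
  assumes b: "b \<in> arr C" and l: "linked C b e f"
  shows "F_rel C e (Delta C b f)" "F_rel C (\<^bold>r b \<otimes> f) f"
proof -
  interpret D: evaluation_projection_ordered_cat "opposite C"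
    by (rule opposite)
  have ef: "e \<in> obs C" "f \<in> obs C"
    using l by (simp_all add: linked_def)
  have "linked (opposite C) b f e"
    using l Theta_obs[OF b, of e] Delta_obs[OF b, of f] b
    by (simp add: linked_def Theta_opposite Delta_opposite)
  from D.linked_F_left[OF _ this] show "F_rel C e (Delta C b f)" "F_rel C (\<^bold>r b \<otimes> f) f"
    using ef Delta_obs[OF b, of f] b by (simp_all add: Theta_opposite)
qed

end

context drc_restriction_semigrp
begin

abbreviation K :: "'a chain_cat" where "K \<equiv> cat_of_semigrp S"

lemma proj_le_right:
  assumes "e \<in> projections S" "f \<in> projections S" "f \<cdot> e = e"
  shows "e \<cdot> f = e"
  using proj_plus_absorb(2)[of f e] assms by simp

lemma proj_le_iff_plus:
  assumes "e \<in> projections S" "f \<in> projections S"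
  shows "(f \<cdot> e)\<^sup>+ = e \<longleftrightarrow> f \<cdot> e = e"
proof
  assume "(f \<cdot> e)\<^sup>+ = e"
  then show "f \<cdot> e = e"
    using proj_plus_absorb(1)[of f e] proj_in assms by metis
qed (use assms in simp)

lemma natural_leqD:
  assumes "natural_leq S a b"
  shows "a \<in> elems S" "b \<in> elems S" "b\<^sup>+ \<cdot> a\<^sup>+ = a\<^sup>+" "a\<^sup>+ \<cdot> b\<^sup>+ = a\<^sup>+" "a\<^sup>+ \<cdot> b = a"
    and "b\<^sup>* \<cdot> a\<^sup>* = a\<^sup>*" "a\<^sup>* \<cdot> b\<^sup>* = a\<^sup>*" "b \<cdot> a\<^sup>* = a"
proof -
  show ab: "a \<in> elems S" "b \<in> elems S" "b\<^sup>+ \<cdot> a\<^sup>+ = a\<^sup>+" "a\<^sup>+ \<cdot> b = a"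
    using assms by (simp_all add: natural_leq_def)
  then show 1: "a\<^sup>+ \<cdot> b\<^sup>+ = a\<^sup>+"
    by (simp add: proj_le_right)
  show "b\<^sup>* \<cdot> a\<^sup>* = a\<^sup>*" "a\<^sup>* \<cdot> b\<^sup>* = a\<^sup>*"
    using ast_mul_left[of "a\<^sup>+" b] ast_mul_right[of "a\<^sup>+" b] ab by simp_all
  show "b \<cdot> a\<^sup>* = a"
    using ast_shift[of b "a\<^sup>+"] ab 1 by (simp add: plus_ast)
qed

text \<open>
  By the shift laws the order could equally be defined from the right, which gives restriction
  to both sides.
\<close>

lemma natural_leq_right:
  "natural_leq S a b \<longleftrightarrow> a \<in> elems S \<and> b \<in> elems S \<and> b\<^sup>* \<cdot> a\<^sup>* = a\<^sup>* \<and> b \<cdot> a\<^sup>* = a"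
proof
  assume "natural_leq S a b"
  then show "a \<in> elems S \<and> b \<in> elems S \<and> b\<^sup>* \<cdot> a\<^sup>* = a\<^sup>* \<and> b \<cdot> a\<^sup>* = a"
    using natural_leqD by blast
next
  assume *: "a \<in> elems S \<and> b \<in> elems S \<and> b\<^sup>* \<cdot> a\<^sup>* = a\<^sup>* \<and> b \<cdot> a\<^sup>* = a"
  then have "b\<^sup>+ \<cdot> a\<^sup>+ = a\<^sup>+"
    using plus_mul_left[of b "a\<^sup>*"] by simp
  moreover have "a\<^sup>+ \<cdot> b = a"
    using plus_shift[of b "a\<^sup>*"] * by (simp add: ast_plus)
  ultimately show "natural_leq S a b"
    using * by (simp add: natural_leq_def)
qed

lemma natural_leq_proj:
  "\<lbrakk>e \<in> projections S; f \<in> elems S\<rbrakk> \<Longrightarrow> natural_leq S e f\<^sup>+ \<longleftrightarrow> f\<^sup>+ \<cdot> e = e"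
  "\<lbrakk>e \<in> projections S; f \<in> elems S\<rbrakk> \<Longrightarrow> natural_leq S e f\<^sup>* \<longleftrightarrow> f\<^sup>* \<cdot> e = e"
  using proj_le_right[of e "f\<^sup>+"] proj_le_right[of e "f\<^sup>*"] by (auto simp: natural_leq_def ast_plus)

lemma ordered_cat_K: "ordered_cat K"
proof unfold_locales
  show "arr K \<noteq> {}"
    using nonempty unfolding cat_of_semigrp_simps .
  show "src K \<in> arr K \<rightarrow>\<^sub>E arr K" "tgt K \<in> arr K \<rightarrow>\<^sub>E arr K"
    using plus_closed ast_closed by simp_all
  fix x y
  show "pcomp K x y \<noteq> None \<longleftrightarrow> x \<in> arr K \<and> y \<in> arr K \<and> \<^bold>r\<^bsub>K\<^esub> x = \<^bold>d\<^bsub>K\<^esub> y"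
    by simp
next
  fix x y assume *: "x \<in> arr K" "y \<in> arr K" "\<^bold>r\<^bsub>K\<^esub> x = \<^bold>d\<^bsub>K\<^esub> y"
  then show "x \<bullet>\<^bsub>K\<^esub> y \<in> arr K"
    by simp
  show "\<^bold>d\<^bsub>K\<^esub> (x \<bullet>\<^bsub>K\<^esub> y) = \<^bold>d\<^bsub>K\<^esub> x"
    using * plus_mul[of x y] mul_ast_self[of x] by simp
  show "\<^bold>r\<^bsub>K\<^esub> (x \<bullet>\<^bsub>K\<^esub> y) = \<^bold>r\<^bsub>K\<^esub> y"
    using * ast_mul[of x y] by (simp add: plus_mul_self)
next
  fix x y z assume "x \<in> arr K" "y \<in> arr K" "z \<in> arr K" "\<^bold>r\<^bsub>K\<^esub> x = \<^bold>d\<^bsub>K\<^esub> y" "\<^bold>r\<^bsub>K\<^esub> y = \<^bold>d\<^bsub>K\<^esub> z"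
  moreover from this have "(x \<cdot> y)\<^sup>* = z\<^sup>+" "(y \<cdot> z)\<^sup>+ = x\<^sup>*"
    using ast_mul[of x y] plus_mul[of y z] by (simp_all add: plus_mul_self) (metis mul_ast_self)
  ultimately show "x \<bullet>\<^bsub>K\<^esub> y \<bullet>\<^bsub>K\<^esub> z = x \<bullet>\<^bsub>K\<^esub> (y \<bullet>\<^bsub>K\<^esub> z)"
    by (simp add: assoc)
next
  fix x assume "x \<in> arr K"
  then show "pcomp K (\<^bold>d\<^bsub>K\<^esub> x) x = Some x" "pcomp K x (\<^bold>r\<^bsub>K\<^esub> x) = Some x"
    by (simp_all add: plus_mul_self mul_ast_self plus_ast ast_plus)
next
  have "natural_leq S a a" if "a \<in> elems S" for a
    using that by (simp add: natural_leq_def plus_mul_self)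
  moreover have "natural_leq S a c" if ab: "natural_leq S a b" and bc: "natural_leq S b c" for a b c
  proof -
    note * = natural_leqD(1-5)[OF ab] natural_leqD(1-5)[OF bc]
    have "c\<^sup>+ \<cdot> a\<^sup>+ = a\<^sup>+"
      using assoc[of "c\<^sup>+" "b\<^sup>+" "a\<^sup>+"] * by simp
    moreover have "a\<^sup>+ \<cdot> c = a"
      using assoc[of "a\<^sup>+" "b\<^sup>+" c] * by simp
    ultimately show ?thesis
      using * by (simp add: natural_leq_def)
  qed
  moreover have "a = b" if ab: "natural_leq S a b" and ba: "natural_leq S b a" for a b
  proof -
    note * = natural_leqD(1-5)[OF ab] natural_leqD(1-5)[OF ba]
    have "a\<^sup>+ = b\<^sup>+"
      using * by metis
    then show ?thesis
      using *(5) plus_mul_self[OF *(2)] by metis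
  qed
  ultimately show "partial_order_on (arr K) {(a, b). a \<sqsubseteq>\<^bsub>K\<^esub> b}"
    using natural_leqD(1,2) unfolding partial_order_on_def preorder_on_def refl_on_def trans_def antisym_def
    by (simp only: cat_of_semigrp_simps) blast
next
  fix a b assume "a \<sqsubseteq>\<^bsub>K\<^esub> b"
  then show "\<^bold>d\<^bsub>K\<^esub> a \<sqsubseteq>\<^bsub>K\<^esub> \<^bold>d\<^bsub>K\<^esub> b \<and> \<^bold>r\<^bsub>K\<^esub> a \<sqsubseteq>\<^bsub>K\<^esub> \<^bold>r\<^bsub>K\<^esub> b"
    using natural_leqD[of a b] by (simp add: natural_leq_proj)
next
  fix a b c e assume "a \<sqsubseteq>\<^bsub>K\<^esub> b" "c \<sqsubseteq>\<^bsub>K\<^esub> e" and r: "\<^bold>r\<^bsub>K\<^esub> a = \<^bold>d\<^bsub>K\<^esub> c" "\<^bold>r\<^bsub>K\<^esub> b = \<^bold>d\<^bsub>K\<^esub> e"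
  then have ab: "natural_leq S a b" and ce: "natural_leq S c e"
    by simp_all
  note * = natural_leqD[OF ab] natural_leqD[OF ce]
  have "(a \<cdot> c)\<^sup>+ = a\<^sup>+" "(b \<cdot> e)\<^sup>+ = b\<^sup>+"
    using plus_mul[of a c] plus_mul[of b e] r mul_ast_self[of a] mul_ast_self[of b] * by simp_all
  moreover have "a\<^sup>+ \<cdot> (b \<cdot> e) = a \<cdot> c"
  proof -
    have "a \<cdot> e = a \<cdot> (c\<^sup>+ \<cdot> e)"
      using r mul_plus_ext(2)[of a e] * by simp
    then show ?thesis
      using assoc[of "a\<^sup>+" b e] * by simp
  qed
  ultimately show "a \<bullet>\<^bsub>K\<^esub> c \<sqsubseteq>\<^bsub>K\<^esub> b \<bullet>\<^bsub>K\<^esub> e"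
    using * r by (simp add: natural_leq_def)
next
  fix a p assume "a \<in> arr K" "p \<in> obs K" "p \<sqsubseteq>\<^bsub>K\<^esub> \<^bold>d\<^bsub>K\<^esub> a"
  then have *: "a \<in> elems S" "p \<in> projections S" "a\<^sup>+ \<cdot> p = p"
    by (simp_all add: natural_leq_proj)
  then have d: "(p \<cdot> a)\<^sup>+ = p"
    using plus_mul[of p a] proj_le_right[of p "a\<^sup>+"] by simp
  show "\<exists>!u. u \<sqsubseteq>\<^bsub>K\<^esub> a \<and> \<^bold>d\<^bsub>K\<^esub> u = p"
  proof (intro ex1I[of _ "p \<cdot> a"])
    show "p \<cdot> a \<sqsubseteq>\<^bsub>K\<^esub> a \<and> \<^bold>d\<^bsub>K\<^esub> (p \<cdot> a) = p"
      using * d by (simp add: natural_leq_def)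
  qed (auto dest: natural_leqD(5))
next
  fix a p assume "a \<in> arr K" "p \<in> obs K" "p \<sqsubseteq>\<^bsub>K\<^esub> \<^bold>r\<^bsub>K\<^esub> a"
  then have *: "a \<in> elems S" "p \<in> projections S" "a\<^sup>* \<cdot> p = p"
    by (simp_all add: natural_leq_proj)
  then have d: "(a \<cdot> p)\<^sup>* = p"
    using ast_mul[of a p] by simp
  show "\<exists>!u. u \<sqsubseteq>\<^bsub>K\<^esub> a \<and> \<^bold>r\<^bsub>K\<^esub> u = p"
  proof (intro ex1I[of _ "a \<cdot> p"])
    show "a \<cdot> p \<sqsubseteq>\<^bsub>K\<^esub> a \<and> \<^bold>r\<^bsub>K\<^esub> (a \<cdot> p) = p"
      using * d by (simp add: natural_leq_right)
  qed (auto dest: natural_leqD(8))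
qed

end

context drc_restriction_semigrp
begin

lemma lrestrict_K:
  assumes "a \<in> elems S" "p \<in> projections S" "a\<^sup>+ \<cdot> p = p"
  shows "p \<downharpoonleft>\<^bsub>K\<^esub> a = p \<cdot> a" "(p \<cdot> a)\<^sup>+ = p"
proof -
  interpret K: ordered_cat K
    by (rule ordered_cat_K)
  show d: "(p \<cdot> a)\<^sup>+ = p"
    using plus_mul[of p a] proj_le_right[of p "a\<^sup>+"] assms by simp
  have "natural_leq S (p \<cdot> a) a"
    using assms d by (simp add: natural_leq_def)
  then show "p \<downharpoonleft>\<^bsub>K\<^esub> a = p \<cdot> a"
    using K.le_eq_lrestrict[of "p \<cdot> a" a] d by simp
qed

lemma rrestrict_K:
  assumes "a \<in> elems S" "p \<in> projections S" "a\<^sup>* \<cdot> p = p"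
  shows "a \<downharpoonright>\<^bsub>K\<^esub> p = a \<cdot> p" "(a \<cdot> p)\<^sup>* = p"
proof -
  interpret K: ordered_cat K
    by (rule ordered_cat_K)
  show d: "(a \<cdot> p)\<^sup>* = p"
    using ast_mul[of a p] assms by simp
  have "natural_leq S (a \<cdot> p) a"
    using assms d by (simp add: natural_leq_right)
  then show "a \<downharpoonright>\<^bsub>K\<^esub> p = a \<cdot> p"
    using K.le_eq_rrestrict[of "a \<cdot> p" a] d by simp
qed

text \<open>
  For \<open>x = (pa)\<^sup>*\<close> and \<open>y = (qa)\<^sup>*\<close> the shift laws give \<open>ax = pa\<close> and \<open>ay = qa\<close>, whence \<open>axy = pqa\<close>. Taking
  \<open>\<^sup>*\<close> of this equation, or taking \<open>\<^sup>+\<close> and shifting the result back across \<open>a\<close>, yields the two claims.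
\<close>

lemma ast_restrict_hom:
  assumes a: "a \<in> elems S" and p: "p \<in> projections S" "a\<^sup>+ \<cdot> p = p"
    and q: "q \<in> projections S" "a\<^sup>+ \<cdot> q = q"
  shows "((p \<cdot> q)\<^sup>+ \<cdot> a)\<^sup>* = ((p \<cdot> a)\<^sup>* \<cdot> (q \<cdot> a)\<^sup>*)\<^sup>+"
    and "((p \<cdot> q)\<^sup>* \<cdot> a)\<^sup>* = ((p \<cdot> a)\<^sup>* \<cdot> (q \<cdot> a)\<^sup>*)\<^sup>*"
proof -
  define x where "x = (p \<cdot> a)\<^sup>*"
  define y where "y = (q \<cdot> a)\<^sup>*"
  have xy: "x \<in> projections S" "y \<in> projections S" "a\<^sup>* \<cdot> x = x"
    using a p q ast_mul_left[of p a] by (simp_all add: x_def y_def)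
  have ax: "a \<cdot> x = p \<cdot> a" and ay: "a \<cdot> y = q \<cdot> a"
    using ast_shift[of a p] ast_shift[of a q] proj_le_right[of p "a\<^sup>+"] proj_le_right[of q "a\<^sup>+"]
      a p q by (simp_all add: x_def y_def)
  have axy: "a \<cdot> (x \<cdot> y) = (p \<cdot> q) \<cdot> a"
    using assoc[of a x y] assoc[of p a y] assoc[of p q a] ax ay a p q xy by simp
  have xy': "a\<^sup>* \<cdot> (x \<cdot> y) = x \<cdot> y"
    using assoc[of "a\<^sup>*" x y] xy a by simp
  have z: "a\<^sup>* \<cdot> (x \<cdot> y)\<^sup>+ = (x \<cdot> y)\<^sup>+"
    using assoc[of "a\<^sup>*" x "(x \<cdot> y)\<^sup>+"] xy a by simp
  have "((p \<cdot> q)\<^sup>* \<cdot> a)\<^sup>* = (a \<cdot> (x \<cdot> y))\<^sup>*"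
    unfolding axy using ast_mul[of "p \<cdot> q" a] a p q by simp
  also have "\<dots> = (x \<cdot> y)\<^sup>*"
    using ast_mul[of a "x \<cdot> y"] xy' a xy by simp
  finally show "((p \<cdot> q)\<^sup>* \<cdot> a)\<^sup>* = ((p \<cdot> a)\<^sup>* \<cdot> (q \<cdot> a)\<^sup>*)\<^sup>*"
    unfolding x_def y_def .
  have "(p \<cdot> q)\<^sup>+ = (a \<cdot> (x \<cdot> y))\<^sup>+"
    unfolding axy using plus_mul[of "p \<cdot> q" a] proj_le_right[of q "a\<^sup>+"] assoc[of p q "a\<^sup>+"] a p q
    by simp
  then have "(p \<cdot> q)\<^sup>+ \<cdot> a = a \<cdot> (x \<cdot> y)\<^sup>+"
    using plus_shift[of a "x \<cdot> y"] xy' a xy by simp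
  then have "((p \<cdot> q)\<^sup>+ \<cdot> a)\<^sup>* = (x \<cdot> y)\<^sup>+"
    using ast_mul[of a "(x \<cdot> y)\<^sup>+"] z a xy by simp
  then show "((p \<cdot> q)\<^sup>+ \<cdot> a)\<^sup>* = ((p \<cdot> a)\<^sup>* \<cdot> (q \<cdot> a)\<^sup>*)\<^sup>+"
    unfolding x_def y_def .
qed

lemma word_path:
  assumes "ps \<in> projection_paths S"
  shows "word S ps \<in> elems S" "(word S ps)\<^sup>+ = hd ps" "(word S ps)\<^sup>* = last ps"
proof -
  have "word S ps \<in> elems S \<and> (word S ps)\<^sup>+ = hd ps \<and> (word S ps)\<^sup>* = last ps"
    using assms
  proof (induction ps)
    case Nil
    then show ?case by (simp add: projection_paths_def)
  next
    case (Cons p ps)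
    show ?case
    proof (cases ps)
      case Nil
      then show ?thesis
        using Cons.prems by (simp add: projection_paths_def)
    next
      case (Cons q qs)
      have pq: "p \<in> projections S" "q \<in> projections S" "(p \<cdot> q)\<^sup>+ = p" "(p \<cdot> q)\<^sup>* = q"
        and "ps \<in> projection_paths S"
        using Cons.prems \<open>ps = q # qs\<close> by (simp_all add: projection_paths_def)
      then have w: "word S ps \<in> elems S" "(word S ps)\<^sup>+ = q" "(word S ps)\<^sup>* = last ps"
        using Cons.IH \<open>ps = q # qs\<close> by simp_all
      have qw: "q \<cdot> word S ps = word S ps"
        using plus_mul_self[OF w(1)] w(2) by simp
      have "(p \<cdot> word S ps)\<^sup>+ = p"
        using plus_mul[of p "word S ps"] w pq by simp
      moreover have "(p \<cdot> word S ps)\<^sup>* = last ps"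
        using ast_mul[of "p \<cdot> q" "word S ps"] assoc[of p q "word S ps"] qw w pq by simp
      ultimately show ?thesis
        using Cons w pq by simp
    qed
  qed
  then show "word S ps \<in> elems S" "(word S ps)\<^sup>+ = hd ps" "(word S ps)\<^sup>* = last ps"
    by simp_all
qed

lemma word_in: "\<lbrakk>ps \<noteq> []; set ps \<subseteq> elems S\<rbrakk> \<Longrightarrow> word S ps \<in> elems S"
  by (induction ps) auto

lemma word_append:
  "\<lbrakk>ps \<noteq> []; qs \<noteq> []; set ps \<subseteq> elems S; set qs \<subseteq> elems S\<rbrakk> \<Longrightarrow> word S (ps @ qs) = word S ps \<cdot> word S qs"
  by (induction ps) (auto simp: assoc word_in)

lemma word_path_comp:
  assumes "ps \<noteq> []" "qs \<noteq> []" "set ps \<subseteq> projections S" "set qs \<subseteq> projections S" "last ps = hd qs"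
  shows "word S (path_comp ps qs) = word S ps \<cdot> word S qs"
proof -
  obtain x qs' where qs: "qs = x # qs'"
    using assms(2) by (cases qs) auto
  obtain ps' where ps: "ps = ps' @ [x]"
    using assms(1,5) qs by (cases ps rule: rev_cases) auto
  have x: "x \<in> projections S" "set qs' \<subseteq> elems S" "set ps' \<subseteq> elems S"
    using assms qs ps by auto
  have "x \<cdot> word S qs = word S qs"
    using x word_in[of qs'] qs by auto
  then show ?thesis
    using x word_append[of ps' "[x]"] word_append[of ps' qs] word_in[of qs] word_in[of ps']
      assoc[of "word S ps'" x "word S qs"] qs ps
    by (cases "ps' = []") (auto simp: path_comp_def)
qed

text \<open>
  Each vertex of the restricted path can be replaced by the vertex it comes from, since
  \<open>r(rq)\<^sup>* = rq\<close>.
\<close>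

lemma word_path_restrict:
  assumes "r \<in> projections S" "set (p # ps) \<subseteq> projections S" "r \<cdot> p = r"
  shows "word S (path_restrict K r (p # ps)) = r \<cdot> word S (p # ps)"
  using assms
proof (induction ps arbitrary: r p)
  case Nil
  then show ?case by (simp add: path_restrict_def)
next
  case (Cons q ps)
  let ?r = "(r \<cdot> q)\<^sup>*" and ?w = "word S (q # ps)"
  have r: "r \<in> projections S" "p \<in> projections S" "q \<in> projections S" "?r \<in> projections S" "r \<cdot> p = r"
    using Cons.prems by simp_all
  have w: "?w \<in> elems S"
    using Cons.prems by (intro word_in) auto
  have qw: "q \<cdot> ?w = ?w"
    using r word_in[of ps] Cons.prems by (auto simp: subset_iff)
  have "word S (path_restrict K r (p # q # ps)) = r \<cdot> word S (path_restrict K ?r (q # ps))"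
    using r by (simp add: path_restrict_def)
  also have "\<dots> = r \<cdot> (?r \<cdot> ?w)"
    using Cons.IH[of ?r q] Cons.prems r by simp
  also have "\<dots> = r \<cdot> ?w"
    using qw w r by (simp del: word.simps)
  also have "\<dots> = r \<cdot> (p \<cdot> ?w)"
    using assoc[of r p ?w] w r by (simp del: word.simps)
  finally show ?case
    by simp
qed

lemma nu_hom_K:
  assumes a: "a \<in> elems S"
  shows "projection_hom (down K (\<^bold>d\<^bsub>K\<^esub> a)) (ptimes K) (pstar K)
    (down K (\<^bold>r\<^bsub>K\<^esub> a)) (ptimes K) (pstar K) (nu K a)"
proof -
  have down: "down K a\<^sup>+ = {p \<in> projections S. a\<^sup>+ \<cdot> p = p}"
    "down K a\<^sup>* = {p \<in> projections S. a\<^sup>* \<cdot> p = p}"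
    using a by (auto simp: down_def natural_leq_proj)
  have nu: "nu K a p = (p \<cdot> a)\<^sup>*" if "p \<in> projections S" "a\<^sup>+ \<cdot> p = p" for p
    using lrestrict_K[OF a] that by (simp add: nu_def)
  have "a\<^sup>+ \<cdot> (e \<cdot> f)\<^sup>+ = (e \<cdot> f)\<^sup>+" "a\<^sup>+ \<cdot> (e \<cdot> f)\<^sup>* = (e \<cdot> f)\<^sup>*"
    if "e \<in> projections S" "f \<in> projections S" "a\<^sup>+ \<cdot> e = e" "a\<^sup>+ \<cdot> f = f" for e f
    using assoc[of "a\<^sup>+" e "(e \<cdot> f)\<^sup>+"] assoc[of "a\<^sup>+" f "(e \<cdot> f)\<^sup>*"] a that by simp_all
  then show ?thesis
    using ast_restrict_hom[OF a] ast_mul_left[of _ a] a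
    by (auto simp: projection_hom_def down nu)
qed

lemma evaluation_projection_ordered_cat_K: "evaluation_projection_ordered_cat K"
proof -
  interpret K: ordered_cat K
    by (rule ordered_cat_K)
  interpret KP: strong_projection_algebra "obs K" "ptimes K" "pstar K"
    using strong_projection_algebra_projections by simp
  show ?thesis
  proof unfold_locales
    fix p q assume "p \<in> obs K" "q \<in> obs K"
    then show "p \<sqsubseteq>\<^bsub>K\<^esub> q \<longleftrightarrow> proj_leq K p q"
      using natural_leq_proj(1)[of p q] proj_le_iff_plus[of p q] by (auto simp: proj_leq_def)
  next
    fix a assume "a \<in> arr K"
    then show "projection_hom (down K (\<^bold>d\<^bsub>K\<^esub> a)) (ptimes K) (pstar K)
      (down K (\<^bold>r\<^bsub>K\<^esub> a)) (ptimes K) (pstar K) (nu K a)"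
      by (intro nu_hom_K) simp
  next
    show "evaluation K \<in> paths K \<rightarrow>\<^sub>E arr K"
      using word_path(1) by auto
  next
    fix p assume "p \<in> obs K"
    then show "evaluation K [p] = p \<and> evaluation K [p, p] = p"
      by (simp add: projection_paths_def)
  next
    fix ps assume "ps \<in> paths K"
    then show "\<^bold>d\<^bsub>K\<^esub> (evaluation K ps) = hd ps \<and> \<^bold>r\<^bsub>K\<^esub> (evaluation K ps) = last ps"
      using word_path by simp
  next
    fix ps qs assume *: "ps \<in> paths K" "qs \<in> paths K" "last ps = hd qs"
    then have "word S (path_comp ps qs) = word S ps \<cdot> word S qs"
      by (intro word_path_comp) (simp_all add: projection_paths_def)
    then show "evaluation K (path_comp ps qs) = evaluation K ps \<bullet>\<^bsub>K\<^esub> evaluation K qs"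
      using path_comp_paths[OF *] * word_path[of ps] word_path[of qs] by simp
  next
    fix ps qs assume *: "ps \<in> paths K" "qs \<in> paths K" "path_leq K ps qs"
    then obtain r where r: "r \<in> projections S" "proj_leq K r (hd qs)" "ps = path_restrict K r qs"
      by (auto simp: path_leq_def)
    obtain q qs' where qs: "qs = q # qs'" "set qs \<subseteq> projections S"
      using * by (cases qs) (auto simp: projection_paths_def)
    have qr: "q \<cdot> r = r" "r \<cdot> q = r"
      using r qs proj_le_iff_plus[of r q] proj_le_right[of r q] by (simp_all add: proj_leq_def)
    have "hd ps = r"
      using r by (simp add: path_restrict_def)
    moreover have "word S ps = r \<cdot> word S qs"
      using word_path_restrict[OF r(1) _ qr(2)] qs r by simp
    ultimately have "natural_leq S (word S ps) (word S qs)"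
      using word_path[of ps] word_path[of qs] * qs qr by (simp add: natural_leq_def del: word.simps)
    then show "evaluation K ps \<sqsubseteq>\<^bsub>K\<^esub> evaluation K qs"
      using * by simp
  qed
qed

text \<open>
  For a \<open>b\<close>-linked pair both sides of (G2) are equal to the semigroup product \<open>ebf\<close>.
\<close>

lemma chain_projection_ordered_cat_K: "chain_projection_ordered_cat K"
proof -
  interpret K: evaluation_projection_ordered_cat K
    by (rule evaluation_projection_ordered_cat_K)
  show ?thesis
  proof unfold_locales
    fix b e f assume b: "b \<in> arr K" and l: "linked K b e f"
    have bef: "b \<in> elems S" "e \<in> projections S" "f \<in> projections S"
      using b l by (simp_all add: linked_def)
    let ?e1 = "(e \<cdot> b\<^sup>+)\<^sup>*" and ?f1 = "(e \<cdot> b)\<^sup>*" and ?e2 = "(b \<cdot> f)\<^sup>+" and ?f2 = "(b\<^sup>* \<cdot> f)\<^sup>+"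
    have e1: "?e1 \<downharpoonleft>\<^bsub>K\<^esub> b = ?e1 \<cdot> b" "(?e1 \<cdot> b)\<^sup>+ = ?e1" "(?e1 \<cdot> b)\<^sup>* = ?f1"
      using lrestrict_K[of b ?e1] ast_mul[of "e \<cdot> b\<^sup>+" b] assoc[of e "b\<^sup>+" b] plus_mul_self[of b] bef
      by simp_all
    have e2: "?e2 \<downharpoonleft>\<^bsub>K\<^esub> b = ?e2 \<cdot> b" "(?e2 \<cdot> b)\<^sup>+ = ?e2"
      using lrestrict_K[of b ?e2] plus_mul_left[of b f] bef by simp_all
    have f2: "b \<downharpoonright>\<^bsub>K\<^esub> ?f2 = b \<cdot> ?f2" "(b \<cdot> ?f2)\<^sup>* = ?f2" "(b \<cdot> ?f2)\<^sup>+ = ?e2" "?e2 \<cdot> b = b \<cdot> ?f2"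
      using rrestrict_K[of b ?f2] plus_mul[of b "b\<^sup>* \<cdot> f"] plus_shift[of b f] bef by simp_all
    have T: "Theta K b e = ?f1" and D: "Delta K b f = ?e2"
      using e1 f2 bef by (simp_all add: Theta_def Delta_def)
    note F = K.linked_F_left[OF b l] K.linked_F_right[OF b l]
    have p1: "(e \<cdot> ?e1)\<^sup>* = ?e1" "[e, ?e1] \<in> projection_paths S"
      and q1: "(?f1 \<cdot> f)\<^sup>+ = ?f1" "[?f1, f] \<in> projection_paths S"
      and p2: "(e \<cdot> ?e2)\<^sup>* = ?e2" "[e, ?e2] \<in> projection_paths S"
      and q2: "(?f2 \<cdot> f)\<^sup>+ = ?f2" "[?f2, f] \<in> projection_paths S"
      using F bef by (simp_all add: T D projection_paths_def del: proj_plus_absorb proj_ast_absorb)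
    have "lambda K e b f = (e \<cdot> ?e1) \<bullet>\<^bsub>K\<^esub> (?e1 \<cdot> b) \<bullet>\<^bsub>K\<^esub> (?f1 \<cdot> f)"
      using p1 q1 e1 bef by (simp add: lambda_def Let_def T del: proj_plus_absorb proj_ast_absorb)
    also have "\<dots> = ((e \<cdot> ?e1) \<cdot> (?e1 \<cdot> b)) \<cdot> (?f1 \<cdot> f)"
      using p1 q1 e1 ast_mul[of "e \<cdot> ?e1" "?e1 \<cdot> b"] bef
      by (simp del: proj_plus_absorb proj_ast_absorb)
    also have "\<dots> = ((e \<cdot> b) \<cdot> ?f1) \<cdot> f"
      using bef by (simp add: assoc)
    also have "\<dots> = e \<cdot> (b \<cdot> f)"
      using mul_ast_self[of "e \<cdot> b"] assoc[of e b f] bef by simp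
    finally have l1: "lambda K e b f = e \<cdot> (b \<cdot> f)" .
    have "rho K e b f = (e \<cdot> ?e2) \<bullet>\<^bsub>K\<^esub> (?e2 \<cdot> b) \<bullet>\<^bsub>K\<^esub> (?f2 \<cdot> f)"
      using p2 q2 e2 bef by (simp add: rho_def Let_def D del: proj_plus_absorb proj_ast_absorb)
    also have "\<dots> = ((e \<cdot> ?e2) \<cdot> (?e2 \<cdot> b)) \<cdot> (?f2 \<cdot> f)"
        using p2 q2 e2 f2 plus_mul_self[of "b \<cdot> ?f2"] ast_mul[of "e \<cdot> ?e2" "?e2 \<cdot> b"] bef
      by (simp del: proj_plus_absorb proj_ast_absorb)
    also have "\<dots> = e \<cdot> (b \<cdot> f)"
      using bef plus_mul_self[of "b \<cdot> f"] by (simp add: assoc)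
    finally have "rho K e b f = e \<cdot> (b \<cdot> f)" .
    with l1 show "lambda K e b f = rho K e b f" by simp
  qed
qed

end

section \<open>The two constructions are mutually inverse\<close>

context drc_restriction_semigrp
begin

text \<open>
  The bridge between projections \<open>e\<close> and \<open>f\<close> evaluates to their product.
\<close>

lemma plus_mul_ast: "\<lbrakk>e \<in> projections S; f \<in> projections S\<rbrakk> \<Longrightarrow> (e \<cdot> f)\<^sup>+ \<cdot> (e \<cdot> f)\<^sup>* = e \<cdot> f"
  using proj_plus_absorb(5)[of e f "(e \<cdot> f)\<^sup>*"] by simp

lemma chain_mul_K:
  assumes "a \<in> elems S" "b \<in> elems S"
  shows "chain_mul K a b = a \<cdot> b"
proof -
  interpret K: evaluation_projection_ordered_cat K
    by (rule evaluation_projection_ordered_cat_K)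
  let ?p = "(a\<^sup>* \<cdot> b\<^sup>+)\<^sup>+" and ?q = "(a\<^sup>* \<cdot> b\<^sup>+)\<^sup>*"
  have F: "(?p \<cdot> ?q)\<^sup>+ = ?p" "(?p \<cdot> ?q)\<^sup>* = ?q" and pq: "?p \<cdot> ?q = a\<^sup>* \<cdot> b\<^sup>+"
    using plus_mul_ast[of "a\<^sup>*" "b\<^sup>+"] assms by simp_all
  have r: "a \<downharpoonright>\<^bsub>K\<^esub> ?p = a \<cdot> ?p" "(a \<cdot> ?p)\<^sup>* = ?p" "?q \<downharpoonleft>\<^bsub>K\<^esub> b = ?q \<cdot> b" "(?q \<cdot> b)\<^sup>+ = ?q"
    using rrestrict_K[of a ?p] lrestrict_K[of b ?q] assms by simp_all
  have path: "[?p, ?q] \<in> projection_paths S"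
    using assms F by (simp add: projection_paths_def)
  have m: "((a \<cdot> ?p) \<cdot> (?p \<cdot> ?q))\<^sup>* = ?q"
    using ast_mul[of "a \<cdot> ?p" "?p \<cdot> ?q"] r F assms by simp
  have "chain_mul K a b = (a \<cdot> ?p) \<bullet>\<^bsub>K\<^esub> (?p \<cdot> ?q) \<bullet>\<^bsub>K\<^esub> (?q \<cdot> b)"
    using path r assms by (simp add: chain_mul_def Let_def)
  also have "\<dots> = ((a \<cdot> ?p) \<cdot> (?p \<cdot> ?q)) \<cdot> (?q \<cdot> b)"
    using r F m assms by (simp del: proj_plus_absorb proj_ast_absorb)
  also have "\<dots> = a \<cdot> ((?p \<cdot> ?q) \<cdot> b)"
    using assms by (simp add: assoc del: proj_plus_absorb(5) proj_ast_absorb(5))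
  also have "\<dots> = a \<cdot> b"
    unfolding pq using assms by (simp add: assoc plus_mul_self)
  finally show ?thesis .
qed

end

lemma semigrp_of_cat_of_semigrp:
  fixes S :: "'a biunary_semigrp"
  assumes "drc_restriction_semigrp S"
  shows "semigrp_of_cat (cat_of_semigrp S) = S"
proof -
  interpret drc_restriction_semigrp S
    by (rule assms)
  have "(\<lambda>a\<in>elems S. \<lambda>b\<in>elems S. chain_mul K a b) = mul S"
  proof
    fix a
    show "(\<lambda>a\<in>elems S. \<lambda>b\<in>elems S. chain_mul K a b) a = mul S a"
    proof (cases "a \<in> elems S")
      case True
      then have "mul S a \<in> extensional (elems S)"
        using mul_closed by (auto simp: PiE_def)
      then show ?thesis
        using True chain_mul_K by (auto simp: extensional_def)
    next
      case False
      then show ?thesis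
        using mul_closed by (simp add: PiE_def extensional_def)
    qed
  qed
  then show ?thesis
    by (simp add: semigrp_of_cat_def)
qed

context evaluation_projection_ordered_cat
begin

lemma mul_composable:
  assumes "x \<in> arr C" "y \<in> arr C" "\<^bold>r x = \<^bold>d y"
  shows "chain_mul C x y = x \<bullet> y"
proof -
  have "x \<bullet> \<^bold>d y = x"
    using comp_r_id[of x] assms by simp
  moreover have "x \<downharpoonright> \<^bold>d y = x"
    using rrestrict_r[of x] assms by simp
  ultimately show ?thesis
    using assms E1[of "\<^bold>d y"] P.L1[of "\<^bold>d y"] P.R1[of "\<^bold>d y"]
    by (simp add: chain_mul_def)
qed

lemma
  assumes "e \<in> obs C" "f \<in> obs C"
  shows d_mul_obs: "\<^bold>d (chain_mul C e f) = e \<otimes> f" and r_mul_obs: "\<^bold>r (chain_mul C e f) = e \<star> f"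
  using mul_parts(8,9)[of e f] assms by (simp_all add: rrestrict_obs lrestrict_obs)

lemma le_iff_mul:
  assumes "a \<in> arr C" "b \<in> arr C"
  shows "a \<sqsubseteq> b \<longleftrightarrow> chain_mul C (\<^bold>d b) (\<^bold>d a) = \<^bold>d a \<and> chain_mul C (\<^bold>d a) b = a"
proof
  assume "a \<sqsubseteq> b"
  then show "chain_mul C (\<^bold>d b) (\<^bold>d a) = \<^bold>d a \<and> chain_mul C (\<^bold>d a) b = a"
    using O1[of a b] le_eq_lrestrict[of a b] mul_obs_left[of b "\<^bold>d a"] mul_obs_right[of "\<^bold>d b" "\<^bold>d a"]
      rrestrict_obs[of "\<^bold>d a" "\<^bold>d b"] assms by simp
next
  assume *: "chain_mul C (\<^bold>d b) (\<^bold>d a) = \<^bold>d a \<and> chain_mul C (\<^bold>d a) b = a"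
  then have "\<^bold>d a \<sqsubseteq> \<^bold>d b"
    using d_mul_obs[of "\<^bold>d b" "\<^bold>d a"] le_iff[of "\<^bold>d a" "\<^bold>d b"] assms by simp
  then show "a \<sqsubseteq> b"
    using lrestrict_le[of b "\<^bold>d a"] mul_obs_left[of b "\<^bold>d a"] * assms by simp
qed

text \<open>
  An evaluation map is determined by its values on edges, and an edge \<open>[p, q]\<close> is the bridge between
  \<open>p\<close> and \<open>q\<close>. So every path evaluates to the product of its vertices.
\<close>

lemma eval_Cons:
  assumes "p # q # qs \<in> paths C"
  shows "\<epsilon> (p # q # qs) = chain_mul C p (\<epsilon> (q # qs))" "q # qs \<in> paths C"
proof -
  have pq: "p \<in> obs C" "q \<in> obs C" "F_rel C p q" and qs: "q # qs \<in> paths C"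
    using assms by (simp_all add: paths_def)
  note ep = eval_pair[OF pq] and eq = E2[OF qs] eval_arr[OF qs]
  have "\<epsilon> (p # q # qs) = \<epsilon> [p, q] \<bullet> \<epsilon> (q # qs)"
    using E3[OF ep(1) qs] by (simp add: path_comp_def)
  also have "\<dots> = chain_mul C p (\<epsilon> (q # qs))"
  proof -
    have "p \<otimes> q = p" "p \<star> q = q" "p \<downharpoonright> p = p" "p \<bullet> \<epsilon> [p, q] = \<epsilon> [p, q]" "q \<downharpoonleft> \<epsilon> (q # qs) = \<epsilon> (q # qs)"
      using pq ep eq d_comp_id[of "\<epsilon> [p, q]"] lrestrict_d[of "\<epsilon> (q # qs)"] rrestrict_r[of p]
      by (simp_all add: F_rel_def)
    then show ?thesis
      using pq eq by (simp add: chain_mul_def)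
  qed
  finally show "\<epsilon> (p # q # qs) = chain_mul C p (\<epsilon> (q # qs))" .
  show "q # qs \<in> paths C"
    by (rule qs)
qed

end

lemma cat_of_semigrp_of_cat:
  assumes "chain_projection_ordered_cat C"
  shows "cat_of_semigrp (semigrp_of_cat C) = C"
proof -
  interpret chain_projection_ordered_cat C
    by (rule assms)
  let ?S = "semigrp_of_cat C"
  have S: "elems ?S = arr C" "splus ?S = src C" "sast ?S = tgt C"
    and mul: "\<lbrakk>a \<in> arr C; b \<in> arr C\<rbrakk> \<Longrightarrow> a \<cdot>\<^bsub>?S\<^esub> b = chain_mul C a b" for a b
    by (simp_all add: semigrp_of_cat_def)
  have proj: "projections ?S = obs C"
    unfolding projections_def obs_def S by (rule refl)
  have paths: "projection_paths ?S = paths C"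
  proof -
    have "successively (\<lambda>p q. (p \<cdot>\<^bsub>?S\<^esub> q)\<^sup>+\<^bsub>?S\<^esub> = p \<and> (p \<cdot>\<^bsub>?S\<^esub> q)\<^sup>*\<^bsub>?S\<^esub> = q) ps
        \<longleftrightarrow> successively (F_rel C) ps" if "set ps \<subseteq> obs C" for ps
    proof (intro successively_cong refl)
      fix p q assume "p \<in> set ps" "q \<in> set ps"
      then have "p \<in> obs C" "q \<in> obs C"
        using that by auto
      then show "(p \<cdot>\<^bsub>?S\<^esub> q)\<^sup>+\<^bsub>?S\<^esub> = p \<and> (p \<cdot>\<^bsub>?S\<^esub> q)\<^sup>*\<^bsub>?S\<^esub> = q \<longleftrightarrow> F_rel C p q"
        by (simp add: S mul F_rel_def d_mul_obs r_mul_obs)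
    qed
    then show ?thesis
      by (auto simp: projection_paths_def paths_def proj)
  qed
  have word: "word ?S ps = \<epsilon>\<^bsub>C\<^esub> ps" if "ps \<in> paths C" for ps
    using that
  proof (induction ps rule: induct_list012)
    case 1
    then show ?case by (simp add: paths_def)
  next
    case (2 p)
    then show ?case
      using E1[of p] by (simp add: paths_def)
  next
    case (3 p q qs)
    have "p \<in> obs C"
      using 3 by (simp add: paths_def)
    then show ?case
      using eval_Cons[OF 3(3)] 3(2) mul[of p "\<epsilon>\<^bsub>C\<^esub> (q # qs)"] by simp
  qed
  have "pcomp C = (\<lambda>x y. if x \<in> elems ?S \<and> y \<in> elems ?S \<and> x\<^sup>*\<^bsub>?S\<^esub> = y\<^sup>+\<^bsub>?S\<^esub> then Some (x \<cdot>\<^bsub>?S\<^esub> y) else None)"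
    by (intro ext) (simp add: pcomp_eq S mul mul_composable)
  moreover have "leq C = natural_leq ?S"
  proof (intro ext)
    fix a b
    show "a \<sqsubseteq>\<^bsub>C\<^esub> b \<longleftrightarrow> natural_leq ?S a b"
    proof (cases "a \<in> arr C \<and> b \<in> arr C")
      case True
      then show ?thesis
        using le_iff_mul[of a b] by (simp add: natural_leq_def S mul)
    next
      case False
      then show ?thesis
        using le_arr[of a b] by (auto simp: natural_leq_def S)
    qed
  qed
  moreover have "ptimes C = (\<lambda>e\<in>projections ?S. \<lambda>f\<in>projections ?S. (e \<cdot>\<^bsub>?S\<^esub> f)\<^sup>+\<^bsub>?S\<^esub>)"
    using P.times_closed
    by (intro ext) (auto simp: proj S mul d_mul_obs restrict_def PiE_iff extensional_def)
  moreover have "pstar C = (\<lambda>e\<in>projections ?S. \<lambda>f\<in>projections ?S. (e \<cdot>\<^bsub>?S\<^esub> f)\<^sup>*\<^bsub>?S\<^esub>)"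
    using P.star_closed
    by (intro ext) (auto simp: proj S mul r_mul_obs restrict_def PiE_iff extensional_def)
  moreover have "evaluation C = (\<lambda>ps\<in>projection_paths ?S. word ?S ps)"
    using eval_closed by (intro ext) (auto simp: paths word restrict_def PiE_iff extensional_def)
  ultimately show ?thesis
    by (simp add: cat_of_semigrp_def S)
qed

text \<open>
  Functors preserve restrictions, as a restriction is determined by the order and its domain or range.
\<close>

lemma functor_mul:
  assumes C: "chain_projection_ordered_cat C" and D: "chain_projection_ordered_cat D"
    and \<phi>: "chain_projection_ordered_functor C D \<phi>" and ab: "a \<in> arr C" "b \<in> arr C"
  shows "\<phi> (chain_mul C a b) = chain_mul D (\<phi> a) (\<phi> b)"
proof -
  interpret C: chain_projection_ordered_cat C
    by (rule C)
  interpret D: chain_projection_ordered_cat D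
    by (rule D)
  have in_D [simp]: "\<phi> x \<in> arr D" if "x \<in> arr C" for x
    using \<phi> that by (auto simp: chain_projection_ordered_functor_def)
  have d_r [simp]: "\<^bold>d\<^bsub>D\<^esub> (\<phi> x) = \<phi> (\<^bold>d\<^bsub>C\<^esub> x)" "\<^bold>r\<^bsub>D\<^esub> (\<phi> x) = \<phi> (\<^bold>r\<^bsub>C\<^esub> x)" if "x \<in> arr C" for x
    using \<phi> that by (auto simp: chain_projection_ordered_functor_def)
  have comp: "\<phi> (x \<bullet>\<^bsub>C\<^esub> y) = \<phi> x \<bullet>\<^bsub>D\<^esub> \<phi> y" if "x \<in> arr C" "y \<in> arr C" "\<^bold>r\<^bsub>C\<^esub> x = \<^bold>d\<^bsub>C\<^esub> y" for x y
    using \<phi> that by (simp add: chain_projection_ordered_functor_def)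
  have le: "\<phi> x \<sqsubseteq>\<^bsub>D\<^esub> \<phi> y" if "x \<sqsubseteq>\<^bsub>C\<^esub> y" for x y
    using \<phi> that C.le_arr by (simp add: chain_projection_ordered_functor_def)
  have proj: "\<phi> (e \<otimes>\<^bsub>C\<^esub> f) = \<phi> e \<otimes>\<^bsub>D\<^esub> \<phi> f" "\<phi> (e \<star>\<^bsub>C\<^esub> f) = \<phi> e \<star>\<^bsub>D\<^esub> \<phi> f"
    if "e \<in> obs C" "f \<in> obs C" for e f
    using \<phi> that by (simp_all add: chain_projection_ordered_functor_def)
  have eval: "\<phi> (\<epsilon>\<^bsub>C\<^esub> ps) = \<epsilon>\<^bsub>D\<^esub> (map \<phi> ps)" if "ps \<in> paths C" for ps
    using \<phi> that by (simp add: chain_projection_ordered_functor_def)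
  let ?p = "\<^bold>r\<^bsub>C\<^esub> a \<otimes>\<^bsub>C\<^esub> \<^bold>d\<^bsub>C\<^esub> b" and ?q = "\<^bold>r\<^bsub>C\<^esub> a \<star>\<^bsub>C\<^esub> \<^bold>d\<^bsub>C\<^esub> b"
  note m = C.mul_parts[OF ab]
  note ep = C.eval_pair[OF m(1,2,5)]
  have "\<phi> (a \<downharpoonright>\<^bsub>C\<^esub> ?p) = \<phi> a \<downharpoonright>\<^bsub>D\<^esub> \<phi> ?p"
    using D.le_eq_rrestrict[OF le[OF C.rrestrict_le[of a ?p]]] m ab by simp
  moreover have "\<phi> (?q \<downharpoonleft>\<^bsub>C\<^esub> b) = \<phi> ?q \<downharpoonleft>\<^bsub>D\<^esub> \<phi> b"
    using D.le_eq_lrestrict[OF le[OF C.lrestrict_le[of b ?q]]] m ab by simp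
  ultimately show ?thesis
    unfolding m(6) using m(1-5) ep ab eval[OF ep(1)]
    by (simp add: comp C.comp_closed C.rng_comp chain_mul_def Let_def proj)
qed

theorem hom_iff_functor:
  fixes S T :: "'a biunary_semigrp"
  assumes S: "drc_restriction_semigrp S" and T: "drc_restriction_semigrp T"
  shows "hom_211 S T \<phi> \<longleftrightarrow> chain_projection_ordered_functor (cat_of_semigrp S) (cat_of_semigrp T) \<phi>"
proof
  interpret S: drc_restriction_semigrp S
    by (rule S)
  interpret T: drc_restriction_semigrp T
    by (rule T)
  {
    assume hom: "hom_211 S T \<phi>"
    have in_T [simp]: "\<phi> x \<in> elems T" if "x \<in> elems S" for x
      using hom that by (auto simp: hom_211_def)
    have mul [simp]: "\<phi> (x \<cdot>\<^bsub>S\<^esub> y) = \<phi> x \<cdot>\<^bsub>T\<^esub> \<phi> y" if "x \<in> elems S" "y \<in> elems S" for x y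
      using hom that by (simp add: hom_211_def)
    have unary: "(\<phi> x)\<^sup>+\<^bsub>T\<^esub> = \<phi> (x\<^sup>+\<^bsub>S\<^esub>)" "(\<phi> x)\<^sup>*\<^bsub>T\<^esub> = \<phi> (x\<^sup>*\<^bsub>S\<^esub>)" if "x \<in> elems S" for x
      using hom that by (simp_all add: hom_211_def)
    have mul': "\<phi> x \<cdot>\<^bsub>T\<^esub> \<phi> y = \<phi> (x \<cdot>\<^bsub>S\<^esub> y)" if "x \<in> elems S" "y \<in> elems S" for x y
      using that by simp
    have proj [simp]: "\<phi> e \<in> projections T" if "e \<in> projections S" for e
      using unary(1)[of e] that by (intro T.proj_iff[THEN iffD2] conjI) simp_all
    have leq: "natural_leq T (\<phi> a) (\<phi> b)" if "natural_leq S a b" for a b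
      using that by (simp add: natural_leq_def unary mul' del: mul)
    have word: "map \<phi> ps \<in> projection_paths T \<and> \<phi> (word S ps) = word T (map \<phi> ps)"
      if "ps \<in> projection_paths S" for ps
      using that
    proof (induction ps rule: induct_list012)
      case 1
      then show ?case by (simp add: projection_paths_def)
    next
      case (2 p)
      then show ?case by (simp add: projection_paths_def)
    next
      case (3 p q qs)
      have pq: "p \<in> projections S" "q \<in> projections S" "(p \<cdot>\<^bsub>S\<^esub> q)\<^sup>+\<^bsub>S\<^esub> = p" "(p \<cdot>\<^bsub>S\<^esub> q)\<^sup>*\<^bsub>S\<^esub> = q"
        and qs: "q # qs \<in> projection_paths S"
        using 3(3) by (simp_all add: projection_paths_def)
      have "(\<phi> p \<cdot>\<^bsub>T\<^esub> \<phi> q)\<^sup>+\<^bsub>T\<^esub> = \<phi> p" "(\<phi> p \<cdot>\<^bsub>T\<^esub> \<phi> q)\<^sup>*\<^bsub>T\<^esub> = \<phi> q"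
        using pq by (simp_all add: unary mul' del: mul)
      moreover have "word S (q # qs) \<in> elems S"
        using S.word_path(1)[OF qs] .
      ultimately show ?case
        using 3(2)[OF qs] pq by (auto simp: projection_paths_def simp del: word.simps)
          (simp add: word.simps)
    qed
    show "chain_projection_ordered_functor (cat_of_semigrp S) (cat_of_semigrp T) \<phi>"
      unfolding chain_projection_ordered_functor_def
      using leq word by (auto simp: unary mul' simp del: mul)
  next
    assume \<phi>: "chain_projection_ordered_functor (cat_of_semigrp S) (cat_of_semigrp T) \<phi>"
    have "\<phi> (x \<cdot>\<^bsub>S\<^esub> y) = \<phi> x \<cdot>\<^bsub>T\<^esub> \<phi> y" if "x \<in> elems S" "y \<in> elems S" for x y
    proof -
      have "\<phi> x \<in> elems T" "\<phi> y \<in> elems T"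
        using \<phi> that by (auto simp: chain_projection_ordered_functor_def)
      then show ?thesis
        using functor_mul[OF S.chain_projection_ordered_cat_K T.chain_projection_ordered_cat_K \<phi>, of x y] that
        by (simp add: S.chain_mul_K T.chain_mul_K)
    qed
    then show "hom_211 S T \<phi>"
      using \<phi> by (auto simp: chain_projection_ordered_functor_def hom_211_def)
  }
qed

section \<open>Symmetry and commutativity\<close>

context P_restriction_semigrp
begin

lemma plus_mul_self: "x \<in> elems S \<Longrightarrow> x\<^sup>+ \<cdot> x = x"
  and plus_mul: "\<lbrakk>x \<in> elems S; y \<in> elems S\<rbrakk> \<Longrightarrow> (x \<cdot> y)\<^sup>+ = (x \<cdot> y\<^sup>+)\<^sup>+"
  and plus_plus_mul: "\<lbrakk>x \<in> elems S; y \<in> elems S\<rbrakk> \<Longrightarrow> (x\<^sup>+ \<cdot> y\<^sup>+)\<^sup>+ = x\<^sup>+ \<cdot> y\<^sup>+ \<cdot> x\<^sup>+"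
  and plus_idem: "x \<in> elems S \<Longrightarrow> x\<^sup>+ \<cdot> x\<^sup>+ = x\<^sup>+"
  and plus_ast: "x \<in> elems S \<Longrightarrow> x\<^sup>+\<^sup>* = x\<^sup>+"
  and mul_ast_self: "x \<in> elems S \<Longrightarrow> x \<cdot> x\<^sup>* = x"
  and ast_mul: "\<lbrakk>x \<in> elems S; y \<in> elems S\<rbrakk> \<Longrightarrow> (x \<cdot> y)\<^sup>* = (x\<^sup>* \<cdot> y)\<^sup>*"
  and ast_ast_mul: "\<lbrakk>x \<in> elems S; y \<in> elems S\<rbrakk> \<Longrightarrow> (x\<^sup>* \<cdot> y\<^sup>*)\<^sup>* = y\<^sup>* \<cdot> x\<^sup>* \<cdot> y\<^sup>*"
  and ast_idem: "x \<in> elems S \<Longrightarrow> x\<^sup>* \<cdot> x\<^sup>* = x\<^sup>*"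
  and ast_plus: "x \<in> elems S \<Longrightarrow> x\<^sup>*\<^sup>+ = x\<^sup>*"
  and plus_shift_P: "\<lbrakk>x \<in> elems S; y \<in> elems S\<rbrakk> \<Longrightarrow> (x \<cdot> y)\<^sup>+ \<cdot> x = x \<cdot> y\<^sup>+ \<cdot> x\<^sup>*"
  and ast_shift_P: "\<lbrakk>x \<in> elems S; y \<in> elems S\<rbrakk> \<Longrightarrow> x \<cdot> (y \<cdot> x)\<^sup>* = x\<^sup>+ \<cdot> y\<^sup>* \<cdot> x"
  using P_restriction_semigrp_axioms unfolding P_restriction_semigrp_def P_restriction_semigrp_axioms_def
  by meson+

lemma is_drc_restriction: "drc_restriction_semigrp S"
proof unfold_locales
  fix x y assume xy: "x \<in> elems S" "y \<in> elems S"
  have p: "(x \<cdot> y)\<^sup>+ = x\<^sup>+ \<cdot> ((x \<cdot> y)\<^sup>+ \<cdot> x\<^sup>+)"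
    using plus_mul[of "x\<^sup>+" "x \<cdot> y"] plus_plus_mul[of x "x \<cdot> y"] assoc[of "x\<^sup>+" x y]
      plus_mul_self[of x] xy by (simp add: assoc)
  show "x\<^sup>+ \<cdot> (x \<cdot> y)\<^sup>+ = (x \<cdot> y)\<^sup>+"
    using p assoc[of "x\<^sup>+" "x\<^sup>+" "(x \<cdot> y)\<^sup>+ \<cdot> x\<^sup>+"] plus_idem[of x] xy by simp
  show "(x \<cdot> y)\<^sup>+ \<cdot> x\<^sup>+ = (x \<cdot> y)\<^sup>+"
    using p plus_idem[of x] xy by (metis assoc mul_in plus_in)
  have a: "(x \<cdot> y)\<^sup>* = y\<^sup>* \<cdot> ((x \<cdot> y)\<^sup>* \<cdot> y\<^sup>*)"
    using ast_mul[of "x \<cdot> y" "y\<^sup>*"] ast_ast_mul[of "x \<cdot> y" y] assoc[of x y "y\<^sup>*"]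
      mul_ast_self[of y] xy by (simp add: assoc)
  show "y\<^sup>* \<cdot> (x \<cdot> y)\<^sup>* = (x \<cdot> y)\<^sup>*"
    using a assoc[of "y\<^sup>*" "y\<^sup>*" "(x \<cdot> y)\<^sup>* \<cdot> y\<^sup>*"] ast_idem[of y] xy by simp
  show "(x \<cdot> y)\<^sup>* \<cdot> y\<^sup>* = (x \<cdot> y)\<^sup>*"
    using a ast_idem[of y] xy by (metis assoc mul_in ast_in)
  have "x \<cdot> (x\<^sup>* \<cdot> y)\<^sup>+ = x \<cdot> (x\<^sup>* \<cdot> (y\<^sup>+ \<cdot> x\<^sup>*))"
    using plus_mul[of "x\<^sup>*" y] plus_plus_mul[of "x\<^sup>*" y] ast_plus[of x] xy by (simp add: assoc)
  also have "\<dots> = (x \<cdot> y)\<^sup>+ \<cdot> x"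
    using plus_shift_P[of x y] assoc[of x "x\<^sup>*" "y\<^sup>+ \<cdot> x\<^sup>*"] mul_ast_self[of x] xy by (simp add: assoc)
  finally show "(x \<cdot> y)\<^sup>+ \<cdot> x = x \<cdot> (x\<^sup>* \<cdot> y)\<^sup>+" ..
  have "(y \<cdot> x\<^sup>+)\<^sup>* \<cdot> x = x\<^sup>+ \<cdot> (y\<^sup>* \<cdot> (x\<^sup>+ \<cdot> x))"
    using ast_mul[of y "x\<^sup>+"] ast_ast_mul[of y "x\<^sup>+"] plus_ast[of x] xy by (simp add: assoc)
  also have "\<dots> = x \<cdot> (y \<cdot> x)\<^sup>*"
    using ast_shift_P[of x y] plus_mul_self[of x] xy by (simp add: assoc)
  finally show "x \<cdot> (y \<cdot> x)\<^sup>* = (y \<cdot> x\<^sup>+)\<^sup>* \<cdot> x" ..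
qed (fact plus_mul_self mul_ast_self plus_mul ast_mul plus_ast ast_plus)+

end

context drc_restriction_semigrp
begin

text \<open>
  Let \<open>p = (ef)\<^sup>+\<close> and \<open>q = (ef)\<^sup>*\<close>. By symmetry the bridge from \<open>f\<close> to \<open>e\<close> is the reverse of the bridge
  from \<open>e\<close> to \<open>f\<close>, so \<open>ef = pq\<close> and \<open>fe = qp\<close>, and \<open>efe = pqqp = p\<close> as \<open>[p, q, p]\<close> evaluates to \<open>p\<close>.
\<close>

lemma P_restrictionI:
  assumes symmetric: "\<And>e f. \<lbrakk>e \<in> projections S; f \<in> projections S\<rbrakk> \<Longrightarrow> (e \<cdot> f)\<^sup>+ = (f \<cdot> e)\<^sup>*"
    and retract: "\<And>p q. \<lbrakk>p \<in> projections S; q \<in> projections S; (p \<cdot> q)\<^sup>+ = p; (p \<cdot> q)\<^sup>* = q\<rbrakk> \<Longrightarrow> p \<cdot> q \<cdot> p = p"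
  shows "P_restriction_semigrp S"
proof -
  have efe: "(e \<cdot> f)\<^sup>+ = e \<cdot> (f \<cdot> e)" "(e \<cdot> f)\<^sup>* = f \<cdot> (e \<cdot> f)"
    if ef: "e \<in> projections S" "f \<in> projections S" for e f
  proof -
    let ?p = "(e \<cdot> f)\<^sup>+" and ?q = "(e \<cdot> f)\<^sup>*"
    have pq: "?p \<cdot> ?q = e \<cdot> f" and qp: "?q \<cdot> ?p = f \<cdot> e"
      using plus_mul_ast[of e f] plus_mul_ast[of f e] symmetric[of e f] symmetric[of f e] ef by simp_all
    have "?p \<cdot> ?q \<cdot> ?p = ?p" "?q \<cdot> ?p \<cdot> ?q = ?q"
      using retract[of ?p ?q] retract[of ?q ?p] symmetric[of e f] symmetric[of f e] pq qp ef
      by (simp_all del: proj_plus_absorb proj_ast_absorb)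
    then have "(?p \<cdot> ?q) \<cdot> (?q \<cdot> ?p) = ?p" "(?q \<cdot> ?p) \<cdot> (?p \<cdot> ?q) = ?q"
      using ef by (simp_all add: assoc del: proj_plus_absorb proj_ast_absorb)
    then show "?p = e \<cdot> (f \<cdot> e)" "?q = f \<cdot> (e \<cdot> f)"
      unfolding pq qp using ef by (simp_all add: assoc)
  qed
  show ?thesis
  proof unfold_locales
    fix x y assume xy: "x \<in> elems S" "y \<in> elems S"
    show "(x\<^sup>+ \<cdot> y\<^sup>+)\<^sup>+ = x\<^sup>+ \<cdot> y\<^sup>+ \<cdot> x\<^sup>+"
      using efe(1)[of "x\<^sup>+" "y\<^sup>+"] xy by (simp add: assoc)
    show "(x\<^sup>* \<cdot> y\<^sup>*)\<^sup>* = y\<^sup>* \<cdot> x\<^sup>* \<cdot> y\<^sup>*"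
      using efe(2)[of "x\<^sup>*" "y\<^sup>*"] xy by (simp add: assoc)
    show "(x \<cdot> y)\<^sup>+ \<cdot> x = x \<cdot> y\<^sup>+ \<cdot> x\<^sup>*"
      using plus_shift[of x y] plus_mul[of "x\<^sup>*" y] efe(1)[of "x\<^sup>*" "y\<^sup>+"] xy by (simp add: assoc)
    show "x \<cdot> (y \<cdot> x)\<^sup>* = x\<^sup>+ \<cdot> y\<^sup>* \<cdot> x"
      using ast_shift[of x y] ast_mul[of y "x\<^sup>+"] efe(2)[of "y\<^sup>*" "x\<^sup>+"] plus_mul_self[of x] xy
      by (simp add: assoc)
  qed (simp_all add: plus_mul_self mul_ast_self plus_ast ast_plus, (fact plus_mul ast_mul)+)
qed

end

lemma P_restriction_iff:
  fixes S :: "'a biunary_semigrp"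
  shows "P_restriction_semigrp S \<longleftrightarrow>
    drc_restriction_semigrp S \<and> symmetric_chain_projection_ordered_cat (cat_of_semigrp S)"
proof (intro iffI conjI; (elim conjE)?)
  assume P: "P_restriction_semigrp S"
  then interpret P_restriction_semigrp S .
  show "drc_restriction_semigrp S"
    by (rule is_drc_restriction)
  then interpret drc_restriction_semigrp S .
  interpret K: chain_projection_ordered_cat K
    by (rule chain_projection_ordered_cat_K)
  have plus: "(e \<cdot>\<^bsub>S\<^esub> f)\<^sup>+\<^bsub>S\<^esub> = e \<cdot>\<^bsub>S\<^esub> f \<cdot>\<^bsub>S\<^esub> e" and ast: "(e \<cdot>\<^bsub>S\<^esub> f)\<^sup>*\<^bsub>S\<^esub> = f \<cdot>\<^bsub>S\<^esub> e \<cdot>\<^bsub>S\<^esub> f"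
    if "e \<in> projections S" "f \<in> projections S" for e f
    using plus_plus_mul[of e f] ast_ast_mul[of e f] that by simp_all
  interpret KP: symmetric_projection_algebra "obs K" "ptimes K" "pstar K"
    using K.projections plus ast
    by (simp add: symmetric_projection_algebra_def symmetric_projection_algebra_axioms_def)
  show "symmetric_chain_projection_ordered_cat K"
  proof unfold_locales
    fix p q assume pq: "p \<in> obs K" "q \<in> obs K" "F_rel K p q"
    then have "[p, q, p] \<in> projection_paths S" "p \<cdot>\<^bsub>S\<^esub> (q \<cdot>\<^bsub>S\<^esub> p) = p"
      using plus[of p q] plus[of q p] ast[of p q] ast[of q p] assoc[of p q p]
      by (simp_all add: projection_paths_def)
    then show "evaluation K [p, q, p] = p"
      by simp
  qed
next
  assume S: "drc_restriction_semigrp S" and K: "symmetric_chain_projection_ordered_cat (cat_of_semigrp S)"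
  interpret drc_restriction_semigrp S
    by (rule S)
  interpret K: symmetric_chain_projection_ordered_cat K
    by (rule K)
  interpret KP: symmetric_projection_algebra "obs K" "ptimes K" "pstar K"
    by (rule K.symmetric_projections)
  show "P_restriction_semigrp S"
  proof (rule P_restrictionI)
    show sym: "(e \<cdot>\<^bsub>S\<^esub> f)\<^sup>+\<^bsub>S\<^esub> = (f \<cdot>\<^bsub>S\<^esub> e)\<^sup>*\<^bsub>S\<^esub>" if "e \<in> projections S" "f \<in> projections S" for e f
      using KP.symmetric[of e f] that by simp
    fix p q
    assume pq: "p \<in> projections S" "q \<in> projections S" "(p \<cdot>\<^bsub>S\<^esub> q)\<^sup>+\<^bsub>S\<^esub> = p" "(p \<cdot>\<^bsub>S\<^esub> q)\<^sup>*\<^bsub>S\<^esub> = q"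
    then have "[p, q, p] \<in> projection_paths S"
      using sym[of p q] sym[of q p] by (simp add: projection_paths_def)
    then show "p \<cdot>\<^bsub>S\<^esub> q \<cdot>\<^bsub>S\<^esub> p = p"
      using K.eval_symmetric[of p q] pq by (simp add: assoc)
  qed
qed

context restriction_semigrp
begin

lemma plus_mul_self: "x \<in> elems S \<Longrightarrow> x\<^sup>+ \<cdot> x = x"
  and plus_comm: "\<lbrakk>x \<in> elems S; y \<in> elems S\<rbrakk> \<Longrightarrow> x\<^sup>+ \<cdot> y\<^sup>+ = y\<^sup>+ \<cdot> x\<^sup>+"
  and plus_plus_mul: "\<lbrakk>x \<in> elems S; y \<in> elems S\<rbrakk> \<Longrightarrow> y\<^sup>+ \<cdot> x\<^sup>+ = (x\<^sup>+ \<cdot> y\<^sup>+)\<^sup>+"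
  and plus_mul_left: "\<lbrakk>x \<in> elems S; y \<in> elems S\<rbrakk> \<Longrightarrow> x\<^sup>+ \<cdot> (x \<cdot> y)\<^sup>+ = (x \<cdot> y)\<^sup>+"
  and plus_mul: "\<lbrakk>x \<in> elems S; y \<in> elems S\<rbrakk> \<Longrightarrow> (x \<cdot> y)\<^sup>+ = (x \<cdot> y\<^sup>+)\<^sup>+"
  and plus_ast: "x \<in> elems S \<Longrightarrow> x\<^sup>+\<^sup>* = x\<^sup>+"
  and mul_ast_self: "x \<in> elems S \<Longrightarrow> x \<cdot> x\<^sup>* = x"
  and ast_comm: "\<lbrakk>x \<in> elems S; y \<in> elems S\<rbrakk> \<Longrightarrow> x\<^sup>* \<cdot> y\<^sup>* = y\<^sup>* \<cdot> x\<^sup>*"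
  and ast_ast_mul: "\<lbrakk>x \<in> elems S; y \<in> elems S\<rbrakk> \<Longrightarrow> y\<^sup>* \<cdot> x\<^sup>* = (x\<^sup>* \<cdot> y\<^sup>*)\<^sup>*"
  and ast_mul_right: "\<lbrakk>x \<in> elems S; y \<in> elems S\<rbrakk> \<Longrightarrow> (x \<cdot> y)\<^sup>* \<cdot> y\<^sup>* = (x \<cdot> y)\<^sup>*"
  and ast_mul: "\<lbrakk>x \<in> elems S; y \<in> elems S\<rbrakk> \<Longrightarrow> (x \<cdot> y)\<^sup>* = (x\<^sup>* \<cdot> y)\<^sup>*"
  and ast_plus: "x \<in> elems S \<Longrightarrow> x\<^sup>*\<^sup>+ = x\<^sup>*"
  and plus_shift_R: "\<lbrakk>x \<in> elems S; y \<in> elems S\<rbrakk> \<Longrightarrow> (x \<cdot> y)\<^sup>+ \<cdot> x = x \<cdot> y\<^sup>+"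
  and ast_shift_R: "\<lbrakk>x \<in> elems S; y \<in> elems S\<rbrakk> \<Longrightarrow> x \<cdot> (y \<cdot> x)\<^sup>* = y\<^sup>* \<cdot> x"
  using restriction_semigrp_axioms unfolding restriction_semigrp_def restriction_semigrp_axioms_def
  by meson+

lemma is_drc_restriction: "drc_restriction_semigrp S"
proof unfold_locales
  fix x y assume xy: "x \<in> elems S" "y \<in> elems S"
  show "(x \<cdot> y)\<^sup>+ \<cdot> x\<^sup>+ = (x \<cdot> y)\<^sup>+"
    using plus_mul_left[of x y] plus_comm[of "x \<cdot> y" x] xy by simp
  show "y\<^sup>* \<cdot> (x \<cdot> y)\<^sup>* = (x \<cdot> y)\<^sup>*"
    using ast_mul_right[of x y] ast_comm[of "x \<cdot> y" y] xy by simp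
  have "(x\<^sup>* \<cdot> y)\<^sup>+ = x\<^sup>* \<cdot> y\<^sup>+"
    using plus_mul[of "x\<^sup>*" y] plus_plus_mul[of "x\<^sup>*" y] plus_comm[of "x\<^sup>*" y] ast_plus[of x] xy by simp
  then show "(x \<cdot> y)\<^sup>+ \<cdot> x = x \<cdot> (x\<^sup>* \<cdot> y)\<^sup>+"
    using plus_shift_R[of x y] assoc[of x "x\<^sup>*" "y\<^sup>+"] mul_ast_self[of x] xy by simp
  have "(y \<cdot> x\<^sup>+)\<^sup>* = y\<^sup>* \<cdot> x\<^sup>+"
    using ast_mul[of y "x\<^sup>+"] ast_ast_mul[of y "x\<^sup>+"] ast_comm[of "x\<^sup>+" y] plus_ast[of x] xy by simp
  then show "x \<cdot> (y \<cdot> x)\<^sup>* = (y \<cdot> x\<^sup>+)\<^sup>* \<cdot> x"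
    using ast_shift_R[of x y] assoc[of "y\<^sup>*" "x\<^sup>+" x] plus_mul_self[of x] xy by simp
qed (fact plus_mul_self mul_ast_self plus_mul ast_mul plus_mul_left ast_mul_right plus_ast ast_plus)+

end

context drc_restriction_semigrp
begin

text \<open>
  For \<open>p = (ef)\<^sup>+\<close> and \<open>q = (ef)\<^sup>*\<close> the hypothesis turns \<open>(pq)\<^sup>+ = p\<close> into \<open>(qp)\<^sup>+ = p\<close>. So \<open>p\<close> lies below
  \<open>q\<close>, and the bridge collapses: \<open>ef = pq = p\<close>.
\<close>

lemma restrictionI:
  assumes comm: "\<And>e f. \<lbrakk>e \<in> projections S; f \<in> projections S\<rbrakk> \<Longrightarrow> (e \<cdot> f)\<^sup>+ = (f \<cdot> e)\<^sup>+"
  shows "restriction_semigrp S"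
proof -
  have plus: "e \<cdot> f = (e \<cdot> f)\<^sup>+" if ef: "e \<in> projections S" "f \<in> projections S" for e f
  proof -
    let ?p = "(e \<cdot> f)\<^sup>+" and ?q = "(e \<cdot> f)\<^sup>*"
    have pq: "?p \<cdot> ?q = e \<cdot> f"
      using plus_mul_ast ef by simp
    have "(?q \<cdot> ?p)\<^sup>+ = ?p"
      using comm[of ?p ?q] pq ef by (simp del: proj_plus_absorb proj_ast_absorb)
    then have "?q \<cdot> ?p = ?p"
      using proj_le_iff_plus[of ?p ?q] ef by simp
    then have "?p \<cdot> ?q = ?p"
      using proj_le_right[of ?p ?q] ef by simp
    then show ?thesis
      using pq by simp
  qed
  have ef: "e \<cdot> f = f \<cdot> e" "(e \<cdot> f)\<^sup>* = e \<cdot> f" if "e \<in> projections S" "f \<in> projections S" for e f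
    using plus[of e f] plus[of f e] comm[of e f] plus_ast[of "e \<cdot> f"] that by (metis proj_in mul_in)+
  show ?thesis
  proof unfold_locales
    fix x y assume xy: "x \<in> elems S" "y \<in> elems S"
    show "x\<^sup>+ \<cdot> y\<^sup>+ = y\<^sup>+ \<cdot> x\<^sup>+" "x\<^sup>* \<cdot> y\<^sup>* = y\<^sup>* \<cdot> x\<^sup>*"
      using ef(1) xy by simp_all
    show "y\<^sup>+ \<cdot> x\<^sup>+ = (x\<^sup>+ \<cdot> y\<^sup>+)\<^sup>+"
      using ef(1)[of "y\<^sup>+" "x\<^sup>+"] plus[of "x\<^sup>+" "y\<^sup>+"] xy by (metis plus_proj)
    show "y\<^sup>* \<cdot> x\<^sup>* = (x\<^sup>* \<cdot> y\<^sup>*)\<^sup>*"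
      using ef(1)[of "y\<^sup>*" "x\<^sup>*"] ef(2)[of "x\<^sup>*" "y\<^sup>*"] xy by (metis ast_proj)
    have "(x\<^sup>* \<cdot> y)\<^sup>+ = x\<^sup>* \<cdot> y\<^sup>+"
      using plus_mul[of "x\<^sup>*" y] plus[of "x\<^sup>*" "y\<^sup>+"] xy by (metis ast_proj plus_proj ast_in)
    then show "(x \<cdot> y)\<^sup>+ \<cdot> x = x \<cdot> y\<^sup>+"
      using plus_shift[of x y] xy by simp
    have "(y \<cdot> x\<^sup>+)\<^sup>* = y\<^sup>* \<cdot> x\<^sup>+"
      using ast_mul[of y "x\<^sup>+"] ef(2)[of "y\<^sup>*" "x\<^sup>+"] xy by (metis ast_proj plus_proj plus_in)
    then show "x \<cdot> (y \<cdot> x)\<^sup>* = y\<^sup>* \<cdot> x"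
      using ast_shift[of x y] assoc[of "y\<^sup>*" "x\<^sup>+" x] plus_mul_self[of x] xy by simp
  qed (fact plus_mul_self mul_ast_self plus_mul ast_mul plus_mul_left ast_mul_right plus_ast ast_plus)+
qed

lemma P_restriction_of_restriction:
  assumes "restriction_semigrp S"
  shows "P_restriction_semigrp S"
proof -
  interpret R: restriction_semigrp S
    by (rule assms)
  have comm: "e \<cdot> f = f \<cdot> e" "(e \<cdot> f)\<^sup>+ = f \<cdot> e"
    if "e \<in> projections S" "f \<in> projections S" for e f
    using R.plus_comm[of e f] R.plus_plus_mul[of e f] that by simp_all
  show ?thesis
  proof (rule P_restrictionI)
    fix e f assume "e \<in> projections S" "f \<in> projections S"
    then show "(e \<cdot> f)\<^sup>+ = (f \<cdot> e)\<^sup>*"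
      using comm[of e f] plus_ast[of "e \<cdot> f"] by simp
  next
    fix p q assume "p \<in> projections S" "q \<in> projections S" "(p \<cdot> q)\<^sup>+ = p"
    then show "p \<cdot> q \<cdot> p = p"
      using comm[of p q] by simp
  qed
qed

end

lemma restriction_iff:
  fixes S :: "'a biunary_semigrp"
  shows "restriction_semigrp S \<longleftrightarrow>
    drc_restriction_semigrp S \<and> commutative_chain_projection_ordered_cat (cat_of_semigrp S)"
proof (intro iffI conjI; (elim conjE)?)
  assume "restriction_semigrp S"
  then interpret restriction_semigrp S .
  show "drc_restriction_semigrp S"
    by (rule is_drc_restriction)
  then interpret drc_restriction_semigrp S .
  interpret K: chain_projection_ordered_cat K
    by (rule chain_projection_ordered_cat_K)
  have "(e \<cdot>\<^bsub>S\<^esub> f)\<^sup>+\<^bsub>S\<^esub> = (f \<cdot>\<^bsub>S\<^esub> e)\<^sup>+\<^bsub>S\<^esub>" if "e \<in> projections S" "f \<in> projections S" for e f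
    using plus_comm[of e f] that by simp
  then interpret KP: commutative_projection_algebra "obs K" "ptimes K" "pstar K"
    using K.projections
    by (simp add: commutative_projection_algebra_def commutative_projection_algebra_axioms_def)
  show "commutative_chain_projection_ordered_cat K"
    by unfold_locales
next
  assume S: "drc_restriction_semigrp S" and K: "commutative_chain_projection_ordered_cat (cat_of_semigrp S)"
  interpret drc_restriction_semigrp S
    by (rule S)
  interpret K: commutative_chain_projection_ordered_cat K
    by (rule K)
  interpret KP: commutative_projection_algebra "obs K" "ptimes K" "pstar K"
    by (rule K.commutative_projections)
  show "restriction_semigrp S"
    using KP.commutative by (intro restrictionI) simp
qed

section \<open>Groupoids and inverses\<close>

text \<open>
  An inverse arrow, in terms of the semigroup.
\<close>

definition is_inv :: "('a, 'm) biunary_semigrp_scheme \<Rightarrow> 'a \<Rightarrow> 'a \<Rightarrow> bool" where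
  "is_inv S x y \<longleftrightarrow> y \<in> elems S \<and> y\<^sup>+\<^bsub>S\<^esub> = x\<^sup>*\<^bsub>S\<^esub> \<and> y\<^sup>*\<^bsub>S\<^esub> = x\<^sup>+\<^bsub>S\<^esub> \<and>
     x \<cdot>\<^bsub>S\<^esub> y = x\<^sup>+\<^bsub>S\<^esub> \<and> y \<cdot>\<^bsub>S\<^esub> x = x\<^sup>*\<^bsub>S\<^esub>"

definition has_inverses :: "('a, 'm) biunary_semigrp_scheme \<Rightarrow> bool" where
  "has_inverses S \<longleftrightarrow> (\<forall>x\<in>elems S. \<exists>y. is_inv S x y)"

definition circ_of_biunary :: "'a biunary_semigrp \<Rightarrow> 'a circ_semigrp" where
  "circ_of_biunary S =
     \<lparr> elems = elems S, mul = mul S, circ = (\<lambda>x\<in>elems S. THE y. is_inv S x y) \<rparr>"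

lemma biunary_of_circ_simps [simp]:
  "elems (biunary_of_circ S) = elems S" "mul (biunary_of_circ S) = mul S"
  "splus (biunary_of_circ S) = (\<lambda>x\<in>elems S. x \<cdot>\<^bsub>S\<^esub> x\<degree>\<^bsub>S\<^esub>)"
  "sast (biunary_of_circ S) = (\<lambda>x\<in>elems S. x\<degree>\<^bsub>S\<^esub> \<cdot>\<^bsub>S\<^esub> x)"
  by (simp_all add: biunary_of_circ_def)

lemma circ_of_biunary_simps [simp]:
  "elems (circ_of_biunary S) = elems S" "mul (circ_of_biunary S) = mul S"
  "circ (circ_of_biunary S) = (\<lambda>x\<in>elems S. THE y. is_inv S x y)"
  by (simp_all add: circ_of_biunary_def)

lemma arrow_groupoid_iff_has_inverses:
  assumes "drc_restriction_semigrp S"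
  shows "arrow_groupoid (cat_of_semigrp S) \<longleftrightarrow> has_inverses S"
proof -
  interpret drc_restriction_semigrp S
    by (rule assms)
  interpret K: ordered_cat K
    by (rule ordered_cat_K)
  have "(\<exists>y\<in>arr K. pcomp K x y = Some (\<^bold>d\<^bsub>K\<^esub> x) \<and> pcomp K y x = Some (\<^bold>r\<^bsub>K\<^esub> x)) \<longleftrightarrow> (\<exists>y. is_inv S x y)"
    if "x \<in> elems S" for x
    using that unfolding is_inv_def cat_of_semigrp_simps by (auto split: if_splits)
  then show ?thesis
    using K.arrow_cat_axioms
    by (auto simp: arrow_groupoid_def arrow_groupoid_axioms_def has_inverses_def)
qed

context drc_restriction_semigrp
begin

lemma is_inv_unique:
  assumes "x \<in> elems S" "is_inv S x y" "is_inv S x z"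
  shows "y = z"
proof -
  have "x\<^sup>* \<cdot> y = z \<cdot> x\<^sup>+"
    using assoc[of z x y] assms by (simp add: is_inv_def)
  then show ?thesis
    using plus_mul_self[of y] mul_ast_self[of z] assms by (simp add: is_inv_def)
qed

lemma the_inv: "\<lbrakk>x \<in> elems S; is_inv S x y\<rbrakk> \<Longrightarrow> (THE z. is_inv S x z) = y"
  using is_inv_unique by blast

end

context generalized_regular_circ_semigrp
begin

lemma mul_in [simp]: "\<lbrakk>x \<in> elems S; y \<in> elems S\<rbrakk> \<Longrightarrow> x \<cdot> y \<in> elems S"
  using mul_closed by auto

lemma circ_in [simp]: "x \<in> elems S \<Longrightarrow> x\<degree> \<in> elems S"
  using circ_closed by auto

lemma mul_circ_mul: "x \<in> elems S \<Longrightarrow> x \<cdot> x\<degree> \<cdot> x = x"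
  and circ_circ [simp]: "x \<in> elems S \<Longrightarrow> x\<degree>\<degree> = x"
  and circ_mul_right: "\<lbrakk>x \<in> elems S; y \<in> elems S\<rbrakk> \<Longrightarrow> (x \<cdot> y)\<degree> = (x \<cdot> y)\<degree> \<cdot> x \<cdot> x\<degree>"
  and circ_mul_left: "\<lbrakk>x \<in> elems S; y \<in> elems S\<rbrakk> \<Longrightarrow> (x \<cdot> y)\<degree> = y\<degree> \<cdot> y \<cdot> (x \<cdot> y)\<degree>"
  and circ_mul_shift: "\<lbrakk>x \<in> elems S; y \<in> elems S\<rbrakk> \<Longrightarrow> (x \<cdot> y)\<degree> \<cdot> x = (x\<degree> \<cdot> x \<cdot> y)\<degree>"
  using generalized_regular_circ_semigrp_axioms
  unfolding generalized_regular_circ_semigrp_def generalized_regular_circ_semigrp_axioms_def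
  by meson+

lemma absorb [simp]:
  assumes "x \<in> elems S"
  shows "x \<cdot> (x\<degree> \<cdot> x) = x" "x\<degree> \<cdot> (x \<cdot> x\<degree>) = x\<degree>"
    and "y \<in> elems S \<Longrightarrow> x \<cdot> (x\<degree> \<cdot> (x \<cdot> y)) = x \<cdot> y"
    and "y \<in> elems S \<Longrightarrow> x\<degree> \<cdot> (x \<cdot> (x\<degree> \<cdot> y)) = x\<degree> \<cdot> y"
proof -
  show 1: "x \<cdot> (x\<degree> \<cdot> x) = x" and 2: "x\<degree> \<cdot> (x \<cdot> x\<degree>) = x\<degree>"
    using mul_circ_mul[of x] mul_circ_mul[of "x\<degree>"] assms by (simp_all add: assoc)
  show "x \<cdot> (x\<degree> \<cdot> (x \<cdot> y)) = x \<cdot> y" if "y \<in> elems S"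
    using arg_cong[OF 1, of "\<lambda>z. z \<cdot> y"] assms that by (simp add: assoc)
  show "x\<degree> \<cdot> (x \<cdot> (x\<degree> \<cdot> y)) = x\<degree> \<cdot> y" if "y \<in> elems S"
    using arg_cong[OF 2, of "\<lambda>z. z \<cdot> y"] assms that by (simp add: assoc)
qed

text \<open>
  The mirror image of the fifth law: applied to \<open>y\<close> and \<open>(xy)\<degree>\<close>, that law shows that
  \<open>(y(xy)\<degree>)\<degree>y = xy\<close>, and applying \<open>\<degree>\<close> once more gives the claim.
\<close>

lemma circ_mul_shift':
  assumes "x \<in> elems S" "y \<in> elems S"
  shows "y \<cdot> (x \<cdot> y)\<degree> = (x \<cdot> y \<cdot> y\<degree>)\<degree>"
proof -
  let ?z = "(x \<cdot> y)\<degree>"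
  have "(y \<cdot> ?z)\<degree> \<cdot> y = x \<cdot> y"
    using circ_mul_shift[of y ?z] circ_mul_left[of x y] assms by simp
  then have "(y \<cdot> ?z)\<degree> = x \<cdot> y \<cdot> y\<degree>"
    using circ_mul_right[of y ?z] assms by simp
  then show ?thesis
    using circ_circ[of "y \<cdot> ?z"] assms by simp
qed

lemma circ_mul_circ [simp]:
  assumes "x \<in> elems S"
  shows "(x \<cdot> x\<degree>)\<degree> = x \<cdot> x\<degree>"
  using circ_mul_shift[of x "x\<degree>"] circ_mul_right[of x "x\<degree>"] assms by (simp add: assoc)

lemma circ_mul_circ' [simp]: "x \<in> elems S \<Longrightarrow> (x\<degree> \<cdot> x)\<degree> = x\<degree> \<cdot> x"
  using circ_mul_circ[of "x\<degree>"] by simp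

end

text \<open>
  The passage to bi-unary semigroups is defined for records without further fields.
\<close>

locale generalized_regular_circ = generalized_regular_circ_semigrp S
  for S :: "'a circ_semigrp" (structure)
begin

lemma is_drc_restriction: "drc_restriction_semigrp (biunary_of_circ S)"
proof unfold_locales
  fix x y assume "x \<in> elems (biunary_of_circ S)" "y \<in> elems (biunary_of_circ S)"
  then have xy: "x \<in> elems S" "y \<in> elems S"
    by simp_all
  let ?z = "(x \<cdot> y)\<degree>"
  have r: "?z \<cdot> (x \<cdot> x\<degree>) = ?z" and l: "y\<degree> \<cdot> (y \<cdot> ?z) = ?z"
    using circ_mul_right[of x y] circ_mul_left[of x y] xy by (simp_all add: assoc)
  have s: "(x\<degree> \<cdot> (x \<cdot> y))\<degree> = ?z \<cdot> x" and s': "(x \<cdot> (y \<cdot> y\<degree>))\<degree> = y \<cdot> ?z"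
    using circ_mul_shift[of x y] circ_mul_shift'[of x y] xy by (simp_all add: assoc)
  have s2: "(y \<cdot> (x \<cdot> x\<degree>))\<degree> = x \<cdot> (y \<cdot> x)\<degree>"
    using circ_mul_shift'[of y x] xy by (simp add: assoc)
  have ext: "?z \<cdot> (x \<cdot> (x\<degree> \<cdot> w)) = ?z \<cdot> w" "y\<degree> \<cdot> (y \<cdot> (?z \<cdot> w)) = ?z \<cdot> w" if "w \<in> elems S" for w
    using arg_cong[OF r, of "\<lambda>z. z \<cdot> w"] arg_cong[OF l, of "\<lambda>z. z \<cdot> w"] xy that by (simp_all add: assoc)
  show "(x \<cdot>\<^bsub>biunary_of_circ S\<^esub> y)\<^sup>+\<^bsub>biunary_of_circ S\<^esub>
      = (x \<cdot>\<^bsub>biunary_of_circ S\<^esub> y\<^sup>+\<^bsub>biunary_of_circ S\<^esub>)\<^sup>+\<^bsub>biunary_of_circ S\<^esub>"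
    using xy s' by (simp add: assoc)
  show "(x \<cdot>\<^bsub>biunary_of_circ S\<^esub> y)\<^sup>*\<^bsub>biunary_of_circ S\<^esub>
      = (x\<^sup>*\<^bsub>biunary_of_circ S\<^esub> \<cdot>\<^bsub>biunary_of_circ S\<^esub> y)\<^sup>*\<^bsub>biunary_of_circ S\<^esub>"
    using xy s by (simp add: assoc)
  show "x\<^sup>+\<^bsub>biunary_of_circ S\<^esub> \<cdot>\<^bsub>biunary_of_circ S\<^esub> (x \<cdot>\<^bsub>biunary_of_circ S\<^esub> y)\<^sup>+\<^bsub>biunary_of_circ S\<^esub>
      = (x \<cdot>\<^bsub>biunary_of_circ S\<^esub> y)\<^sup>+\<^bsub>biunary_of_circ S\<^esub>"
    using xy by (simp add: assoc)
  show "(x \<cdot>\<^bsub>biunary_of_circ S\<^esub> y)\<^sup>+\<^bsub>biunary_of_circ S\<^esub> \<cdot>\<^bsub>biunary_of_circ S\<^esub> x\<^sup>+\<^bsub>biunary_of_circ S\<^esub>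
      = (x \<cdot>\<^bsub>biunary_of_circ S\<^esub> y)\<^sup>+\<^bsub>biunary_of_circ S\<^esub>"
    using xy r by (simp add: assoc)
  show "(x \<cdot>\<^bsub>biunary_of_circ S\<^esub> y)\<^sup>*\<^bsub>biunary_of_circ S\<^esub> \<cdot>\<^bsub>biunary_of_circ S\<^esub> y\<^sup>*\<^bsub>biunary_of_circ S\<^esub>
      = (x \<cdot>\<^bsub>biunary_of_circ S\<^esub> y)\<^sup>*\<^bsub>biunary_of_circ S\<^esub>"
    using xy by (simp add: assoc)
  show "y\<^sup>*\<^bsub>biunary_of_circ S\<^esub> \<cdot>\<^bsub>biunary_of_circ S\<^esub> (x \<cdot>\<^bsub>biunary_of_circ S\<^esub> y)\<^sup>*\<^bsub>biunary_of_circ S\<^esub>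
      = (x \<cdot>\<^bsub>biunary_of_circ S\<^esub> y)\<^sup>*\<^bsub>biunary_of_circ S\<^esub>"
    using xy ext by (simp add: assoc)
  show "(x \<cdot>\<^bsub>biunary_of_circ S\<^esub> y)\<^sup>+\<^bsub>biunary_of_circ S\<^esub> \<cdot>\<^bsub>biunary_of_circ S\<^esub> x
      = x \<cdot>\<^bsub>biunary_of_circ S\<^esub> (x\<^sup>*\<^bsub>biunary_of_circ S\<^esub> \<cdot>\<^bsub>biunary_of_circ S\<^esub> y)\<^sup>+\<^bsub>biunary_of_circ S\<^esub>"
    using xy s by (simp add: assoc)
  show "x \<cdot>\<^bsub>biunary_of_circ S\<^esub> (y \<cdot>\<^bsub>biunary_of_circ S\<^esub> x)\<^sup>*\<^bsub>biunary_of_circ S\<^esub>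
      = (y \<cdot>\<^bsub>biunary_of_circ S\<^esub> x\<^sup>+\<^bsub>biunary_of_circ S\<^esub>)\<^sup>*\<^bsub>biunary_of_circ S\<^esub> \<cdot>\<^bsub>biunary_of_circ S\<^esub> x"
    using xy s2 by (simp add: assoc)
next
  show "elems (biunary_of_circ S) \<noteq> {}"
    using nonempty by simp
  show "mul (biunary_of_circ S) \<in> elems (biunary_of_circ S) \<rightarrow>\<^sub>E elems (biunary_of_circ S) \<rightarrow>\<^sub>E elems (biunary_of_circ S)"
    using mul_closed by simp
qed (simp_all add: assoc)

lemma is_inv_circ: "x \<in> elems S \<Longrightarrow> is_inv (biunary_of_circ S) x x\<degree>"
  by (simp add: is_inv_def)

end

lemma circ_of_biunary_of_circ:
  fixes S :: "'a circ_semigrp"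
  assumes "generalized_regular_circ_semigrp S"
  shows "has_inverses (biunary_of_circ S)" "circ_of_biunary (biunary_of_circ S) = S"
proof -
  interpret generalized_regular_circ S
    by (intro generalized_regular_circ.intro assms)
  interpret B: drc_restriction_semigrp "biunary_of_circ S"
    by (rule is_drc_restriction)
  show "has_inverses (biunary_of_circ S)"
    using is_inv_circ by (auto simp: has_inverses_def)
  have "(\<lambda>x\<in>elems S. THE y. is_inv (biunary_of_circ S) x y) = circ S"
    using B.the_inv is_inv_circ circ_closed by (auto simp: restrict_def PiE_iff extensional_def)
  then show "circ_of_biunary (biunary_of_circ S) = S"
    by (simp add: circ_of_biunary_def)
qed

locale drc_semigrp_with_inverses = drc_restriction_semigrp S for S :: "'a biunary_semigrp" (structure) +
  assumes has_inverses: "has_inverses S"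
begin

definition inv :: "'a \<Rightarrow> 'a" where "inv x = (THE y. is_inv S x y)"

lemma is_inv_inv: "x \<in> elems S \<Longrightarrow> is_inv S x (inv x)"
  using has_inverses the_inv unfolding inv_def has_inverses_def by metis

lemma inv [simp]:
  assumes "x \<in> elems S"
  shows "inv x \<in> elems S" "(inv x)\<^sup>+ = x\<^sup>*" "(inv x)\<^sup>* = x\<^sup>+" "x \<cdot> inv x = x\<^sup>+" "inv x \<cdot> x = x\<^sup>*"
  using is_inv_inv[OF assms] by (simp_all add: is_inv_def)

lemma inv_eqI: "\<lbrakk>x \<in> elems S; is_inv S x y\<rbrakk> \<Longrightarrow> inv x = y"
  using is_inv_unique is_inv_inv by blast

lemma inv_inv [simp]: "x \<in> elems S \<Longrightarrow> inv (inv x) = x"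
  by (rule inv_eqI) (simp_all add: is_inv_def)

text \<open>
  The left-hand side is an inverse of \<open>x\<^sup>*y\<close>, because shifting \<open>(xy)\<^sup>+\<close> across \<open>x\<close> computes its range.
\<close>

lemma inv_shift:
  assumes xy: "x \<in> elems S" "y \<in> elems S"
  shows "inv (x \<cdot> y) \<cdot> x = inv (x\<^sup>* \<cdot> y)"
proof -
  let ?z = "inv (x \<cdot> y)" and ?w = "x\<^sup>* \<cdot> y"
  have w: "?w\<^sup>* = (x \<cdot> y)\<^sup>*"
    using ast_mul[of x y] xy by simp
  have z: "?z \<cdot> x\<^sup>+ = ?z" "?z \<cdot> (x \<cdot> y) = (x \<cdot> y)\<^sup>*"
    using mul_ast_self[of ?z] assoc[of ?z "(x \<cdot> y)\<^sup>+" "x\<^sup>+"] plus_mul_right[of x y] xy by simp_all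
  have "(?z \<cdot> x)\<^sup>+ = ?w\<^sup>*"
    using plus_mul[of ?z x] z(1) w xy by simp
  moreover have "(?z \<cdot> x)\<^sup>* = ?w\<^sup>+"
    using ast_mul[of ?z x] ast_mul[of x "?w\<^sup>+"] plus_shift[of x y] xy by simp
  moreover have "(?z \<cdot> x) \<cdot> ?w = ?w\<^sup>*"
    using z(2) w xy by (simp add: assoc)
  moreover have "?w \<cdot> (?z \<cdot> x) = ?w\<^sup>+"
  proof -
    have "?w \<cdot> (?z \<cdot> x) = inv x \<cdot> (((x \<cdot> y) \<cdot> ?z) \<cdot> x)"
      using inv(5)[of x] xy by (simp add: assoc del: inv(4,5) flip: inv(5)[of x])
    also have "\<dots> = inv x \<cdot> (x \<cdot> ?w\<^sup>+)"
      using plus_shift[of x y] xy by simp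
    also have "\<dots> = ?w\<^sup>+"
      using assoc[of "inv x" x "?w\<^sup>+"] xy by simp
    finally show ?thesis .
  qed
  ultimately show ?thesis
    using inv_eqI[of ?w "?z \<cdot> x"] xy by (simp add: is_inv_def)
qed

lemma circ_eq_inv: "circ (circ_of_biunary S) = (\<lambda>x\<in>elems S. inv x)"
  by (simp add: inv_def)

lemma generalized_regular_circ_of_biunary: "generalized_regular_circ_semigrp (circ_of_biunary S)"
proof unfold_locales
  show "elems (circ_of_biunary S) \<noteq> {}"
    using nonempty by simp
  show "mul (circ_of_biunary S)
      \<in> elems (circ_of_biunary S) \<rightarrow>\<^sub>E elems (circ_of_biunary S) \<rightarrow>\<^sub>E elems (circ_of_biunary S)"
    using mul_closed by simp
  show "circ (circ_of_biunary S) \<in> elems (circ_of_biunary S) \<rightarrow>\<^sub>E elems (circ_of_biunary S)"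
    unfolding circ_eq_inv by simp
next
  fix x assume "x \<in> elems (circ_of_biunary S)"
  then show "x \<cdot>\<^bsub>circ_of_biunary S\<^esub> x\<degree>\<^bsub>circ_of_biunary S\<^esub> \<cdot>\<^bsub>circ_of_biunary S\<^esub> x = x"
    and "x\<degree>\<^bsub>circ_of_biunary S\<^esub>\<degree>\<^bsub>circ_of_biunary S\<^esub> = x"
    unfolding circ_eq_inv by (simp_all add: plus_mul_self)
next
  fix x y assume "x \<in> elems (circ_of_biunary S)" "y \<in> elems (circ_of_biunary S)"
  then have xy: "x \<in> elems S" "y \<in> elems S"
    by simp_all
  let ?z = "inv (x \<cdot> y)"
  have z: "?z \<cdot> x\<^sup>+ = ?z" "y\<^sup>* \<cdot> ?z = ?z"
    using mul_ast_self[of ?z] assoc[of ?z "(x \<cdot> y)\<^sup>+" "x\<^sup>+"] plus_mul_right[of x y]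
      plus_mul_self[of ?z] assoc[of "y\<^sup>*" "(x \<cdot> y)\<^sup>*" ?z] ast_mul_left[of x y] xy by simp_all
  show "(x \<cdot>\<^bsub>circ_of_biunary S\<^esub> y)\<degree>\<^bsub>circ_of_biunary S\<^esub>
      = (x \<cdot>\<^bsub>circ_of_biunary S\<^esub> y)\<degree>\<^bsub>circ_of_biunary S\<^esub> \<cdot>\<^bsub>circ_of_biunary S\<^esub> x \<cdot>\<^bsub>circ_of_biunary S\<^esub> x\<degree>\<^bsub>circ_of_biunary S\<^esub>"
    unfolding circ_eq_inv using xy z by (simp add: assoc)
  show "(x \<cdot>\<^bsub>circ_of_biunary S\<^esub> y)\<degree>\<^bsub>circ_of_biunary S\<^esub>
      = y\<degree>\<^bsub>circ_of_biunary S\<^esub> \<cdot>\<^bsub>circ_of_biunary S\<^esub> y \<cdot>\<^bsub>circ_of_biunary S\<^esub> (x \<cdot>\<^bsub>circ_of_biunary S\<^esub> y)\<degree>\<^bsub>circ_of_biunary S\<^esub>"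
    unfolding circ_eq_inv using xy z by simp
  show "(x \<cdot>\<^bsub>circ_of_biunary S\<^esub> y)\<degree>\<^bsub>circ_of_biunary S\<^esub> \<cdot>\<^bsub>circ_of_biunary S\<^esub> x
      = (x\<degree>\<^bsub>circ_of_biunary S\<^esub> \<cdot>\<^bsub>circ_of_biunary S\<^esub> x \<cdot>\<^bsub>circ_of_biunary S\<^esub> y)\<degree>\<^bsub>circ_of_biunary S\<^esub>"
    unfolding circ_eq_inv using xy inv_shift[of x y] by simp
qed (simp add: assoc)

lemma biunary_of_circ_of_biunary: "biunary_of_circ (circ_of_biunary S) = S"
proof -
  have "(\<lambda>x\<in>elems S. x \<cdot> (\<lambda>x\<in>elems S. inv x) x) = splus S"
    using plus_closed by (auto simp: restrict_def PiE_iff extensional_def)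
  moreover have "(\<lambda>x\<in>elems S. (\<lambda>x\<in>elems S. inv x) x \<cdot> x) = sast S"
    using ast_closed by (auto simp: restrict_def PiE_iff extensional_def)
  ultimately show ?thesis
    unfolding biunary_of_circ_def circ_eq_inv by simp
qed

end

section \<open>Regular and inverse semigroups\<close>

lemma regular_circ_imp_generalized:
  assumes "regular_circ_semigrp S"
  shows "generalized_regular_circ_semigrp S"
proof -
  interpret regular_circ_semigrp S
    by (rule assms)
  have [simp]: "x \<cdot>\<^bsub>S\<^esub> y \<in> elems S" "x\<degree>\<^bsub>S\<^esub> \<in> elems S" if "x \<in> elems S" "y \<in> elems S" for x y
    using mul_closed circ_closed that by auto
  have ax: "x \<cdot>\<^bsub>S\<^esub> x\<degree>\<^bsub>S\<^esub> \<cdot>\<^bsub>S\<^esub> x = x" "x\<degree>\<^bsub>S\<^esub>\<degree>\<^bsub>S\<^esub> = x"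
    "(x \<cdot>\<^bsub>S\<^esub> y)\<degree>\<^bsub>S\<^esub> = y\<degree>\<^bsub>S\<^esub> \<cdot>\<^bsub>S\<^esub> x\<degree>\<^bsub>S\<^esub>" if "x \<in> elems S" "y \<in> elems S" for x y
    using that regular_circ_semigrp_axioms
    unfolding regular_circ_semigrp_def regular_circ_semigrp_axioms_def by meson+
  show ?thesis
  proof unfold_locales
    fix x y assume xy: "x \<in> elems S" "y \<in> elems S"
    have [simp]: "x\<degree>\<^bsub>S\<^esub> \<cdot>\<^bsub>S\<^esub> (x \<cdot>\<^bsub>S\<^esub> x\<degree>\<^bsub>S\<^esub>) = x\<degree>\<^bsub>S\<^esub>" if "x \<in> elems S" for x
      using ax(1)[of "x\<degree>\<^bsub>S\<^esub>" x] ax(2)[of x x] that by (simp add: assoc)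
    have "y\<degree>\<^bsub>S\<^esub> \<cdot>\<^bsub>S\<^esub> (y \<cdot>\<^bsub>S\<^esub> (y\<degree>\<^bsub>S\<^esub> \<cdot>\<^bsub>S\<^esub> x\<degree>\<^bsub>S\<^esub>)) = y\<degree>\<^bsub>S\<^esub> \<cdot>\<^bsub>S\<^esub> (y \<cdot>\<^bsub>S\<^esub> y\<degree>\<^bsub>S\<^esub>) \<cdot>\<^bsub>S\<^esub> x\<degree>\<^bsub>S\<^esub>"
      using xy assoc[of "y\<degree>\<^bsub>S\<^esub>" "y \<cdot>\<^bsub>S\<^esub> y\<degree>\<^bsub>S\<^esub>" "x\<degree>\<^bsub>S\<^esub>"] by (simp add: assoc)
    then show "(x \<cdot>\<^bsub>S\<^esub> y)\<degree>\<^bsub>S\<^esub> = (x \<cdot>\<^bsub>S\<^esub> y)\<degree>\<^bsub>S\<^esub> \<cdot>\<^bsub>S\<^esub> x \<cdot>\<^bsub>S\<^esub> x\<degree>\<^bsub>S\<^esub>"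
      "(x \<cdot>\<^bsub>S\<^esub> y)\<degree>\<^bsub>S\<^esub> = y\<degree>\<^bsub>S\<^esub> \<cdot>\<^bsub>S\<^esub> y \<cdot>\<^bsub>S\<^esub> (x \<cdot>\<^bsub>S\<^esub> y)\<degree>\<^bsub>S\<^esub>"
      using xy ax(3)[of x y] by (simp_all add: assoc)
    show "(x \<cdot>\<^bsub>S\<^esub> y)\<degree>\<^bsub>S\<^esub> \<cdot>\<^bsub>S\<^esub> x = (x\<degree>\<^bsub>S\<^esub> \<cdot>\<^bsub>S\<^esub> x \<cdot>\<^bsub>S\<^esub> y)\<degree>\<^bsub>S\<^esub>"
      using xy ax(2)[of x x] ax(3)[of x y] ax(3)[of "x\<degree>\<^bsub>S\<^esub> \<cdot>\<^bsub>S\<^esub> x" y] ax(3)[of "x\<degree>\<^bsub>S\<^esub>" x] by (simp add: assoc)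
  qed (use ax in blast)+
qed

text \<open>
  Projections are fixed by \<open>\<degree>\<close>, so that \<open>(ef)\<degree> = fe\<close> and \<open>(ef)\<^sup>+ = effe = (fe)\<^sup>*\<close>.
\<close>

lemma P_restriction_of_regular_circ:
  fixes S :: "'a circ_semigrp"
  assumes "regular_circ_semigrp S"
  shows "P_restriction_semigrp (biunary_of_circ S)"
proof -
  interpret generalized_regular_circ S
    by (intro generalized_regular_circ.intro regular_circ_imp_generalized assms)
  interpret B: drc_restriction_semigrp "biunary_of_circ S"
    by (rule is_drc_restriction)
  have ax: "(x \<cdot>\<^bsub>S\<^esub> y)\<degree>\<^bsub>S\<^esub> = y\<degree>\<^bsub>S\<^esub> \<cdot>\<^bsub>S\<^esub> x\<degree>\<^bsub>S\<^esub>" if "x \<in> elems S" "y \<in> elems S" for x y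
    using that assms unfolding regular_circ_semigrp_def regular_circ_semigrp_axioms_def by meson
  have proj: "p \<in> elems S \<and> p\<degree>\<^bsub>S\<^esub> = p \<and> p \<cdot>\<^bsub>S\<^esub> p = p" if "p \<in> projections (biunary_of_circ S)" for p
    using that B.proj_in[OF that] B.proj_idem[OF that] circ_mul_circ by (auto simp: projections_def)
  have efe: "(e \<cdot>\<^bsub>S\<^esub> f) \<cdot>\<^bsub>S\<^esub> (e \<cdot>\<^bsub>S\<^esub> f)\<degree>\<^bsub>S\<^esub> = e \<cdot>\<^bsub>S\<^esub> f \<cdot>\<^bsub>S\<^esub> e" "(f \<cdot>\<^bsub>S\<^esub> e)\<degree>\<^bsub>S\<^esub> \<cdot>\<^bsub>S\<^esub> (f \<cdot>\<^bsub>S\<^esub> e) = e \<cdot>\<^bsub>S\<^esub> f \<cdot>\<^bsub>S\<^esub> e"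
    if "e \<in> projections (biunary_of_circ S)" "f \<in> projections (biunary_of_circ S)" for e f
  proof -
    note e = proj[OF that(1)] and f = proj[OF that(2)]
    have "f \<cdot>\<^bsub>S\<^esub> (f \<cdot>\<^bsub>S\<^esub> e) = f \<cdot>\<^bsub>S\<^esub> e"
      using assoc[of f f e] e f by simp
    then show "(e \<cdot>\<^bsub>S\<^esub> f) \<cdot>\<^bsub>S\<^esub> (e \<cdot>\<^bsub>S\<^esub> f)\<degree>\<^bsub>S\<^esub> = e \<cdot>\<^bsub>S\<^esub> f \<cdot>\<^bsub>S\<^esub> e" "(f \<cdot>\<^bsub>S\<^esub> e)\<degree>\<^bsub>S\<^esub> \<cdot>\<^bsub>S\<^esub> (f \<cdot>\<^bsub>S\<^esub> e) = e \<cdot>\<^bsub>S\<^esub> f \<cdot>\<^bsub>S\<^esub> e"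
      using ax[of e f] ax[of f e] e f by (simp_all add: assoc)
  qed
  show ?thesis
  proof (rule B.P_restrictionI)
    fix e f assume "e \<in> projections (biunary_of_circ S)" "f \<in> projections (biunary_of_circ S)"
    then show "(e \<cdot>\<^bsub>biunary_of_circ S\<^esub> f)\<^sup>+\<^bsub>biunary_of_circ S\<^esub> = (f \<cdot>\<^bsub>biunary_of_circ S\<^esub> e)\<^sup>*\<^bsub>biunary_of_circ S\<^esub>"
      using efe[of e f] proj[of e] proj[of f] by simp
  next
    fix p q assume pq: "p \<in> projections (biunary_of_circ S)" "q \<in> projections (biunary_of_circ S)"
      and "(p \<cdot>\<^bsub>biunary_of_circ S\<^esub> q)\<^sup>+\<^bsub>biunary_of_circ S\<^esub> = p"
    then show "p \<cdot>\<^bsub>biunary_of_circ S\<^esub> q \<cdot>\<^bsub>biunary_of_circ S\<^esub> p = p"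
      using efe(1)[OF pq] proj[OF pq(1)] proj[OF pq(2)] by simp
  qed
qed

lemma restriction_of_inverse:
  fixes S :: "'a circ_semigrp"
  assumes "inverse_semigrp S"
  shows "restriction_semigrp (biunary_of_circ S)"
proof -
  have "regular_circ_semigrp S"
    using assms by (simp add: inverse_semigrp_def)
  then interpret generalized_regular_circ S
    by (intro generalized_regular_circ.intro regular_circ_imp_generalized)
  interpret B: drc_restriction_semigrp "biunary_of_circ S"
    by (rule is_drc_restriction)
  have ax: "x \<cdot>\<^bsub>S\<^esub> x\<degree>\<^bsub>S\<^esub> \<cdot>\<^bsub>S\<^esub> y \<cdot>\<^bsub>S\<^esub> y\<degree>\<^bsub>S\<^esub> = y \<cdot>\<^bsub>S\<^esub> y\<degree>\<^bsub>S\<^esub> \<cdot>\<^bsub>S\<^esub> x \<cdot>\<^bsub>S\<^esub> x\<degree>\<^bsub>S\<^esub>" if "x \<in> elems S" "y \<in> elems S" for x y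
    using that assms unfolding inverse_semigrp_def inverse_semigrp_axioms_def by meson
  show ?thesis
  proof (rule B.restrictionI)
    fix e f assume "e \<in> projections (biunary_of_circ S)" "f \<in> projections (biunary_of_circ S)"
    then obtain x y where "x \<in> elems S" "y \<in> elems S" "e = x \<cdot>\<^bsub>S\<^esub> x\<degree>\<^bsub>S\<^esub>" "f = y \<cdot>\<^bsub>S\<^esub> y\<degree>\<^bsub>S\<^esub>"
      by (auto simp: projections_def)
    then have "e \<cdot>\<^bsub>S\<^esub> f = f \<cdot>\<^bsub>S\<^esub> e"
      using ax[of x y] by (simp add: assoc)
    then show "(e \<cdot>\<^bsub>biunary_of_circ S\<^esub> f)\<^sup>+\<^bsub>biunary_of_circ S\<^esub> = (f \<cdot>\<^bsub>biunary_of_circ S\<^esub> e)\<^sup>+\<^bsub>biunary_of_circ S\<^esub>"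
      by simp
  qed
qed

context drc_semigrp_with_inverses
begin

text \<open>
  The right-hand side is an inverse of \<open>xy\<close>. The equation \<open>(xy)\<^sup>+x = xy\<^sup>+x\<^sup>*\<close> of a \<open>P\<close>-restriction
  semigroup gives \<open>(xy)\<^sup>+ = xy\<^sup>+x\<degree>\<close>, and dually \<open>(xy)\<^sup>* = y\<degree>x\<^sup>*y\<close>.
\<close>

lemma inv_mul:
  assumes P: "P_restriction_semigrp S" and xy: "x \<in> elems S" "y \<in> elems S"
  shows "inv (x \<cdot> y) = inv y \<cdot> inv x"
proof -
  interpret P: P_restriction_semigrp S
    by (rule P)
  let ?z = "inv y \<cdot> inv x"
  have xi: "x\<^sup>* \<cdot> inv x = inv x" and yi: "inv y \<cdot> y\<^sup>+ = inv y"
    using plus_mul_self[of "inv x"] mul_ast_self[of "inv y"] xy by simp_all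
  have yi': "inv y \<cdot> (y\<^sup>+ \<cdot> w) = inv y \<cdot> w" if "w \<in> elems S" for w
    using assoc[of "inv y" "y\<^sup>+" w] yi xy that by simp
  have 1: "(x \<cdot> y) \<cdot> ?z = (x \<cdot> y)\<^sup>+"
  proof -
    have "(x \<cdot> y)\<^sup>+ = ((x \<cdot> y)\<^sup>+ \<cdot> x) \<cdot> inv x"
      using plus_mul_right[of x y] xy by (simp add: assoc)
    also have "\<dots> = x \<cdot> (y\<^sup>+ \<cdot> inv x)"
      using P.plus_shift_P[of x y] xi xy by (simp add: assoc)
    also have "\<dots> = (x \<cdot> y) \<cdot> ?z"
      using assoc[of y "inv y" "inv x"] xy by (simp add: assoc)
    finally show ?thesis ..
  qed
  have 2: "?z \<cdot> (x \<cdot> y) = inv y \<cdot> (x\<^sup>* \<cdot> y)"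
    using assoc[of "inv x" x y] xy by (simp add: assoc)
  have 3: "inv y \<cdot> (x\<^sup>* \<cdot> y) = (x \<cdot> y)\<^sup>*"
  proof -
    have "(x \<cdot> y)\<^sup>* = inv y \<cdot> (y \<cdot> (x \<cdot> y)\<^sup>*)"
      using ast_mul_left[of x y] assoc[of "inv y" y "(x \<cdot> y)\<^sup>*"] xy by simp
    also have "\<dots> = inv y \<cdot> (x\<^sup>* \<cdot> y)"
      using P.ast_shift_P[of y x] yi' xy by (simp add: assoc)
    finally show ?thesis ..
  qed
  have "?z\<^sup>+ = (inv y \<cdot> (y\<^sup>+ \<cdot> x\<^sup>*))\<^sup>+"
    using plus_mul[of "inv y" "inv x"] yi' xy by simp
  also have "\<dots> = (inv y \<cdot> (x\<^sup>* \<cdot> y\<^sup>+))\<^sup>+"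
    using plus_mul[of "inv y" "y\<^sup>+ \<cdot> x\<^sup>*"] P.plus_plus_mul[of y "x\<^sup>*"] yi' xy by (simp add: assoc ast_plus)
  also have "\<dots> = (x \<cdot> y)\<^sup>*"
    using plus_mul[of "inv y \<cdot> x\<^sup>*" y] 3 xy by (simp add: assoc ast_plus)
  finally have 4: "?z\<^sup>+ = (x \<cdot> y)\<^sup>*" .
  have "?z\<^sup>* = ((y\<^sup>+ \<cdot> x\<^sup>*) \<cdot> inv x)\<^sup>*"
    using ast_mul[of "inv y" "inv x"] xi xy by (simp add: assoc)
  also have "\<dots> = (x\<^sup>* \<cdot> (y\<^sup>+ \<cdot> inv x))\<^sup>*"
    using ast_mul[of "y\<^sup>+ \<cdot> x\<^sup>*" "inv x"] P.ast_ast_mul[of "y\<^sup>+" x] xi xy by (simp add: assoc plus_ast)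
  also have "\<dots> = (x \<cdot> (y\<^sup>+ \<cdot> inv x))\<^sup>*"
    using ast_mul[of x "y\<^sup>+ \<cdot> inv x"] xy by simp
  also have "x \<cdot> (y\<^sup>+ \<cdot> inv x) = (x \<cdot> y)\<^sup>+"
    using 1 assoc[of y "inv y" "inv x"] xy by (simp add: assoc)
  finally have "?z\<^sup>* = (x \<cdot> y)\<^sup>+"
    using xy by (simp add: plus_ast)
  then show ?thesis
    using 1 2 3 4 xy by (intro inv_eqI) (simp_all add: is_inv_def)
qed

lemma regular_circ_of_biunary:
  assumes "P_restriction_semigrp S"
  shows "regular_circ_semigrp (circ_of_biunary S)"
proof -
  interpret G: generalized_regular_circ_semigrp "circ_of_biunary S"
    by (rule generalized_regular_circ_of_biunary)
  show ?thesis
  proof unfold_locales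
    fix x y assume "x \<in> elems (circ_of_biunary S)" "y \<in> elems (circ_of_biunary S)"
    then show "(x \<cdot>\<^bsub>circ_of_biunary S\<^esub> y)\<degree>\<^bsub>circ_of_biunary S\<^esub>
        = y\<degree>\<^bsub>circ_of_biunary S\<^esub> \<cdot>\<^bsub>circ_of_biunary S\<^esub> x\<degree>\<^bsub>circ_of_biunary S\<^esub>"
      unfolding circ_eq_inv using inv_mul[OF assms] by simp
  qed (fact G.mul_circ_mul G.circ_circ)+
qed

lemma inverse_of_biunary:
  assumes "restriction_semigrp S"
  shows "inverse_semigrp (circ_of_biunary S)"
proof -
  interpret G: regular_circ_semigrp "circ_of_biunary S"
    by (intro regular_circ_of_biunary P_restriction_of_restriction assms)
  interpret R: restriction_semigrp S
    by (rule assms)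
  show ?thesis
  proof unfold_locales
    fix x y assume "x \<in> elems (circ_of_biunary S)" "y \<in> elems (circ_of_biunary S)"
    then show "x \<cdot>\<^bsub>circ_of_biunary S\<^esub> x\<degree>\<^bsub>circ_of_biunary S\<^esub> \<cdot>\<^bsub>circ_of_biunary S\<^esub> y \<cdot>\<^bsub>circ_of_biunary S\<^esub> y\<degree>\<^bsub>circ_of_biunary S\<^esub>
      = y \<cdot>\<^bsub>circ_of_biunary S\<^esub> y\<degree>\<^bsub>circ_of_biunary S\<^esub> \<cdot>\<^bsub>circ_of_biunary S\<^esub> x \<cdot>\<^bsub>circ_of_biunary S\<^esub> x\<degree>\<^bsub>circ_of_biunary S\<^esub>"
      unfolding circ_eq_inv using R.plus_comm[of x y] assoc[of "x\<^sup>+" y "inv y"] assoc[of "y\<^sup>+" x "inv x"]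
      by simp
  qed
qed

end

section \<open>The isomorphisms of categories\<close>

lemma is_category_structure_category:
  assumes id: "\<And>A. obj A \<Longrightarrow> hom A A (\<lambda>x\<in>car A. x)"
    and comp: "\<And>A B C f g. \<lbrakk>obj A; obj B; obj C; f \<in> car A \<rightarrow>\<^sub>E car B; g \<in> car B \<rightarrow>\<^sub>E car C; hom A B f; hom B C g\<rbrakk>
      \<Longrightarrow> hom A C (compose (car A) g f)"
  shows "is_category (structure_category obj car hom)"
  unfolding is_category_def structure_category_def using id comp
  by (auto simp: compose_def PiE_iff extensional_def restrict_def fun_eq_iff split: prod.splits)

text \<open>
  Morphisms are maps between carriers, so a bijection between the objects that preserves carriers
  and morphism predicates is an isomorphism of categories. The axioms of the second category are
  transported from the first.
\<close>

lemma structure_category_isomorphic: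
  fixes Fo :: "'s \<Rightarrow> 't" and car1 :: "'s \<Rightarrow> 'a set" and car2 :: "'t \<Rightarrow> 'a set"
  assumes Fo: "\<And>A. obj1 A \<Longrightarrow> obj2 (Fo A)" and Go: "\<And>B. obj2 B \<Longrightarrow> obj1 (Go B)"
    and GF: "\<And>A. obj1 A \<Longrightarrow> Go (Fo A) = A" and FG: "\<And>B. obj2 B \<Longrightarrow> Fo (Go B) = B"
    and car: "\<And>A. obj1 A \<Longrightarrow> car2 (Fo A) = car1 A"
    and hom: "\<And>A B f. \<lbrakk>obj1 A; obj1 B\<rbrakk> \<Longrightarrow> hom2 (Fo A) (Fo B) f \<longleftrightarrow> hom1 A B f"
    and id: "\<And>A. obj1 A \<Longrightarrow> hom1 A A (\<lambda>x\<in>car1 A. x)"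
    and comp: "\<And>A B C f g. \<lbrakk>obj1 A; obj1 B; obj1 C; f \<in> car1 A \<rightarrow>\<^sub>E car1 B; g \<in> car1 B \<rightarrow>\<^sub>E car1 C;
      hom1 A B f; hom1 B C g\<rbrakk> \<Longrightarrow> hom1 A C (compose (car1 A) g f)"
  shows "structure_category obj1 car1 hom1 \<cong>\<^sub>C structure_category obj2 car2 hom2"
proof -
  let ?C = "structure_category obj1 car1 hom1" and ?D = "structure_category obj2 car2 hom2"
  let ?Fm = "\<lambda>(A, f, B). (Fo A, f, Fo B)" and ?Gm = "\<lambda>(A, f, B). (Go A, f, Go B)"
  have C: "is_category ?C"
    using id comp by (rule is_category_structure_category)
  have car': "car1 (Go B) = car2 B" if "obj2 B" for B
    using car[OF Go[OF that]] FG[OF that] by simp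
  have hom': "hom1 (Go A) (Go B) f \<longleftrightarrow> hom2 A B f" if "obj2 A" "obj2 B" for A B f
    using hom[OF Go[OF that(1)] Go[OF that(2)]] FG that by simp
  have D: "is_category ?D"
  proof (rule is_category_structure_category)
    fix A assume "obj2 A"
    then show "hom2 A A (\<lambda>x\<in>car2 A. x)"
      using id[of "Go A"] Go hom' car' by simp
  next
    fix A B C f g
    assume "obj2 A" "obj2 B" "obj2 C" "f \<in> car2 A \<rightarrow>\<^sub>E car2 B" "g \<in> car2 B \<rightarrow>\<^sub>E car2 C" "hom2 A B f" "hom2 B C g"
    then show "hom2 A C (compose (car2 A) g f)"
      using comp[of "Go A" "Go B" "Go C" f g] Go hom' car' by simp
  qed
  have F: "is_functor ?C ?D Fo ?Fm"
    using Fo car hom by (auto simp: is_functor_def structure_category_def)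
  have G: "is_functor ?D ?C Go ?Gm"
    using Go car' hom' by (auto simp: is_functor_def structure_category_def)
  have "(\<forall>A\<in>Obj ?C. Go (Fo A) = A) \<and> (\<forall>f\<in>Mor ?C. ?Gm (?Fm f) = f) \<and>
      (\<forall>B\<in>Obj ?D. Fo (Go B) = B) \<and> (\<forall>g\<in>Mor ?D. ?Fm (?Gm g) = g)"
    using GF FG by (auto simp: structure_category_def)
  then show ?thesis
    unfolding isomorphic_categories_def using C D F G by blast
qed

text \<open>
  The correspondence restricted to a class \<open>R\<close> of categories. The maps \<open>U\<close> and \<open>V\<close> translate between the
  given kind of semigroup and its bi-unary form; they are identities if the structure is
  bi-unary already.
\<close>

lemma chain_cat_category_isomorphic:
  fixes U :: "'s \<Rightarrow> 'a biunary_semigrp" and R :: "'a chain_cat \<Rightarrow> bool"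
  assumes U: "\<And>S. obj S \<Longrightarrow> drc_restriction_semigrp (U S) \<and> R (cat_of_semigrp (U S))"
    and VU: "\<And>S. obj S \<Longrightarrow> V (U S) = S" and car: "\<And>S. obj S \<Longrightarrow> elems (U S) = car S"
    and V: "\<And>B. drc_restriction_semigrp B \<Longrightarrow> R (cat_of_semigrp B) \<Longrightarrow> obj (V B) \<and> U (V B) = B"
    and R: "\<And>C. R C \<Longrightarrow> chain_projection_ordered_cat C"
  shows "structure_category obj car (\<lambda>S T. hom_211 (U S) (U T)) \<cong>\<^sub>C chain_cat_category R"
  unfolding chain_cat_category_def
proof (rule structure_category_isomorphic[where Fo = "\<lambda>S. cat_of_semigrp (U S)" and Go = "\<lambda>C. V (semigrp_of_cat C)"])
  fix S assume S: "obj S"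
  show "R (cat_of_semigrp (U S))"
    using U S by blast
  show "V (semigrp_of_cat (cat_of_semigrp (U S))) = S"
    using semigrp_of_cat_of_semigrp U VU S by metis
  show "arr (cat_of_semigrp (U S)) = car S"
    using car S by simp
  interpret drc_restriction_semigrp "U S"
    using U S by blast
  show "hom_211 (U S) (U S) (\<lambda>x\<in>car S. x)"
    unfolding car[OF S, symmetric] hom_211_def by simp
next
  fix C assume C: "R C"
  have "obj (V (semigrp_of_cat C)) \<and> U (V (semigrp_of_cat C)) = semigrp_of_cat C"
    using C drc_restriction_semigrp_of_cat[OF R[OF C]] cat_of_semigrp_of_cat[OF R[OF C]] by (intro V) simp_all
  then show "obj (V (semigrp_of_cat C))" "cat_of_semigrp (U (V (semigrp_of_cat C))) = C"
    using cat_of_semigrp_of_cat[OF R[OF C]] by simp_all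
next
  fix S T f assume "obj S" "obj T"
  then show "chain_projection_ordered_functor (cat_of_semigrp (U S)) (cat_of_semigrp (U T)) f \<longleftrightarrow> hom_211 (U S) (U T) f"
    using hom_iff_functor U by blast
next
  fix S T W f g
  assume S: "obj S" "obj T" and fg: "f \<in> car S \<rightarrow>\<^sub>E car T" "g \<in> car T \<rightarrow>\<^sub>E car W"
    "hom_211 (U S) (U T) f" "hom_211 (U T) (U W) g"
  interpret drc_restriction_semigrp "U S"
    using U S by blast
  show "hom_211 (U S) (U W) (compose (car S) g f)"
    using fg unfolding car[OF S(1), symmetric] car[OF S(2), symmetric] hom_211_def
    by (simp add: compose_eq Pi_iff)
qed


theorem theorem6p12:
  "(circ_semigrp_category (generalized_regular_circ_semigrp :: 'a circ_semigrp \<Rightarrow> bool)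
       \<cong>\<^sub>C chain_cat_category (chain_projection_ordered_groupoid :: 'a chain_cat \<Rightarrow> bool)) \<and>
    (biunary_semigrp_category (P_restriction_semigrp :: 'a biunary_semigrp \<Rightarrow> bool)
       \<cong>\<^sub>C chain_cat_category (symmetric_chain_projection_ordered_cat :: 'a chain_cat \<Rightarrow> bool)) \<and>
    (circ_semigrp_category (regular_circ_semigrp :: 'a circ_semigrp \<Rightarrow> bool)
       \<cong>\<^sub>C chain_cat_category (symmetric_chain_projection_ordered_groupoid :: 'a chain_cat \<Rightarrow> bool)) \<and>
    (biunary_semigrp_category (restriction_semigrp :: 'a biunary_semigrp \<Rightarrow> bool)
       \<cong>\<^sub>C chain_cat_category (commutative_chain_projection_ordered_cat :: 'a chain_cat \<Rightarrow> bool)) \<and>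
    (circ_semigrp_category (inverse_semigrp :: 'a circ_semigrp \<Rightarrow> bool)
       \<cong>\<^sub>C chain_cat_category (commutative_chain_projection_ordered_groupoid :: 'a chain_cat \<Rightarrow> bool))"
proof (intro conjI)
  have biunary: "biunary_semigrp_category obj \<cong>\<^sub>C chain_cat_category R"
    if obj: "\<And>B :: 'a biunary_semigrp. obj B \<longleftrightarrow> drc_restriction_semigrp B \<and> R (cat_of_semigrp B)"
      and R: "\<And>C. R C \<Longrightarrow> chain_projection_ordered_cat C" for obj R
    using chain_cat_category_isomorphic[of obj "\<lambda>B. B" R "\<lambda>B. B" elems] obj R
    by (simp add: biunary_semigrp_category_def)
  show "biunary_semigrp_category (P_restriction_semigrp :: 'a biunary_semigrp \<Rightarrow> bool)
      \<cong>\<^sub>C chain_cat_category (symmetric_chain_projection_ordered_cat :: 'a chain_cat \<Rightarrow> bool)"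
    by (rule biunary) (simp_all add: P_restriction_iff symmetric_chain_projection_ordered_cat_def)
  show "biunary_semigrp_category (restriction_semigrp :: 'a biunary_semigrp \<Rightarrow> bool)
      \<cong>\<^sub>C chain_cat_category (commutative_chain_projection_ordered_cat :: 'a chain_cat \<Rightarrow> bool)"
    by (rule biunary) (simp_all add: restriction_iff commutative_chain_projection_ordered_cat_def)
  have circ: "circ_semigrp_category obj \<cong>\<^sub>C chain_cat_category (\<lambda>C. R C \<and> arrow_groupoid C)"
    if obj: "\<And>S :: 'a circ_semigrp. obj S \<Longrightarrow> generalized_regular_circ_semigrp S \<and> R (cat_of_semigrp (biunary_of_circ S))"
      and B: "\<And>B. \<lbrakk>drc_semigrp_with_inverses B; R (cat_of_semigrp B)\<rbrakk> \<Longrightarrow> obj (circ_of_biunary B)"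
      and R: "\<And>C. R C \<Longrightarrow> chain_projection_ordered_cat C" for obj R
    unfolding circ_semigrp_category_def
  proof (rule chain_cat_category_isomorphic[where V = circ_of_biunary])
    fix S :: "'a circ_semigrp" assume S: "obj S"
    then interpret generalized_regular_circ S
      using obj by (simp add: generalized_regular_circ_def)
    show "drc_restriction_semigrp (biunary_of_circ S) \<and>
        R (cat_of_semigrp (biunary_of_circ S)) \<and> arrow_groupoid (cat_of_semigrp (biunary_of_circ S))"
      using obj[OF S] is_drc_restriction circ_of_biunary_of_circ(1) arrow_groupoid_iff_has_inverses
      by blast
    show "circ_of_biunary (biunary_of_circ S) = S"
      using obj[OF S] circ_of_biunary_of_circ(2) by blast
  next
    fix B :: "'a biunary_semigrp"
    assume D: "drc_restriction_semigrp B" and RB: "R (cat_of_semigrp B) \<and> arrow_groupoid (cat_of_semigrp B)"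
    then interpret drc_semigrp_with_inverses B
      using arrow_groupoid_iff_has_inverses[OF D]
      by (simp add: drc_semigrp_with_inverses_def drc_semigrp_with_inverses_axioms_def)
    show "obj (circ_of_biunary B) \<and> biunary_of_circ (circ_of_biunary B) = B"
      using B biunary_of_circ_of_biunary drc_semigrp_with_inverses_axioms RB by blast
  qed (use R in auto)
  have groupoids: "chain_projection_ordered_groupoid = (\<lambda>C :: 'a chain_cat. chain_projection_ordered_cat C \<and> arrow_groupoid C)"
    "symmetric_chain_projection_ordered_groupoid =
      (\<lambda>C :: 'a chain_cat. symmetric_chain_projection_ordered_cat C \<and> arrow_groupoid C)"
    "commutative_chain_projection_ordered_groupoid =
      (\<lambda>C :: 'a chain_cat. commutative_chain_projection_ordered_cat C \<and> arrow_groupoid C)"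
    by (simp_all add: fun_eq_iff chain_projection_ordered_groupoid_def
        symmetric_chain_projection_ordered_groupoid_def commutative_chain_projection_ordered_groupoid_def)
  show "circ_semigrp_category (generalized_regular_circ_semigrp :: 'a circ_semigrp \<Rightarrow> bool)
      \<cong>\<^sub>C chain_cat_category (chain_projection_ordered_groupoid :: 'a chain_cat \<Rightarrow> bool)"
    unfolding groupoids
    by (rule circ)
      (auto intro: drc_restriction_semigrp.chain_projection_ordered_cat_K generalized_regular_circ.is_drc_restriction
        generalized_regular_circ.intro drc_semigrp_with_inverses.generalized_regular_circ_of_biunary)
  show "circ_semigrp_category (regular_circ_semigrp :: 'a circ_semigrp \<Rightarrow> bool)
      \<cong>\<^sub>C chain_cat_category (symmetric_chain_projection_ordered_groupoid :: 'a chain_cat \<Rightarrow> bool)"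
    unfolding groupoids
  proof (rule circ)
    fix B :: "'a biunary_semigrp"
    assume "drc_semigrp_with_inverses B" "symmetric_chain_projection_ordered_cat (cat_of_semigrp B)"
    then show "regular_circ_semigrp (circ_of_biunary B)"
      using P_restriction_iff[of B] drc_semigrp_with_inverses.regular_circ_of_biunary
      by (auto simp: drc_semigrp_with_inverses_def)
  qed (use regular_circ_imp_generalized P_restriction_of_regular_circ P_restriction_iff
      symmetric_chain_projection_ordered_cat_def in blast)+
  show "circ_semigrp_category (inverse_semigrp :: 'a circ_semigrp \<Rightarrow> bool)
      \<cong>\<^sub>C chain_cat_category (commutative_chain_projection_ordered_groupoid :: 'a chain_cat \<Rightarrow> bool)"
    unfolding groupoids
  proof (rule circ)
    fix B :: "'a biunary_semigrp"
    assume "drc_semigrp_with_inverses B" "commutative_chain_projection_ordered_cat (cat_of_semigrp B)"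
    then show "inverse_semigrp (circ_of_biunary B)"
      using restriction_iff[of B] drc_semigrp_with_inverses.inverse_of_biunary
      by (auto simp: drc_semigrp_with_inverses_def)
  qed (use regular_circ_imp_generalized restriction_of_inverse restriction_iff inverse_semigrp_def
      commutative_chain_projection_ordered_cat_def in blast)+
qed

end
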